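(* Let $X$ be a finite connected symmetric digraph with all $d_v\ge1$, let $\alpha:E(X)\to\Gamma\simeq\mathbb Z_p^d$ be a voltage assignment, and let $U_n$ be the Grover transition matrix on $X_n$. Let $P(A)\in K[A]$ be monic. Then, for every $n\ge0$, the $P$-spectral multiplicity $m_n(P)=\operatorname{ord}_P^*\det(AI_{2lq_n}-U_n)$ satisfies \[ m_n(P)=-q_n\,\chi(X)\operatorname{ord}_P^*(A^2-1)+\sum_{\zeta\in W_n^d}\operatorname{ord}_P^*\mathcal F_X(A,\zeta-1). \] In particular, if $\gcd(P,A^2-1)=1$, then \[ m_n(P)=\sum_{\zeta\in W_n^d}\operatorname{ord}_P^*\mathcal F_X(A,\zeta-1). \]
   Context: Let $p$ be a prime, $d\ge1$, $\overline{\mathbb Q}_p$ a fixed algebraic closure of $\mathbb Q_p$, and $K\subset\overline{\mathbb Q}_p$ a finite extension of $\mathbb Q_p$. $P$-weighted order. Write $P(A)=\prod_{\theta\in\Theta(P)}(A-\theta)^{e_\theta}$ over $\overline{\mathbb Q}_p$, where $\Theta(P)$ is the set of distinct roots. For a nonzero polynomial $F(A)\in\overline{\mathbb Q}_p[A]$ put $\operatorname{ord}_P^*F=\sum_{\theta\in\Theta(P)}e_\theta\operatorname{ord}_{A=\theta}F(A)$, where $\operatorname{ord}_{A=\theta}$ is the order of vanishing at $\theta$. Graphs. A finite symmetric digraph $X$ has a finite vertex set $V(X)=\{v_1,\dots,v_m\}$ and a finite set $E(X)$ of directed edges (loops and multiple edges allowed) with origin $o(e)$, terminus $t(e)$ and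 an inversion $e\mapsto\bar e\ne e$ with $\bar{\bar e}=e$, $o(\bar e)=t(e)$. Put $\#E(X)=2l$, $\chi(X)=m-l$, $d_v=\#\{e:o(e)=v\}$, and let $w(e)=2/d_{o(e)}$ be the Grover weight. Tower. A voltage assignment is a map $\alpha:E(X)\to\Gamma\simeq\mathbb Z_p^d$ with $\alpha(\bar e)=-\alpha(e)$. Let $\Gamma_n=\Gamma/p^n\Gamma$, $q_n=p^{dn}$, $\alpha_n$ the reduction of $\alpha$. $X_n$ has vertex set $V(X)\times\Gamma_n$ and directed edges $(e,g):(o(e),g)\to(t(e),g+\alpha_n(e))$, with $\overline{(e,g)}=(\bar e,g+\alpha_n(e))$. The Grover transition matrix $U_n$, indexed by $E(X_n)$ and of size $2lq_n$, has $(U_n)_{e,f}=\frac{2}{d_{t(f)}}-\delta_{f,\bar e}$ if $t(f)=o(e)$ and $0$ otherwise (degrees taken in $X_n$). Spectral polynomial. For $\gamma\in\Gamma\simeq\mathbb Z_p^d$ put $\tau(\gamma)=\prod_i(1+T_i)^{\gamma_i}\in\mathbb Z_p[[T_1,\dots,T_d]]$. Let $W_{\tau,\alpha}$ be the $m\times m$ matrix with $(i,j)$ entry $\sum_{e:v_i\to v_j}w(e)\tau(\alpha(e))$ and $\mathcal F_X(A,T)=\det\bigl((A^2+1)I_m-AW_{\tau,\alpha}\bigr)$, monic of degree $2m$ in $A$. $W_n=\mu_{p^n}(\overline{\mathbb Q}_p)$; for $\zeta\in W_n^d$, $\zeta-1=(\zeta_1-1,\dots,\zeta_d-1)$, and $\mathcal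 F_X(A,\zeta-1)\in\overline{\mathbb Q}_p[A]$ is the specialization at $T=\zeta-1$. *)

theory Defs
  imports
    "HOL-Algebra.Algebraic_Closure_Type"
    "HOL-Library.Set_Algebras"
    "Berlekamp_Zassenhaus.Finite_Field"
    "Jordan_Normal_Form.Char_Poly"
    "Graph_Theory.Bidirected_Digraph"
    "Graph_Theory.Digraph_Component"
begin

section \<open>The $p$-adic integers and an algebraic closure of $\mathbb{Q}_p$\<close>

text \<open>
  The prime is the cardinality of the index type. A $p$-adic integer is a coherent sequence of
  residues, the \<open>n\<close>-th one being the representative in \<open>{0..<p ^ n}\<close>.
\<close>

typedef (overloaded) 'p :: prime_card padic_int =
  "{x :: nat \<Rightarrow> int. \<forall>n. x (Suc n) mod int CARD('p) ^ n = x n}"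
  by (rule exI[of _ "\<lambda>_. 0"]) simp

setup_lifting type_definition_padic_int

lemma mod_mod_Suc_power: "(a mod (q :: int) ^ Suc n) mod q ^ n = a mod q ^ n"
  by (simp add: mod_mod_cancel)

lemma padic_mod_self:
  assumes "\<forall>n. x (Suc n) mod (q :: int) ^ n = x n"
  shows "x n mod q ^ n = x n"
  using assms by (metis mod_mod_trivial)

instantiation padic_int :: (prime_card) comm_ring_1
begin

lift_definition zero_padic_int :: "'a padic_int" is "\<lambda>_. 0" by simp

lift_definition one_padic_int :: "'a padic_int" is "\<lambda>n. 1 mod int CARD('a) ^ n"
  by (auto simp: mod_mod_Suc_power simp del: power_Suc)

lift_definition plus_padic_int :: "'a padic_int \<Rightarrow> 'a padic_int \<Rightarrow> 'a padic_int"
  is "\<lambda>x y n. (x n + y n) mod int CARD('a) ^ n"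
  by (auto simp: mod_mod_Suc_power simp del: power_Suc) (metis mod_add_eq)

lift_definition minus_padic_int :: "'a padic_int \<Rightarrow> 'a padic_int \<Rightarrow> 'a padic_int"
  is "\<lambda>x y n. (x n - y n) mod int CARD('a) ^ n"
  by (auto simp: mod_mod_Suc_power simp del: power_Suc) (metis mod_diff_eq)

lift_definition uminus_padic_int :: "'a padic_int \<Rightarrow> 'a padic_int"
  is "\<lambda>x n. (- x n) mod int CARD('a) ^ n"
  by (auto simp: mod_mod_Suc_power simp del: power_Suc) (metis mod_minus_eq)

lift_definition times_padic_int :: "'a padic_int \<Rightarrow> 'a padic_int \<Rightarrow> 'a padic_int"
  is "\<lambda>x y n. (x n * y n) mod int CARD('a) ^ n"
  by (auto simp: mod_mod_Suc_power simp del: power_Suc) (metis mod_mult_eq)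

instance
proof
  fix a b c :: "'a padic_int"
  show "a * b * c = a * (b * c)" by transfer (simp add: mod_simps mult.assoc)
  show "a * b = b * a" by transfer (simp add: mult.commute)
  show "1 * a = a" by transfer (auto simp: mod_simps padic_mod_self)
  show "a + b + c = a + (b + c)" by transfer (simp add: mod_simps add.assoc)
  show "a + b = b + a" by transfer (simp add: add.commute)
  show "0 + a = a" by transfer (auto simp: padic_mod_self)
  show "- a + a = 0" by transfer (simp add: mod_simps)
  show "a - b = a + - b" by transfer (simp add: mod_simps)
  show "(a + b) * c = a * c + b * c" by transfer (simp add: mod_simps distrib_right)
  have "(1 :: int) mod int CARD('a) ^ Suc 0 \<noteq> 0"
    using prime_gt_1_nat[OF prime_card[where ?'a = 'a]] by simp
  then show "(0 :: 'a padic_int) \<noteq> 1" by transfer (metis)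
qed

end

lemma padic_zero_iff_dvd:
  assumes "\<forall>n. x (Suc n) mod (q :: int) ^ n = x n"
  shows "q ^ i dvd x (i + j) \<longleftrightarrow> x i = 0"
proof -
  have "x (i + j) mod q ^ i = x i"
  proof (induction j)
    case 0
    show ?case using padic_mod_self[OF assms] by simp
  next
    case (Suc j)
    have "x (i + Suc j) mod q ^ i = x (Suc (i + j)) mod q ^ (i + j) mod q ^ i"
      by (simp add: mod_mod_cancel le_imp_power_dvd)
    with Suc assms show ?case by simp
  qed
  then show ?thesis by (simp add: dvd_eq_mod_eq_0)
qed

instance padic_int :: (prime_card) idom
proof
  fix a b :: "'a padic_int"
  assume "a \<noteq> 0" "b \<noteq> 0"
  then show "a * b \<noteq> 0"
  proof transfer
    fix x y :: "nat \<Rightarrow> int"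
    let ?q = "int CARD('a)"
    assume x: "\<forall>n. x (Suc n) mod ?q ^ n = x n" and y: "\<forall>n. y (Suc n) mod ?q ^ n = y n"
    assume "x \<noteq> (\<lambda>_. 0)" "y \<noteq> (\<lambda>_. 0)"
    then obtain i j where ij: "x i \<noteq> 0" "y j \<noteq> 0" by (auto simp: fun_eq_iff)
    have pr: "prime_elem ?q" using prime_card[where ?'a = 'a] by simp
    have nx: "\<not> ?q ^ i dvd x (i + j)" using padic_zero_iff_dvd[OF x] ij by blast
    have ny: "\<not> ?q ^ j dvd y (i + j)"
      using padic_zero_iff_dvd[OF y, of j i] ij by (simp add: add.commute)
    have "\<not> ?q ^ (i + j) dvd x (i + j) * y (i + j)"
    proof
      assume "?q ^ (i + j) dvd x (i + j) * y (i + j)"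
      then obtain k l where kl: "k + l = i + j" "?q ^ k dvd x (i + j)" "?q ^ l dvd y (i + j)"
        using prime_elem_power_dvd_prod[OF _ pr] by blast
      then have "i \<le> k \<or> j \<le> l" by linarith
      then show False using kl nx ny by (meson dvd_trans le_imp_power_dvd)
    qed
    then show "(\<lambda>n. x n * y n mod ?q ^ n) \<noteq> (\<lambda>_. 0)"
      by (metis dvd_eq_mod_eq_0)
  qed
qed

lemma Rep_of_nat_padic_int:
  "Rep_padic_int (of_nat m :: 'p :: prime_card padic_int) n = int m mod int CARD('p) ^ n"
proof (induction m)
  case 0
  show ?case by (simp add: zero_padic_int.rep_eq)
next
  case (Suc m)
  have "Rep_padic_int (of_nat (Suc m) :: 'p padic_int) n =
        (1 mod int CARD('p) ^ n + int m mod int CARD('p) ^ n) mod int CARD('p) ^ n"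
    using Suc by (simp add: plus_padic_int.rep_eq one_padic_int.rep_eq)
  then show ?case by (simp add: mod_add_eq)
qed

instance padic_int :: (prime_card) ring_char_0
proof
  show "inj (of_nat :: nat \<Rightarrow> 'a padic_int)"
  proof (rule injI)
    fix m n :: nat
    assume eq: "(of_nat m :: 'a padic_int) = of_nat n"
    let ?k = "m + n"
    have gt: "m + n < CARD('a) ^ ?k"
      using power_gt_expt[of "CARD('a)" ?k] prime_gt_1_nat[OF prime_card[where ?'a = 'a]] by simp
    have "int m mod int CARD('a) ^ ?k = int n mod int CARD('a) ^ ?k"
      using eq by (metis Rep_of_nat_padic_int)
    with gt show "m = n"
      by (simp flip: of_nat_power of_nat_mod)
  qed
qed

instance fract :: ("{idom, ring_char_0}") field_char_0
proof
  have "(of_nat n :: 'a fract) = Fract (of_nat n) 1" for n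
    by (rule of_nat_fract)
  then show "inj (of_nat :: nat \<Rightarrow> 'a fract)"
    by (auto simp: inj_def eq_fract)
qed

type_synonym 'p padic_field = "'p padic_int fract"
type_synonym 'p padic_closure = "'p padic_field alg_closure"

definition embed_Zp :: "'p :: prime_card padic_int \<Rightarrow> 'p padic_closure" where
  "embed_Zp a = to_ac (to_fract a)"

definition integral_over_Zp :: "'p :: prime_card padic_closure \<Rightarrow> bool" where
  "integral_over_Zp x \<longleftrightarrow>
     (\<exists>f :: 'p padic_int poly. lead_coeff f = 1 \<and> poly (map_poly embed_Zp f) x = 0)"

definition finite_extension_of_Qp :: "'p :: prime_card padic_closure set \<Rightarrow> bool" where
  "finite_extension_of_Qp K \<longleftrightarrow>
     range to_ac \<subseteq> K \<and>
     (\<forall>x\<in>K. \<forall>y\<in>K. x + y \<in> K \<and> x * y \<in> K \<and> - x \<in> K \<and> inverse x \<in> K) \<and>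
     (\<exists>B. finite B \<and> K = module.span (\<lambda>a x. to_ac a * x) B)"

definition roots_of_unity :: "nat \<Rightarrow> 'p :: prime_card padic_closure set" where
  "roots_of_unity n = {z. z ^ (CARD('p) ^ n) = 1}"


section \<open>Power series in several variables\<close>

text \<open>The variables are indexed by the finite type \<^typ>\<open>'d\<close>, multi-indices are functions
  \<^typ>\<open>'d \<Rightarrow> nat\<close>.\<close>

typedef ('d, 'a) mfps = "UNIV :: (('d \<Rightarrow> nat) \<Rightarrow> 'a) set"
  morphisms mfps_nth Abs_mfps ..

setup_lifting type_definition_mfps

lemma finite_multiindices_le: "finite {i. i \<le> (k :: 'd :: finite \<Rightarrow> nat)}"
proof -
  have "{i. i \<le> k} \<subseteq> (\<Pi>\<^sub>E x\<in>UNIV. {..k x})"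
    by (auto simp: le_fun_def)
  then show ?thesis by (rule finite_subset) (auto intro: finite_PiE)
qed

instantiation mfps :: (finite, comm_ring_1) comm_ring_1
begin

lift_definition zero_mfps :: "('a, 'b) mfps" is "\<lambda>_. 0" .
lift_definition one_mfps :: "('a, 'b) mfps" is "\<lambda>k. if k = (\<lambda>_. 0) then 1 else 0" .
lift_definition plus_mfps :: "('a, 'b) mfps \<Rightarrow> ('a, 'b) mfps \<Rightarrow> ('a, 'b) mfps"
  is "\<lambda>f g k. f k + g k" .
lift_definition minus_mfps :: "('a, 'b) mfps \<Rightarrow> ('a, 'b) mfps \<Rightarrow> ('a, 'b) mfps"
  is "\<lambda>f g k. f k - g k" .
lift_definition uminus_mfps :: "('a, 'b) mfps \<Rightarrow> ('a, 'b) mfps" is "\<lambda>f k. - f k" .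
lift_definition times_mfps :: "('a, 'b) mfps \<Rightarrow> ('a, 'b) mfps \<Rightarrow> ('a, 'b) mfps"
  is "\<lambda>f g k. \<Sum>i\<in>{i. i \<le> k}. f i * g (\<lambda>x. k x - i x)" .

instance
proof
  fix f g h :: "('a, 'b) mfps"
  show "f * g = g * f"
  proof transfer
    fix f g :: "('a \<Rightarrow> nat) \<Rightarrow> 'b"
    show "(\<lambda>k. \<Sum>i\<in>{i. i \<le> k}. f i * g (\<lambda>x. k x - i x)) =
          (\<lambda>k. \<Sum>i\<in>{i. i \<le> k}. g i * f (\<lambda>x. k x - i x))"
    proof
      fix k :: "'a \<Rightarrow> nat"
      show "(\<Sum>i\<in>{i. i \<le> k}. f i * g (\<lambda>x. k x - i x)) =
            (\<Sum>i\<in>{i. i \<le> k}. g i * f (\<lambda>x. k x - i x))"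
        by (rule sum.reindex_bij_witness[of _ "\<lambda>i x. k x - i x" "\<lambda>i x. k x - i x"])
           (auto simp: le_fun_def mult.commute)
    qed
  qed
  show "f * g * h = f * (g * h)"
  proof transfer
    fix f g h :: "('a \<Rightarrow> nat) \<Rightarrow> 'b"
    show "(\<lambda>k. \<Sum>i\<in>{i. i \<le> k}. (\<Sum>j\<in>{j. j \<le> i}. f j * g (\<lambda>x. i x - j x)) * h (\<lambda>x. k x - i x)) =
          (\<lambda>k. \<Sum>i\<in>{i. i \<le> k}. f i *
             (\<Sum>j\<in>{j. j \<le> (\<lambda>x. k x - i x)}. g j * h (\<lambda>x. k x - i x - j x)))"
    proof
      fix k :: "'a \<Rightarrow> nat"
      have "(\<Sum>i\<in>{i. i \<le> k}. (\<Sum>j\<in>{j. j \<le> i}. f j * g (\<lambda>x. i x - j x)) * h (\<lambda>x. k x - i x)) =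
            (\<Sum>(i, j)\<in>Sigma {i. i \<le> k} (\<lambda>i. {j. j \<le> i}).
               f j * g (\<lambda>x. i x - j x) * h (\<lambda>x. k x - i x))"
        by (subst sum.Sigma[symmetric]) (auto simp: finite_multiindices_le sum_distrib_right)
      also have "\<dots> = (\<Sum>(i, j)\<in>Sigma {i. i \<le> k} (\<lambda>i. {j. j \<le> (\<lambda>x. k x - i x)}).
               f i * (g j * h (\<lambda>x. k x - i x - j x)))"
        by (rule sum.reindex_bij_witness
              [of _ "\<lambda>(i, j). (\<lambda>x. i x + j x, i)" "\<lambda>(i, j). (j, \<lambda>x. i x - j x)"])
           (auto simp: le_fun_def fun_eq_iff mult.assoc le_diff_conv2 add.commute
                 intro: order_trans diff_le_mono)
      also have "\<dots> = (\<Sum>i\<in>{i. i \<le> k}. f i *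
             (\<Sum>j\<in>{j. j \<le> (\<lambda>x. k x - i x)}. g j * h (\<lambda>x. k x - i x - j x)))"
        by (subst sum.Sigma[symmetric]) (auto simp: finite_multiindices_le sum_distrib_left)
      finally show "(\<Sum>i\<in>{i. i \<le> k}. (\<Sum>j\<in>{j. j \<le> i}. f j * g (\<lambda>x. i x - j x)) *
              h (\<lambda>x. k x - i x)) = \<dots>" .
    qed
  qed
  show "1 * f = f"
  proof transfer
    fix f :: "('a \<Rightarrow> nat) \<Rightarrow> 'b"
    show "(\<lambda>k. \<Sum>i\<in>{i. i \<le> k}. (if i = (\<lambda>_. 0) then 1 else 0) * f (\<lambda>x. k x - i x)) = f"
    proof
      fix k :: "'a \<Rightarrow> nat"
      have "(\<Sum>i\<in>{i. i \<le> k}. (if i = (\<lambda>_. 0) then 1 else 0) * f (\<lambda>x. k x - i x)) =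
            (\<Sum>i\<in>{i. i \<le> k}. if i = (\<lambda>_. 0) then f k else 0)"
        by (rule sum.cong) auto
      also have "\<dots> = f k"
        using finite_multiindices_le[of k] by (subst sum.delta) (auto simp: le_fun_def)
      finally show "(\<Sum>i\<in>{i. i \<le> k}. (if i = (\<lambda>_. 0) then 1 else 0) * f (\<lambda>x. k x - i x)) = f k" .
    qed
  qed
  show "(f + g) * h = f * h + g * h"
    by transfer (simp add: distrib_right sum.distrib)
  show "f + g + h = f + (g + h)" by transfer (simp add: add.assoc)
  show "f + g = g + f" by transfer (simp add: add.commute)
  show "0 + f = f" by transfer simp
  show "- f + f = 0" by transfer simp
  show "f - g = f + - g" by transfer simp
  show "(0 :: ('a, 'b) mfps) \<noteq> 1" by transfer (metis zero_neq_one)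
qed

end

definition mfps_const :: "'a \<Rightarrow> ('d, 'a :: zero) mfps" where
  "mfps_const c = Abs_mfps (\<lambda>k. if k = (\<lambda>_. 0) then c else 0)"

text \<open>The binomial series $(1 + T_i)^a = \sum_k \binom{a}{k} T_i^k$ for $a \in \mathbb{Z}_p$.
  It has coefficients in $\mathbb{Z}_p$, but is regarded as a series over $\mathbb{Q}_p$, because
  the weights $2 / d_v$ in the matrix below need not be $p$-adic integers.\<close>

definition binomial_series ::
    "'d \<Rightarrow> 'p :: prime_card padic_int \<Rightarrow> ('d, 'p padic_field) mfps" where
  "binomial_series i a =
     Abs_mfps (\<lambda>k. if \<forall>j. j \<noteq> i \<longrightarrow> k j = 0 then to_fract a gchoose k i else 0)"

definition tau :: "('d :: finite \<Rightarrow> 'p :: prime_card padic_int) \<Rightarrow> ('d, 'p padic_field) mfps" where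
  "tau c = (\<Prod>i\<in>UNIV. binomial_series i (c i))"

text \<open>Evaluation at a point of $\overline{\mathbb{Q}}_p^d$, as the limit of the net of finite
  partial sums. The $p$-adic topology of $\overline{\mathbb{Q}}_p$ is given by the neighbourhoods
  $p^N \mathcal{O}$ of $0$, where $\mathcal{O}$ is the valuation ring of $\overline{\mathbb{Q}}_p$,
  that is, the integral closure of $\mathbb{Z}_p$.\<close>

definition mfps_has_value ::
    "('d :: finite, 'p :: prime_card padic_field) mfps \<Rightarrow> ('d \<Rightarrow> 'p padic_closure) \<Rightarrow>
     'p padic_closure \<Rightarrow> bool" where
  "mfps_has_value f t s \<longleftrightarrow>
     (\<forall>N. \<forall>\<^sub>F S in finite_subsets_at_top UNIV.
        integral_over_Zp
          (((\<Sum>k\<in>S. to_ac (mfps_nth f k) * (\<Prod>i\<in>UNIV. t i ^ k i)) - s) / of_nat CARD('p) ^ N))"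

definition mfps_eval ::
    "('d :: finite, 'p :: prime_card padic_field) mfps \<Rightarrow> ('d \<Rightarrow> 'p padic_closure) \<Rightarrow>
     'p padic_closure" where
  "mfps_eval f t = (THE s. mfps_has_value f t s)"


section \<open>The weighted order\<close>

definition ord_star :: "'a :: field poly \<Rightarrow> 'a poly \<Rightarrow> nat" where
  "ord_star P F = (\<Sum>\<theta> | poly P \<theta> = 0. order \<theta> P * order \<theta> F)"


section \<open>The tower and its Grover matrices\<close>

definition multiples :: "nat \<Rightarrow> 'g :: ab_group_add set" where
  "multiples m = range (\<lambda>z. \<Sum>i<m. z)"

definition quotient_group :: "nat \<Rightarrow> 'g :: ab_group_add set set" where
  "quotient_group m = range (\<lambda>x. x +o multiples m)"

text \<open>
  The number \<open>m\<close> is \<open>p ^ n\<close> in the application, so that \<open>quotient_group m\<close> is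
  $\Gamma / p^n \Gamma$, the set of cosets. In the following two definitions, \<open>+\<close> between
  two cosets is their elementwise sum, hence the addition of the quotient group.
\<close>

definition derived_graph ::
    "('v, 'e) pre_digraph \<Rightarrow> ('e \<Rightarrow> 'g :: ab_group_add) \<Rightarrow> nat \<Rightarrow>
     ('v \<times> 'g set, 'e \<times> 'g set) pre_digraph" where
  "derived_graph G \<alpha> m =
     \<lparr> verts = verts G \<times> quotient_group m,
       arcs = arcs G \<times> quotient_group m,
       tail = (\<lambda>(e, g). (tail G e, g)),
       head = (\<lambda>(e, g). (head G e, g + (\<alpha> e +o multiples m))) \<rparr>"

definition derived_rev ::
    "('e \<Rightarrow> 'e) \<Rightarrow> ('e \<Rightarrow> 'g :: ab_group_add) \<Rightarrow> nat \<Rightarrow> 'e \<times> 'g set \<Rightarrow> 'e \<times> 'g set" where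
  "derived_rev rv \<alpha> m = (\<lambda>(e, g). (rv e, g + (\<alpha> e +o multiples m)))"

text \<open>The index sets of the matrices are given by lists enumerating the arcs and the vertices; the
  determinants do not depend on the order.\<close>

definition grover_matrix ::
    "('v, 'e) pre_digraph \<Rightarrow> ('e \<Rightarrow> 'e) \<Rightarrow> 'e list \<Rightarrow> 'a :: field mat" where
  "grover_matrix G rv es = mat (length es) (length es) (\<lambda>(i, j).
     let e = es ! i; f = es ! j in
     if head G f = tail G e
     then 2 / of_nat (out_degree G (head G f)) - (if f = rv e then 1 else 0)
     else 0)"

definition twisted_weight_matrix ::
    "('v, 'e) pre_digraph \<Rightarrow> ('e \<Rightarrow> 'd :: finite \<Rightarrow> 'p :: prime_card padic_int) \<Rightarrow> 'v list \<Rightarrow>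
     ('d, 'p padic_field) mfps mat" where
  "twisted_weight_matrix G \<alpha> vs = mat (length vs) (length vs) (\<lambda>(i, j).
     \<Sum>e | e \<in> arcs G \<and> tail G e = vs ! i \<and> head G e = vs ! j.
       mfps_const (2 / of_nat (out_degree G (tail G e))) * tau (\<alpha> e))"

definition spectral_poly ::
    "('v, 'e) pre_digraph \<Rightarrow> ('e \<Rightarrow> 'd :: finite \<Rightarrow> 'p :: prime_card padic_int) \<Rightarrow> 'v list \<Rightarrow>
     ('d, 'p padic_field) mfps poly" where
  "spectral_poly G \<alpha> vs =
     det ([:1, 0, 1:] \<cdot>\<^sub>m 1\<^sub>m (length vs) -
          [:0, 1:] \<cdot>\<^sub>m map_mat (\<lambda>c. [:c:]) (twisted_weight_matrix G \<alpha> vs))"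

definition specialize ::
    "('d :: finite, 'p :: prime_card padic_field) mfps poly \<Rightarrow> ('d \<Rightarrow> 'p padic_closure) \<Rightarrow>
     'p padic_closure poly" where
  "specialize F t = map_poly (\<lambda>f. mfps_eval f t) F"

definition euler_char :: "('v, 'e) pre_digraph \<Rightarrow> int" where
  "euler_char G = int (card (verts G)) - int (card (arcs G) div 2)"

end

theory Submission
  imports Defs
begin

text \<open>
  Write \<open>J\<close> for the permutation matrix of the inversion of the arcs, so that $U = ST - J$, where \<open>S\<close>
  is the incidence matrix of the tails and \<open>T\<close> that of the heads, weighted by $2 / d_v$. From
  $(x - J)(x + J) = x^2 - 1$, $T(x - J)S = xW - 2$ and Sylvester's determinant identity one obtains
  $\det(x - U)(x^2 - 1)^{\#V} = (x^2 - 1)^{\#E / 2}\det((x^2 + 1) - xW)$ for every finite symmetric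
  digraph. For the derived graph, the characters of $\Gamma / p^n\Gamma$ block diagonalise the last
  determinant; they are indexed by the tuples \<open>\<zeta>\<close> of $p^n$-th roots of unity. The block at \<open>\<zeta>\<close> is
  the specialisation of the spectral polynomial at $T = \zeta - 1$, because the binomial series
  $(1 + T_i)^a$ converges there to $\zeta_i^{a \bmod p^n}$. The claim follows by comparing orders.
\<close>

section \<open>Determinants of matrices indexed by lists\<close>

text \<open>The determinants live in a polynomial ring, where x - J has no inverse. All identities
  are therefore kept free of denominators: both sides carry powers of c = x^2 - 1, det(x - J) is
  computed exactly and cancelled, and the exponent #E / 2 - #V, which may be negative, becomes a
  difference only after passing to integer orders. The analytic obstacle is that a specialisation is
  a limit in the algebraic closure, where no absolute value is at hand: to be close to 0 means to
  stay integral over Z_p after division by p^N. Limits can be added because sums of integral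
  elements are integral. They are unique because only 0 lies in every p^N O, which rests on u / p
  not being integral for a unit u of Z_p. They can be multiplied because each element becomes
  integral after multiplication by some power of p; this also absorbs the denominators of the
  weights 2 / d_v.\<close>

definition imat :: "'a list \<Rightarrow> 'b list \<Rightarrow> ('a \<Rightarrow> 'b \<Rightarrow> 'c) \<Rightarrow> 'c mat" where
  "imat xs ys f = mat (length xs) (length ys) (\<lambda>(i, j). f (xs ! i) (ys ! j))"

lemma imat_carrier [simp]: "imat xs ys f \<in> carrier_mat (length xs) (length ys)"
  by (simp add: imat_def)

lemma dim_imat [simp]:
  "dim_row (imat xs ys f) = length xs" "dim_col (imat xs ys f) = length ys"
  by (simp_all add: imat_def)

lemma imat_index [simp]:
  "i < length xs \<Longrightarrow> j < length ys \<Longrightarrow> imat xs ys f $$ (i, j) = f (xs ! i) (ys ! j)"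
  by (simp add: imat_def)

lemma imat_cong:
  assumes "\<And>x y. x \<in> set xs \<Longrightarrow> y \<in> set ys \<Longrightarrow> f x y = g x y"
  shows "imat xs ys f = imat xs ys g"
  by (rule eq_matI) (auto intro!: assms)

lemma imat_mult:
  fixes f :: "'a \<Rightarrow> 'b \<Rightarrow> 'c :: semiring_0"
  assumes "distinct ys"
  shows "imat xs ys f * imat ys zs g = imat xs zs (\<lambda>x z. \<Sum>y\<in>set ys. f x y * g y z)"
proof (rule eq_matI)
  fix i k
  assume "i < dim_row (imat xs zs (\<lambda>x z. \<Sum>y\<in>set ys. f x y * g y z))"
    and "k < dim_col (imat xs zs (\<lambda>x z. \<Sum>y\<in>set ys. f x y * g y z))"
  then have ik: "i < length xs" "k < length zs" by simp_all
  have "(imat xs ys f * imat ys zs g) $$ (i, k) =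
        (\<Sum>j\<in>{0..<length ys}. f (xs ! i) (ys ! j) * g (ys ! j) (zs ! k))"
    using ik by (simp add: scalar_prod_def)
  also have "\<dots> = (\<Sum>y\<in>set ys. f (xs ! i) y * g y (zs ! k))"
    by (rule sum.reindex_bij_betw, rule bij_betw_nth)
       (use assms in \<open>auto simp: atLeast0LessThan\<close>)
  finally show "(imat xs ys f * imat ys zs g) $$ (i, k) =
      imat xs zs (\<lambda>x z. \<Sum>y\<in>set ys. f x y * g y z) $$ (i, k)"
    using ik by simp
qed simp_all

lemma imat_diagonal:
  assumes "distinct xs"
  shows "imat xs xs (\<lambda>x y. if x = y then c else 0) = c \<cdot>\<^sub>m (1\<^sub>m (length xs) :: 'b :: semiring_1 mat)"
  by (rule eq_matI) (use assms in \<open>auto simp: nth_eq_iff_index_eq\<close>)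

lemma imat_diff: "imat xs ys f - imat xs ys g = imat xs ys (\<lambda>x y. f x y - g x y)"
  by (rule eq_matI) auto

text \<open>Both determinants come from the block matrix with rows (c, A) and (B, 1), once by
  clearing B from the right and once from the left. The powers of \<open>c\<close> stand in for a
  division, so \<open>c\<close> may be any element of the domain.\<close>

lemma sylvester_determinant:
  fixes A :: "'a :: idom mat"
  assumes A: "A \<in> carrier_mat n m" and B: "B \<in> carrier_mat m n"
  shows "c ^ m * det (c \<cdot>\<^sub>m 1\<^sub>m n - A * B) = c ^ n * det (c \<cdot>\<^sub>m 1\<^sub>m m - B * A)"
proof -
  define M where "M = four_block_mat (c \<cdot>\<^sub>m 1\<^sub>m n) A B (1\<^sub>m m)"
  have M: "M \<in> carrier_mat (n + m) (n + m)"
    unfolding M_def by (rule four_block_carrier_mat) auto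
  \<comment> \<open>Clearing B from the left against the block c needs c in the lower corner, as -B
    c + c B = 0. The price is det L = c^m.\<close>
  define L where "L = four_block_mat (1\<^sub>m n) (0\<^sub>m n m) (- B) (c \<cdot>\<^sub>m 1\<^sub>m m)"
  have L: "L \<in> carrier_mat (n + m) (n + m)"
    unfolding L_def by (rule four_block_carrier_mat) auto
  define R where "R = four_block_mat (1\<^sub>m n) (0\<^sub>m n m) (- B) (1\<^sub>m m)"
  have R: "R \<in> carrier_mat (n + m) (n + m)"
    unfolding R_def by (rule four_block_carrier_mat) auto
  have MR: "M * R = four_block_mat (c \<cdot>\<^sub>m 1\<^sub>m n - A * B) A (0\<^sub>m m n) (1\<^sub>m m)"
    unfolding M_def R_def using A B
    by (subst mult_four_block_mat[where ?nr1.0 = n and ?n1.0 = n and ?n2.0 = m and ?nr2.0 = m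
          and ?nc1.0 = n and ?nc2.0 = m])
       (auto intro!: cong_four_block_mat simp: minus_add_uminus_mat)
  have LM: "L * M = four_block_mat (c \<cdot>\<^sub>m 1\<^sub>m n) A (0\<^sub>m m n) (c \<cdot>\<^sub>m 1\<^sub>m m - B * A)"
    unfolding M_def L_def using A B
    by (subst mult_four_block_mat[where ?nr1.0 = n and ?n1.0 = n and ?n2.0 = m and ?nr2.0 = m
          and ?nc1.0 = n and ?nc2.0 = m])
       (auto intro!: cong_four_block_mat eq_matI)
  have detR: "det R = 1" and detL: "det L = c ^ m"
    unfolding R_def L_def using B
    by (subst det_four_block_mat_upper_right_zero[where n = n and m = m]; auto)+
  have "det (c \<cdot>\<^sub>m 1\<^sub>m n - A * B) = det (M * R)"
    unfolding MR using A B by (subst det_four_block_mat_lower_left_zero[where n = n and m = m]) auto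
  also have "\<dots> = det M" by (simp add: det_mult[OF M R] detR)
  finally have 1: "det (c \<cdot>\<^sub>m 1\<^sub>m n - A * B) = det M" .
  have "c ^ n * det (c \<cdot>\<^sub>m 1\<^sub>m m - B * A) = det (L * M)"
    unfolding LM using A B by (subst det_four_block_mat_lower_left_zero[where n = n and m = m]) auto
  also have "\<dots> = c ^ m * det M" by (simp add: det_mult[OF L M] detL)
  finally show ?thesis by (simp add: 1)
qed

section \<open>Fixed-point-free involutions and their permutation matrices\<close>

text \<open>An injective numbering of \<open>A\<close> breaks the symmetry of each orbit {a, f a};
  the members numbered below their partner form \<open>B\<close>. This supplies an orientation of
  the arcs as well as the evenness of their number.\<close>

lemma involution_half:
  assumes "finite A" and inv: "\<And>a. a \<in> A \<Longrightarrow> f a \<in> A \<and> f (f a) = a \<and> f a \<noteq> a"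
  shows "\<exists>B. B \<subseteq> A \<and> f ` B = A - B \<and> card A = 2 * card B"
proof -
  obtain pos :: "'a \<Rightarrow> nat" where pos: "inj_on pos A"
    using finite_imp_inj_to_nat_seg[OF assms(1)] by metis
  define B where "B = {a \<in> A. pos a < pos (f a)}"
  have img: "f ` B = A - B"
  proof
    show "f ` B \<subseteq> A - B"
    proof
      fix b assume "b \<in> f ` B"
      then obtain a where a: "a \<in> A" "pos a < pos (f a)" "b = f a" by (auto simp: B_def)
      with inv[OF a(1)] show "b \<in> A - B" by (simp add: B_def)
    qed
    show "A - B \<subseteq> f ` B"
    proof
      fix a assume a: "a \<in> A - B"
      then have "\<not> pos a < pos (f a)" "pos a \<noteq> pos (f a)"
        using inv[of a] inj_onD[OF pos, of a "f a"] by (auto simp: B_def)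
      then have "f a \<in> B" "a = f (f a)" using a inv[of a] by (simp_all add: B_def)
      then show "a \<in> f ` B" by blast
    qed
  qed
  have sub: "B \<subseteq> A" by (auto simp: B_def)
  have "inj_on f B" by (rule inj_on_inverseI[of _ f]) (use inv sub in auto)
  then have "card (A - B) = card B" using img by (metis card_image)
  then have "card A = 2 * card B"
    using card_Diff_subset[of B A] card_mono[OF assms(1) sub] finite_subset[OF sub assms(1)] sub
    by simp
  then show ?thesis using sub img by blast
qed

text \<open>This is x + c J with J the permutation matrix of \<open>f\<close>; the values c = 1 and
  c = -1 occur.\<close>

definition involution_mat :: "'a list \<Rightarrow> ('a \<Rightarrow> 'a) \<Rightarrow> 'b \<Rightarrow> 'b \<Rightarrow> 'b :: comm_ring_1 mat" where
  "involution_mat xs f x c =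
     imat xs xs (\<lambda>a b. (if a = b then x else 0) + (if b = f a then c else 0))"

lemma involution_mat_carrier [simp]:
  "involution_mat xs f x c \<in> carrier_mat (length xs) (length xs)"
  by (simp add: involution_mat_def)

lemma involution_mat_mult:
  assumes "distinct xs" and inv: "\<And>a. a \<in> set xs \<Longrightarrow> f a \<in> set xs \<and> f (f a) = a \<and> f a \<noteq> a"
  shows "involution_mat xs f x (- 1) * involution_mat xs f x 1 = (x\<^sup>2 - 1) \<cdot>\<^sub>m 1\<^sub>m (length xs)"
proof -
  have "involution_mat xs f x (- 1) * involution_mat xs f x 1 =
        imat xs xs (\<lambda>a b. if a = b then x\<^sup>2 - 1 else 0)"
    unfolding involution_mat_def imat_mult[OF assms(1)]
  proof (rule imat_cong)
    fix a c assume a: "a \<in> set xs" and c: "c \<in> set xs"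
    have "(\<Sum>b\<in>set xs. ((if a = b then x else 0) + (if b = f a then - 1 else 0)) *
             ((if b = c then x else 0) + (if c = f b then 1 else 0))) =
          (\<Sum>b\<in>set xs. if b = a then x * ((if a = c then x else 0) + (if c = f a then 1 else 0)) else 0) -
          (\<Sum>b\<in>set xs. if b = f a then (if f a = c then x else 0) + (if c = f (f a) then 1 else 0) else 0)"
      by (subst sum_subtractf[symmetric], rule sum.cong) (use a inv[OF a] in \<open>auto simp: algebra_simps\<close>)
    also have "\<dots> = (if a = c then x\<^sup>2 - 1 else 0)"
      using a inv[OF a] by (auto simp: power2_eq_square algebra_simps)
    finally show "(\<Sum>b\<in>set xs. ((if a = b then x else 0) + (if b = f a then - 1 else 0)) *
             ((if b = c then x else 0) + (if c = f b then 1 else 0))) = (if a = c then x\<^sup>2 - 1 else 0)" .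
  qed
  then show ?thesis by (simp add: imat_diagonal[OF assms(1)])
qed

text \<open>Conjugation by the signs of an orientation, that is, of a choice of one element in each
  orbit of the involution, changes the sign of its permutation matrix.\<close>

lemma det_involution_mat_uminus:
  fixes x :: "'b :: idom"
  assumes "distinct xs" and inv: "\<And>a. a \<in> set xs \<Longrightarrow> f a \<in> set xs \<and> f (f a) = a \<and> f a \<noteq> a"
  shows "det (involution_mat xs f x (- 1)) = det (involution_mat xs f x 1)"
proof -
  obtain B where B: "B \<subseteq> set xs" "f ` B = set xs - B"
    using involution_half[of "set xs" f, OF finite_set inv] by blast
  define s :: "'a \<Rightarrow> 'b" where "s a = (if a \<in> B then 1 else - 1)" for a
  have s: "s (f a) = - s a" if "a \<in> set xs" for a
  proof (cases "a \<in> B")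
    case True
    then have "f a \<in> set xs - B" unfolding B(2)[symmetric] by (rule imageI)
    then have "f a \<notin> B" by simp
    then show ?thesis using True by (simp add: s_def)
  next
    case False
    then have "a \<in> f ` B" using that B(2) by simp
    then obtain b where b: "b \<in> B" "a = f b" by (rule imageE)
    have "f a = b" using inv[of b] B(1) b by (simp add: subset_iff)
    then have "f a \<in> B" using b by simp
    then show ?thesis using False by (simp add: s_def)
  qed
  define E where "E = imat xs xs (\<lambda>a b. if a = b then s a else 0)"
  have E: "E \<in> carrier_mat (length xs) (length xs)" by (simp add: E_def)
  \<comment> \<open>Signs square to 1, so E is invertible.\<close>
  have "E * E = imat xs xs (\<lambda>a b. if a = b then 1 else 0)"
    unfolding E_def imat_mult[OF assms(1)]
    by (rule imat_cong) (auto simp: if_distrib[of "\<lambda>z. z * _"] s_def cong: if_cong)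
  then have "det (E * E) = 1"
    by (simp add: imat_diagonal[OF assms(1)])
  then have "det E \<noteq> 0" by (auto simp: det_mult[OF E E])
  \<comment> \<open>An entry of J joins a to f a, and these have opposite signs; moving E across J
    therefore turns J into -J.\<close>
  have "E * involution_mat xs f x 1 = involution_mat xs f x (- 1) * E"
    unfolding E_def involution_mat_def imat_mult[OF assms(1)]
  proof (rule imat_cong)
    fix a b assume ab: "a \<in> set xs" "b \<in> set xs"
    have "(\<Sum>y\<in>set xs. (if a = y then s a else 0) * ((if y = b then x else 0) + (if b = f y then 1 else 0))) =
          (\<Sum>y\<in>set xs. if a = y then s a * ((if a = b then x else 0) + (if b = f a then 1 else 0)) else 0)"
      by (rule sum.cong) auto
    also have "\<dots> = s a * ((if a = b then x else 0) + (if b = f a then 1 else 0))"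
      using ab by simp
    also have "\<dots> = ((if a = b then x else 0) + (if b = f a then - 1 else 0)) * s b"
      using s[OF ab(1)] inv[OF ab(1)] by auto
    also have "\<dots> = (\<Sum>y\<in>set xs. if y = b then
        ((if a = b then x else 0) + (if b = f a then - 1 else 0)) * s b else 0)"
      using ab by simp
    also have "\<dots> = (\<Sum>y\<in>set xs. ((if a = y then x else 0) + (if y = f a then - 1 else 0)) *
        (if y = b then s y else 0))"
      by (rule sum.cong) auto
    finally show "(\<Sum>y\<in>set xs. (if a = y then s a else 0) * ((if y = b then x else 0) + (if b = f y then 1 else 0))) =
        (\<Sum>y\<in>set xs. ((if a = y then x else 0) + (if y = f a then - 1 else 0)) *
        (if y = b then s y else 0))" .
  qed
  then have "det E * det (involution_mat xs f x 1) = det (involution_mat xs f x (- 1)) * det E"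
    using det_mult[OF E involution_mat_carrier] det_mult[OF involution_mat_carrier E] by metis
  then show ?thesis using \<open>det E \<noteq> 0\<close> by simp
qed

text \<open>The square of det(x - J) is det(x - J) det(x + J) = (x^2 - 1)^N, which in a domain
  leaves two candidates. Being the characteristic polynomial of J, it is monic, and 1 differs from
  -1 in characteristic 0; this excludes the negative candidate.\<close>

lemma det_involution_mat:
  fixes f :: "'a \<Rightarrow> 'a"
  assumes "distinct xs" and inv: "\<And>a. a \<in> set xs \<Longrightarrow> f a \<in> set xs \<and> f (f a) = a \<and> f a \<noteq> a"
  shows "det (involution_mat xs f [:0, 1:] (- 1)) = [:-1, 0, 1 :: 'b :: field_char_0:] ^ (length xs div 2)"
proof -
  define J :: "'b mat" where "J = imat xs xs (\<lambda>a b. if b = f a then 1 else 0)"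
  define D where "D = det (involution_mat xs f [:0, 1:] (- 1 :: 'b poly))"
  define Q where "Q = [:-1, 0, 1 :: 'b:] ^ (length xs div 2)"
  have "char_poly_matrix J = involution_mat xs f [:0, 1:] (- 1)"
    unfolding char_poly_matrix_def J_def involution_mat_def
    by (rule eq_matI) (auto simp: nth_eq_iff_index_eq[OF assms(1)] one_pCons)
  then have "D = char_poly J" by (simp add: D_def char_poly_def)
  then have monic: "lead_coeff D = 1"
    using degree_monic_char_poly[of J "length xs"] by (simp add: J_def)
  have X: "[:0, 1 :: 'b:]\<^sup>2 - 1 = [:-1, 0, 1:]" by (simp add: power2_eq_square one_pCons)
  have "even (length xs)"
    using involution_half[of "set xs" f, OF finite_set inv] by (auto simp: distinct_card[OF assms(1)])
  have "D * D = D * det (involution_mat xs f [:0, 1:] 1)"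
    unfolding D_def
    by (rule arg_cong[where f = "(*) _", OF det_involution_mat_uminus[OF assms(1) inv]])
  also have "\<dots> = det ([:-1, 0, 1 :: 'b:] \<cdot>\<^sub>m 1\<^sub>m (length xs))"
    unfolding D_def X[symmetric]
    by (simp only: involution_mat_mult[OF assms(1) inv]
          flip: det_mult[OF involution_mat_carrier involution_mat_carrier])
  also have "\<dots> = Q * Q"
    using \<open>even (length xs)\<close> by (simp add: Q_def power_add[symmetric] flip: mult_2)
  finally have "D = Q \<or> D = - Q" by (rule square_eq_iff[THEN iffD1])
  moreover have "lead_coeff Q = 1" by (simp add: Q_def lead_coeff_power)
  then have "D \<noteq> - Q" using monic by (auto simp: lead_coeff_minus)
  ultimately show ?thesis by (simp add: D_def Q_def)
qed

section \<open>The characteristic polynomial of the Grover matrix\<close>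

text \<open>Since x - U = (x + J) - S T, multiplication by x - J makes the first summand the scalar
  c, and Sylvester's identity moves the determinant from the arcs to the vertices. The factor c^#V
  stays on the left because #E / 2 - #V may be negative.\<close>

lemma grover_char_poly:
  fixes H :: "('v, 'e) pre_digraph"
  assumes fin: "fin_digraph H" and bid: "bidirected_digraph H rv"
    and deg: "\<And>v. v \<in> verts H \<Longrightarrow> out_degree H v \<noteq> 0"
    and vs: "distinct vs" "set vs = verts H" and es: "distinct es" "set es = arcs H"
  shows "char_poly (grover_matrix H rv es :: 'a :: field_char_0 mat) * [:-1, 0, 1:] ^ card (verts H) =
         [:-1, 0, 1:] ^ (card (arcs H) div 2) *
         det (imat vs vs (\<lambda>v w. (if v = w then [:1, 0, 1:] else 0) -
           [:0, 1:] * [:\<Sum>e | e \<in> arcs H \<and> tail H e = v \<and> head H e = w.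
             2 / of_nat (out_degree H v):]))"
proof -
  interpret fin_digraph H by (rule fin)
  interpret bidirected_digraph H rv by (rule bid)
  define N where "N = length es"
  define m where "m = length vs"
  define x :: "'a poly" where "x = [:0, 1:]"
  define c :: "'a poly" where "c = [:-1, 0, 1:]"
  have cx: "c = x\<^sup>2 - 1" by (simp add: c_def x_def power2_eq_square one_pCons)
  define k :: "'v \<Rightarrow> 'a poly" where "k v = [:2 / of_nat (out_degree H v):]" for v
  \<comment> \<open>Division by zero yields 0, so d_v times 2 / d_v is 2 only for d_v > 0: this is
    where positive degrees enter.\<close>
  have kdeg: "of_nat (out_degree H v) * k v = 2" if "v \<in> verts H" for v
    using deg[OF that] by (simp add: k_def of_nat_poly numeral_poly)
  have inv: "e \<in> set es \<Longrightarrow> rv e \<in> set es \<and> rv (rv e) = e \<and> rv e \<noteq> e" for e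
    using arev_neq by (simp add: es)
  define S :: "'a poly mat" where "S = imat es vs (\<lambda>e v. if tail H e = v then 1 else 0)"
  define T :: "'a poly mat" where "T = imat vs es (\<lambda>v f. if head H f = v then k v else 0)"
  define B where "B = involution_mat es rv x (- 1)"
  define D where "D = involution_mat es rv x 1"
  have carrier: "S \<in> carrier_mat N m" "T \<in> carrier_mat m N" "B \<in> carrier_mat N N"
    "D \<in> carrier_mat N N"
    by (simp_all add: S_def T_def B_def D_def N_def m_def)
  have ST: "S * T = imat es es (\<lambda>e f. if head H f = tail H e then k (tail H e) else 0)"
    unfolding S_def T_def imat_mult[OF vs(1)]
  proof (rule imat_cong)
    fix e f assume "e \<in> set es" "f \<in> set es"
    then have "tail H e \<in> set vs" by (simp add: es vs)
    moreover have "(\<Sum>v\<in>set vs. (if tail H e = v then 1 else 0) * (if head H f = v then k v else 0)) =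
        (\<Sum>v\<in>set vs. if tail H e = v then (if head H f = tail H e then k (tail H e) else 0) else 0)"
      by (rule sum.cong) auto
    ultimately show "(\<Sum>v\<in>set vs. (if tail H e = v then 1 else 0) * (if head H f = v then k v else 0)) =
        (if head H f = tail H e then k (tail H e) else 0)" by simp
  qed
  have "char_poly_matrix (grover_matrix H rv es :: 'a mat) = D - S * T"
  proof (rule eq_matI)
    fix i j assume "i < dim_row (D - S * T)" "j < dim_col (D - S * T)"
    then have ij: "i < length es" "j < length es"
      by (simp_all add: ST)
    have "es ! i \<in> arcs H" using ij es(2) nth_mem by blast
    then show "char_poly_matrix (grover_matrix H rv es :: 'a mat) $$ (i, j) = (D - S * T) $$ (i, j)"
      using ij
      by (auto simp: char_poly_matrix_def grover_matrix_def D_def involution_mat_def ST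
            nth_eq_iff_index_eq[OF es(1)] x_def k_def Let_def one_pCons)
  qed (simp_all add: char_poly_matrix_def grover_matrix_def ST)
  then have cp: "char_poly (grover_matrix H rv es :: 'a mat) = det (D - S * T)"
    by (simp add: char_poly_def)
  have BD: "B * D = c \<cdot>\<^sub>m 1\<^sub>m N"
    unfolding B_def D_def cx N_def by (rule involution_mat_mult[OF es(1) inv])
  have BST: "B * (D - S * T) = c \<cdot>\<^sub>m 1\<^sub>m N - B * S * T"
  proof -
    have "B * (D - S * T) = B * D - B * (S * T)"
      by (rule mult_minus_distrib_mat[OF carrier(3,4)]) (use carrier in auto)
    also have "B * (S * T) = B * S * T"
      by (rule assoc_mult_mat[OF carrier(3,1,2), symmetric])
    finally show ?thesis by (simp only: BD)
  qed
  \<comment> \<open>J S is the incidence matrix of the heads, because \<open>rv\<close> exchanges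
    tail and head; so B S = x S - J S.\<close>
  have BS: "B * S = imat es vs (\<lambda>e w. (if tail H e = w then x else 0) - (if head H e = w then 1 else 0))"
    unfolding B_def S_def involution_mat_def imat_mult[OF es(1)]
  proof (rule imat_cong)
    fix e w assume e: "e \<in> set es"
    have "(\<Sum>f\<in>set es. ((if e = f then x else 0) + (if f = rv e then - 1 else 0)) *
            (if tail H f = w then 1 else 0)) =
          (\<Sum>f\<in>set es. if e = f then (if tail H e = w then x else 0) else 0) -
          (\<Sum>f\<in>set es. if f = rv e then (if tail H (rv e) = w then 1 else 0) else 0)"
      by (subst sum_subtractf[symmetric], rule sum.cong) (auto simp: algebra_simps)
    also have "\<dots> = (if tail H e = w then x else 0) - (if head H e = w then 1 else 0)"
      using e by (simp add: es)
    finally show "(\<Sum>f\<in>set es. ((if e = f then x else 0) + (if f = rv e then - 1 else 0)) *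
            (if tail H f = w then 1 else 0)) =
        (if tail H e = w then x else 0) - (if head H e = w then 1 else 0)" .
  qed
  define W where "W v w = [:\<Sum>e | e \<in> arcs H \<and> tail H e = v \<and> head H e = w.
      2 / of_nat (out_degree H v) :: 'a:]" for v w
  have W: "W v w = of_nat (card {e \<in> arcs H. tail H e = v \<and> head H e = w}) * k v" for v w
    by (simp add: W_def k_def of_nat_poly)
  \<comment> \<open>T S becomes W after reversing the arcs, and T J S is diagonal with entry
    in-degree times 2 / d_v, which is 2 since in-degree and out-degree agree by reversal.\<close>
  have TBS: "T * (B * S) = imat vs vs (\<lambda>v w. x * W v w - (if v = w then 2 else 0))"
    unfolding BS T_def imat_mult[OF es(1)]
  proof (rule imat_cong)
    fix v w assume v: "v \<in> set vs"
    have "(\<Sum>e\<in>set es. (if head H e = v then k v else 0) *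
             ((if tail H e = w then x else 0) - (if head H e = w then 1 else 0))) =
          (\<Sum>e\<in>arcs H. if head H e = v \<and> tail H e = w then k v * x else 0) -
          (\<Sum>e\<in>arcs H. if head H e = v then (if v = w then k v else 0) else 0)"
      unfolding es(2) by (subst sum_subtractf[symmetric], rule sum.cong) (auto simp: algebra_simps)
    also have "(\<Sum>e\<in>arcs H. if head H e = v \<and> tail H e = w then k v * x else 0) =
        of_nat (card {e \<in> arcs H. head H e = v \<and> tail H e = w}) * (k v * x)"
      by (subst sum.inter_filter[symmetric]) simp_all
    also have "{e \<in> arcs H. head H e = v \<and> tail H e = w} =
        rv ` {e \<in> arcs H. tail H e = v \<and> head H e = w}"
    proof (intro equalityI subsetI)
      fix e assume "e \<in> {e \<in> arcs H. head H e = v \<and> tail H e = w}"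
      then have "rv e \<in> {e \<in> arcs H. tail H e = v \<and> head H e = w}" "e = rv (rv e)" by simp_all
      then show "e \<in> rv ` {e \<in> arcs H. tail H e = v \<and> head H e = w}" by (rule rev_image_eqI)
    qed auto
    also have "card \<dots> = card {e \<in> arcs H. tail H e = v \<and> head H e = w}"
      by (rule card_image) (rule inj_on_arev)
    also have "(\<Sum>e\<in>arcs H. if head H e = v then (if v = w then k v else 0) else 0) =
        of_nat (card (in_arcs H v)) * (if v = w then k v else 0)"
      by (subst sum.inter_filter[symmetric]) (simp_all add: in_arcs_def)
    also have "card (in_arcs H v) = out_degree H v"
      unfolding in_arcs_eq out_degree_def by (rule card_image) (rule inj_on_arev)
    also have "of_nat (out_degree H v) * (if v = w then k v else 0) = (if v = w then 2 else 0)"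
      using kdeg[of v] v vs(2) by (cases "v = w") auto
    finally show "(\<Sum>e\<in>set es. (if head H e = v then k v else 0) *
             ((if tail H e = w then x else 0) - (if head H e = w then 1 else 0))) =
        x * W v w - (if v = w then 2 else 0)"
      by (simp add: W mult_ac)
  qed
  define M where "M = imat vs vs (\<lambda>v w. (if v = w then [:1, 0, 1:] else 0) - x * W v w)"
  \<comment> \<open>On the diagonal c + 2 = x^2 + 1.\<close>
  have "c \<cdot>\<^sub>m 1\<^sub>m m - T * (B * S) = M"
    unfolding TBS m_def M_def imat_diagonal[OF vs(1), symmetric] imat_diff
    by (rule imat_cong) (auto simp: c_def numeral_poly)
  then have syl: "c ^ m * det (c \<cdot>\<^sub>m 1\<^sub>m N - B * S * T) = c ^ N * det M"
    using sylvester_determinant[of "B * S" N m T c] carrier by simp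
  have detB: "det B = c ^ (N div 2)"
    unfolding B_def x_def c_def N_def by (rule det_involution_mat[OF es(1) inv])
  have "even N"
    using involution_half[of "set es" rv, OF finite_set inv] distinct_card[OF es(1)]
    by (auto simp: N_def)
  then have cN: "c ^ N = c ^ (N div 2) * c ^ (N div 2)"
    by (simp add: power_add[symmetric] flip: mult_2)
  \<comment> \<open>One half of the factor c^N from Sylvester's identity cancels against det B; the
    other half is the power in the claim.\<close>
  have "c ^ (N div 2) * (det (D - S * T) * c ^ m) = c ^ m * det (B * (D - S * T))"
    using det_mult[OF carrier(3) minus_carrier_mat[OF mult_carrier_mat[OF carrier(1,2)]], of D]
    by (simp add: detB mult_ac)
  also have "\<dots> = c ^ (N div 2) * (c ^ (N div 2) * det M)"
    unfolding BST syl cN by (simp add: mult_ac)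
  finally have "det (D - S * T) * c ^ m = c ^ (N div 2) * det M"
    by (simp add: c_def)
  moreover have "m = card (verts H)" "N = card (arcs H)"
    using distinct_card[OF vs(1)] distinct_card[OF es(1)] vs es by (simp_all add: m_def N_def)
  ultimately show ?thesis
    by (simp add: cp c_def M_def W_def x_def)
qed

section \<open>Block diagonalisation by characters\<close>

lemma imat_map: "imat (map h xs) (map k ys) f = imat xs ys (\<lambda>x y. f (h x) (k y))"
  by (rule eq_matI) auto

lemma imat_append:
  "imat (xs @ ys) (xs' @ ys') f =
   four_block_mat (imat xs xs' f) (imat xs ys' f) (imat ys xs' f) (imat ys ys' f)"
  by (rule eq_matI) (auto simp: nth_append)

text \<open>\<open>List.product\<close> lists pairs with equal first component consecutively, so the
  head of the list splits off a diagonal block with zeros below it.\<close>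

lemma det_imat_block_diagonal:
  fixes f :: "'z \<Rightarrow> 'v \<Rightarrow> 'v \<Rightarrow> 'a :: idom"
  assumes "distinct zs"
  shows "det (imat (List.product zs vs) (List.product zs vs)
           (\<lambda>(z, v) (z', w). if z = z' then f z v w else 0)) =
         (\<Prod>z\<in>set zs. det (imat vs vs (f z)))"
  using assms
proof (induction zs)
  case Nil
  show ?case by simp (intro det_dim_zero carrier_matI, simp_all)
next
  case (Cons z zs)
  let ?F = "\<lambda>(z, v) (z', w). if z = z' then f z v w else 0"
  have "imat (List.product zs vs) (map (Pair z) vs) ?F =
        imat (List.product zs vs) (map (Pair z) vs) (\<lambda>_ _. 0)"
    by (rule imat_cong) (use Cons.prems in auto)
  also have "\<dots> = 0\<^sub>m (length (List.product zs vs)) (length vs)"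
    by (rule eq_matI) auto
  finally have 0: "imat (List.product zs vs) (map (Pair z) vs) ?F =
    0\<^sub>m (length (List.product zs vs)) (length vs)" .
  have "det (imat (List.product (z # zs) vs) (List.product (z # zs) vs) ?F) =
        det (imat (map (Pair z) vs) (map (Pair z) vs) ?F) *
        det (imat (List.product zs vs) (List.product zs vs) ?F)"
    unfolding product.simps imat_append 0
    by (rule det_four_block_mat_lower_left_zero[where n = "length vs"])
       (auto intro!: carrier_matI)
  also have "imat (map (Pair z) vs) (map (Pair z) vs) ?F = imat vs vs (f z)"
    unfolding imat_map by (rule imat_cong) simp
  finally show ?case using Cons by simp
qed

text \<open>Here \<open>\<chi>\<close> is the character table of a finite abelian group, and \<open>\<chi>'\<close> its inverse up to the
  factor \<open>q\<close>.\<close>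

lemma det_imat_fourier:
  fixes M :: "'g \<Rightarrow> 'v \<Rightarrow> 'g \<Rightarrow> 'v \<Rightarrow> 'a :: idom" and \<chi> \<chi>' :: "'z \<Rightarrow> 'g \<Rightarrow> 'a"
  assumes dist: "distinct gs" "distinct zs" "distinct vs" and len: "length gs = length zs"
    and orth: "\<And>z z'. z \<in> set zs \<Longrightarrow> z' \<in> set zs \<Longrightarrow>
      (\<Sum>g\<in>set gs. \<chi>' z g * \<chi> z' g) = (if z = z' then q else 0)"
    and "q \<noteq> 0"
    and eig: "\<And>g z v w. g \<in> set gs \<Longrightarrow> z \<in> set zs \<Longrightarrow> v \<in> set vs \<Longrightarrow> w \<in> set vs \<Longrightarrow>
      (\<Sum>h\<in>set gs. M g v h w * \<chi> z h) = \<chi> z g * F z v w"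
  shows "det (imat (List.product gs vs) (List.product gs vs) (\<lambda>(g, v) (h, w). M g v h w)) =
         (\<Prod>z\<in>set zs. det (imat vs vs (F z)))"
proof -
  let ?gv = "List.product gs vs" and ?zv = "List.product zs vs"
  define N where "N = length gs * length vs"
  define A where "A = imat ?gv ?gv (\<lambda>(g, v) (h, w). M g v h w)"
  define D where "D = imat ?zv ?zv (\<lambda>(z, v) (z', w). if z = z' then F z v w else 0)"
  define \<Phi> where "\<Phi> = imat ?gv ?zv (\<lambda>(g, v) (z, w). if v = w then \<chi> z g else 0)"
  define \<Psi> where "\<Psi> = imat ?zv ?gv (\<lambda>(z, v) (g, w). if v = w then \<chi>' z g else 0)"
  have carrier: "A \<in> carrier_mat N N" "D \<in> carrier_mat N N" "\<Phi> \<in> carrier_mat N N" "\<Psi> \<in> carrier_mat N N"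
    by (auto simp: A_def D_def \<Phi>_def \<Psi>_def N_def len intro!: carrier_matI)
  have dgv: "distinct ?gv" and dzv: "distinct ?zv"
    using dist by (simp_all add: distinct_product)
  \<comment> \<open>Orthogonality makes \<Psi> an inverse of \<Phi> up to the factor q; this yields
    det \<Phi> \<noteq> 0, which suffices for cancelling in a domain.\<close>
  have "\<Psi> * \<Phi> = imat ?zv ?zv (\<lambda>a b. if a = b then q else 0)"
    unfolding \<Psi>_def \<Phi>_def imat_mult[OF dgv]
  proof (rule imat_cong)
    fix a b assume *: "a \<in> set ?zv" "b \<in> set ?zv"
    obtain z v z' w where ab: "a = (z, v)" "b = (z', w)" by (metis surj_pair)
    note zv = *[unfolded ab]
    have "(\<Sum>y\<in>set ?gv. (case (z, v) of (z, v) \<Rightarrow> \<lambda>(g, w). if v = w then \<chi>' z g else 0) y *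
             (case y of (g, v) \<Rightarrow> \<lambda>(z, w). if v = w then \<chi> z g else 0) (z', w)) =
          (\<Sum>g\<in>set gs. \<Sum>u\<in>set vs. if v = u then (if v = w then \<chi>' z g * \<chi> z' g else 0) else 0)"
      unfolding set_product sum.cartesian_product by (rule sum.cong) auto
    also have "\<dots> = (if v = w then \<Sum>g\<in>set gs. \<chi>' z g * \<chi> z' g else 0)"
      using zv by simp
    also have "\<dots> = (if (z, v) = (z', w) then q else 0)"
      using zv orth[of z z'] by (cases "z = z'") auto
    finally show "(\<Sum>y\<in>set ?gv. (case a of (z, v) \<Rightarrow> \<lambda>(g, w). if v = w then \<chi>' z g else 0) y *
             (case y of (g, v) \<Rightarrow> \<lambda>(z, w). if v = w then \<chi> z g else 0) b) =
          (if a = b then q else 0)" unfolding ab .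
  qed
  then have "det (\<Psi> * \<Phi>) = q ^ length ?zv"
    by (simp add: imat_diagonal[OF dzv])
  then have nz: "det \<Phi> \<noteq> 0"
    using \<open>q \<noteq> 0\<close> by (auto simp: det_mult[OF carrier(4,3)])
  \<comment> \<open>The columns of \<Phi> are block eigenvectors of A, with the block
    \<open>F z\<close> as eigenvalue.\<close>
  have "A * \<Phi> = \<Phi> * D"
    unfolding A_def D_def \<Phi>_def imat_mult[OF dgv] imat_mult[OF dzv]
  proof (rule imat_cong)
    fix a b assume *: "a \<in> set ?gv" "b \<in> set ?zv"
    obtain g v z w where ab: "a = (g, v)" "b = (z, w)" by (metis surj_pair)
    note gv = *[unfolded ab]
    have "(\<Sum>y\<in>set ?gv. (case (g, v) of (g, v) \<Rightarrow> \<lambda>(h, w). M g v h w) y *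
             (case y of (g, v) \<Rightarrow> \<lambda>(z, w). if v = w then \<chi> z g else 0) (z, w)) =
          (\<Sum>h\<in>set gs. \<Sum>u\<in>set vs. if u = w then M g v h w * \<chi> z h else 0)"
      unfolding set_product sum.cartesian_product by (rule sum.cong) auto
    also have "\<dots> = \<chi> z g * F z v w"
      using gv eig[of g z v w] by simp
    also have "\<dots> = (\<Sum>z'\<in>set zs. \<Sum>u\<in>set vs. if v = u then (if z' = z then \<chi> z g * F z v w else 0) else 0)"
      using gv by simp
    also have "\<dots> = (\<Sum>y\<in>set ?zv. (case (g, v) of (g, v) \<Rightarrow> \<lambda>(z, w). if v = w then \<chi> z g else 0) y *
        (case y of (z, v) \<Rightarrow> \<lambda>(z', w). if z = z' then F z v w else 0) (z, w))"
      unfolding set_product sum.cartesian_product by (rule sum.cong) auto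
    finally show "(\<Sum>y\<in>set ?gv. (case a of (g, v) \<Rightarrow> \<lambda>(h, w). M g v h w) y *
             (case y of (g, v) \<Rightarrow> \<lambda>(z, w). if v = w then \<chi> z g else 0) b) =
        (\<Sum>y\<in>set ?zv. (case a of (g, v) \<Rightarrow> \<lambda>(z, w). if v = w then \<chi> z g else 0) y *
        (case y of (z, v) \<Rightarrow> \<lambda>(z', w). if z = z' then F z v w else 0) b)" unfolding ab .
  qed
  then have "det A * det \<Phi> = det \<Phi> * det D"
    by (simp only: flip: det_mult[OF carrier(1,3)] det_mult[OF carrier(3,2)])
  then have "det A = det D" using nz by auto
  then show ?thesis by (simp add: A_def D_def det_imat_block_diagonal[OF dist(2)])
qed

section \<open>The ring of integers of the algebraic closure\<close>

interpretation embed_Zp: inj_idom_hom "embed_Zp :: 'p :: prime_card padic_int \<Rightarrow> 'p padic_closure"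
  by unfold_locales (auto simp: embed_Zp_def)

interpretation Zp: Modules.module "\<lambda>(a :: 'p :: prime_card padic_int) (x :: 'p padic_closure). embed_Zp a * x"
  by unfold_locales (simp_all add: algebra_simps embed_Zp.hom_add embed_Zp.hom_mult)

text \<open>Lets a linear relation for a power of x be multiplied by a further factor: only the
  generators have to be checked.\<close>

lemma Zp_span_mult:
  fixes y :: "'p :: prime_card padic_closure"
  assumes "a \<in> Zp.span S" and "\<And>s. s \<in> S \<Longrightarrow> s * y \<in> Zp.span T"
  shows "a * y \<in> Zp.span T"
  using assms(1)
proof (induction rule: Zp.span_induct_alt)
  case base
  show ?case by (simp add: Zp.span_zero)
next
  case (step c x z)
  have "embed_Zp c * (x * y) + z * y \<in> Zp.span T"
    by (intro Zp.span_add Zp.span_scale step assms(2))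
  then show ?case by (simp add: algebra_simps)
qed

text \<open>Multiplication by \<open>z\<close> on the spanning set is given by a matrix over $\mathbb{Z}_p$, of whose
  characteristic polynomial \<open>z\<close> is a root.\<close>

lemma integral_over_Zp_if_stable_span:
  fixes z :: "'p :: prime_card padic_closure"
  assumes "finite B" and "b \<in> B" "b \<noteq> 0" and stable: "\<And>b. b \<in> B \<Longrightarrow> z * b \<in> Zp.span B"
  shows "integral_over_Zp z"
proof -
  obtain bs where bs: "distinct bs" "set bs = B"
    using finite_distinct_list[OF assms(1)] by blast
  have "\<forall>b\<in>B. \<exists>u. z * b = (\<Sum>v\<in>B. embed_Zp (u v) * v)"
    using stable unfolding Zp.span_finite[OF assms(1)] image_iff by blast
  \<comment> \<open>Any choice of coefficients will do; \<open>B\<close> may be linearly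
    dependent.\<close>
  from bchoice[OF this]
  obtain c where c: "\<And>b. b \<in> B \<Longrightarrow> z * b = (\<Sum>v\<in>B. embed_Zp (c b v) * v)"
    by blast
  define n where "n = length bs"
  define A :: "'p padic_int mat" where "A = mat n n (\<lambda>(i, j). c (bs ! i) (bs ! j))"
  define v where "v = vec n (\<lambda>i. bs ! i)"
  have A: "A \<in> carrier_mat n n" by (simp add: A_def)
  have "map_mat embed_Zp A *\<^sub>v v = z \<cdot>\<^sub>v v"
  proof (rule eq_vecI)
    fix i assume "i < dim_vec (z \<cdot>\<^sub>v v)"
    then have i: "i < n" by (simp add: v_def)
    have "(map_mat embed_Zp A *\<^sub>v v) $ i = (\<Sum>j\<in>{0..<n}. embed_Zp (c (bs ! i) (bs ! j)) * (bs ! j))"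
      using i by (simp add: A_def v_def scalar_prod_def)
    also have "\<dots> = (\<Sum>w\<in>B. embed_Zp (c (bs ! i) w) * w)"
      by (rule sum.reindex_bij_betw, rule bij_betw_nth)
         (use bs in \<open>auto simp: atLeast0LessThan n_def\<close>)
    also have "\<dots> = z * bs ! i"
      using c[of "bs ! i"] i bs nth_mem[of i bs] by (simp add: n_def)
    finally show "(map_mat embed_Zp A *\<^sub>v v) $ i = (z \<cdot>\<^sub>v v) $ i"
      using i by (simp add: v_def)
  qed (simp add: A_def v_def)
  moreover obtain i where "i < n" "bs ! i = b"
    using assms(2) bs by (metis in_set_conv_nth n_def)
  \<comment> \<open>The nonzero element \<open>b\<close> is an entry of \<open>v\<close>, so
    \<open>v\<close> qualifies as an eigenvector.\<close>
  then have "v \<noteq> 0\<^sub>v n"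
    using assms(3) by (metis v_def index_vec index_zero_vec(1))
  ultimately have "eigenvector (map_mat embed_Zp A) v z"
    by (simp add: eigenvector_def A_def v_def)
  then have "poly (char_poly (map_mat embed_Zp A)) z = 0"
    using eigenvalue_root_char_poly[of "map_mat embed_Zp A" n z] A
    by (auto simp: eigenvalue_def)
  then have "poly (map_poly embed_Zp (char_poly A)) z = 0"
    by (simp add: embed_Zp.char_poly_hom[OF A])
  moreover have "lead_coeff (char_poly A) = 1"
    using degree_monic_char_poly[OF A] by simp
  ultimately show ?thesis unfolding integral_over_Zp_def by blast
qed

text \<open>The module form of integrality: the span of 1, x, ..., x^(n-1) is stable under x as soon
  as x^n falls back into it, and n > 0 keeps the nonzero element 1 among the generators.\<close>

lemma integral_over_Zp_iff_power_span:
  fixes x :: "'p :: prime_card padic_closure"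
  shows "integral_over_Zp x \<longleftrightarrow> (\<exists>n>0. x ^ n \<in> Zp.span ((\<lambda>i. x ^ i) ` {..<n}))"
proof
  assume "integral_over_Zp x"
  then obtain f :: "'p padic_int poly" where f: "lead_coeff f = 1" "poly (map_poly embed_Zp f) x = 0"
    by (auto simp: integral_over_Zp_def)
  define n where "n = degree f"
  have "n > 0"
  proof (rule ccontr)
    assume "\<not> n > 0"
    then have "degree f = 0" by (simp add: n_def)
    then have "f = 1" using f(1) degree_0_id[of f] by (simp add: one_pCons)
    then show False using f(2) by simp
  qed
  have "0 = (\<Sum>i\<le>n. embed_Zp (coeff f i) * x ^ i)"
    using f(2) by (simp add: poly_altdef n_def)
  also have "\<dots> = (\<Sum>i<n. embed_Zp (coeff f i) * x ^ i) + x ^ n"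
    using f(1) by (simp add: n_def lessThan_Suc_atMost[symmetric])
  finally have "x ^ n = - (\<Sum>i<n. embed_Zp (coeff f i) * x ^ i)"
    by (simp add: eq_neg_iff_add_eq_0 add.commute)
  also have "\<dots> \<in> Zp.span ((\<lambda>i. x ^ i) ` {..<n})"
    by (intro Zp.span_neg Zp.span_sum Zp.span_scale Zp.span_base) simp
  finally show "\<exists>n>0. x ^ n \<in> Zp.span ((\<lambda>i. x ^ i) ` {..<n})" using \<open>n > 0\<close> by blast
next
  assume "\<exists>n>0. x ^ n \<in> Zp.span ((\<lambda>i. x ^ i) ` {..<n})"
  then obtain n where n: "n > 0" "x ^ n \<in> Zp.span ((\<lambda>i. x ^ i) ` {..<n})" by blast
  show "integral_over_Zp x"
  proof (rule integral_over_Zp_if_stable_span)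
    show "x ^ 0 \<in> (\<lambda>i. x ^ i) ` {..<n}" using n(1) by blast
    fix b assume "b \<in> (\<lambda>i. x ^ i) ` {..<n}"
    then obtain i where i: "i < n" "b = x ^ i" by blast
    show "x * b \<in> Zp.span ((\<lambda>i. x ^ i) ` {..<n})"
    proof (cases "Suc i < n")
      case True
      then show ?thesis using i by (intro Zp.span_base image_eqI[of _ _ "Suc i"]) auto
    next
      case False
      then have "Suc i = n" using i by simp
      then show ?thesis using n(2) i(2) by (metis power_Suc)
    qed
  qed auto
qed

text \<open>The monomials x^i y^j with i < n and j < m include 1, and their span is stable under x
  and under y, hence under x + y and x y.\<close>

lemma integral_over_Zp_add_mult:
  fixes x y :: "'p :: prime_card padic_closure"
  assumes "integral_over_Zp x" and "integral_over_Zp y"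
  shows "integral_over_Zp (x + y) \<and> integral_over_Zp (x * y)"
proof -
  obtain n where n: "n > 0" "x ^ n \<in> Zp.span ((\<lambda>i. x ^ i) ` {..<n})"
    using assms(1) integral_over_Zp_iff_power_span by blast
  obtain m where m: "m > 0" "y ^ m \<in> Zp.span ((\<lambda>i. y ^ i) ` {..<m})"
    using assms(2) integral_over_Zp_iff_power_span by blast
  define B where "B = (\<lambda>(i, j). x ^ i * y ^ j) ` ({..<n} \<times> {..<m})"
  have B: "x ^ i * y ^ j \<in> B" if "i < n" "j < m" for i j
    using that by (auto simp: B_def)
  have fin: "finite B" by (simp add: B_def)
  have one: "1 \<in> B" using B[OF n(1) m(1)] by simp
  have x: "x * b \<in> Zp.span B" if "b \<in> B" for b
  proof -
    obtain i j where ij: "i < n" "j < m" "b = x ^ i * y ^ j" using \<open>b \<in> B\<close> by (auto simp: B_def)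
    show ?thesis
    proof (cases "Suc i < n")
      case True
      then show ?thesis using ij B[of "Suc i" j] by (simp add: Zp.span_base mult.assoc)
    next
      case False
      then have "n = Suc i" using ij by simp
      then have "x * b = x ^ n * y ^ j" by (simp add: ij mult.assoc)
      also have "\<dots> \<in> Zp.span B"
        by (rule Zp_span_mult[OF n(2)]) (auto intro!: Zp.span_base B ij)
      finally show ?thesis .
    qed
  qed
  have y: "y * b \<in> Zp.span B" if "b \<in> B" for b
  proof -
    obtain i j where ij: "i < n" "j < m" "b = x ^ i * y ^ j" using \<open>b \<in> B\<close> by (auto simp: B_def)
    show ?thesis
    proof (cases "Suc j < m")
      case True
      have "y * b = x ^ i * y ^ Suc j" by (simp add: ij mult_ac)
      then show ?thesis using B[OF ij(1) True] by (simp only: Zp.span_base)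
    next
      case False
      then have "m = Suc j" using ij by simp
      then have "y * b = y ^ m * x ^ i" by (simp add: ij mult_ac)
      also have "\<dots> \<in> Zp.span B"
        by (rule Zp_span_mult[OF m(2)]) (auto simp: mult.commute[of _ "x ^ i"] intro!: Zp.span_base B ij)
      finally show ?thesis .
    qed
  qed
  have "(x + y) * b \<in> Zp.span B" if "b \<in> B" for b
    using Zp.span_add[OF x[OF that] y[OF that]] by (simp add: distrib_right)
  moreover have "x * y * b \<in> Zp.span B" if "b \<in> B" for b
  proof -
    have "y * b * x \<in> Zp.span B"
      by (rule Zp_span_mult[OF y[OF that]]) (simp only: x mult.commute[of _ x])
    moreover have "y * b * x = x * y * b" by (simp add: mult_ac)
    ultimately show ?thesis by (simp only:)
  qed
  ultimately show ?thesis
    using integral_over_Zp_if_stable_span[OF fin one] by simp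
qed

lemmas integral_over_Zp_add = integral_over_Zp_add_mult[THEN conjunct1]
lemmas integral_over_Zp_mult = integral_over_Zp_add_mult[THEN conjunct2]

lemma integral_over_Zp_embed [simp]: "integral_over_Zp (embed_Zp a)"
  unfolding integral_over_Zp_def
  by (rule exI[of _ "[:- a, 1:]"]) (simp add: embed_Zp.hom_uminus)

lemma integral_over_Zp_0 [simp]: "integral_over_Zp 0"
  using integral_over_Zp_embed[of 0] by simp

lemma integral_over_Zp_1 [simp]: "integral_over_Zp 1"
  using integral_over_Zp_embed[of 1] by simp

lemma integral_over_Zp_of_nat [simp]: "integral_over_Zp (of_nat n)"
  by (induction n) (simp_all add: integral_over_Zp_add)

lemma integral_over_Zp_uminus: "integral_over_Zp x \<Longrightarrow> integral_over_Zp (- x)"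
  using integral_over_Zp_mult[OF integral_over_Zp_embed[of "- 1"], of x]
  by (simp add: embed_Zp.hom_uminus)

lemma integral_over_Zp_power: "integral_over_Zp x \<Longrightarrow> integral_over_Zp (x ^ n)"
  by (induction n) (auto intro: integral_over_Zp_mult)

section \<open>Residues, divisibility and units in Z_p\<close>

lemma Rep_padic_int_mod:
  fixes x :: "'p :: prime_card padic_int"
  assumes "m \<le> n"
  shows "Rep_padic_int x n mod int CARD('p) ^ m = Rep_padic_int x m"
  using assms
proof (induction n rule: dec_induct)
  case base
  show ?case using padic_mod_self[of "Rep_padic_int x"] Rep_padic_int[of x] by simp
next
  case (step n)
  have "Rep_padic_int x (Suc n) mod int CARD('p) ^ m =
        Rep_padic_int x (Suc n) mod int CARD('p) ^ n mod int CARD('p) ^ m"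
    using step by (simp add: mod_mod_cancel le_imp_power_dvd)
  also have "Rep_padic_int x (Suc n) mod int CARD('p) ^ n = Rep_padic_int x n"
    using Rep_padic_int[of x] by simp
  finally show ?case using step by simp
qed

lemma Rep_padic_int_bounds:
  "0 \<le> Rep_padic_int (x :: 'p :: prime_card padic_int) n"
  "Rep_padic_int (x :: 'p :: prime_card padic_int) n < int CARD('p) ^ n"
proof -
  have p: "int CARD('p) ^ n > 0" using prime_gt_0_nat[OF prime_card[where ?'a = 'p]] by simp
  have "Rep_padic_int x n mod int CARD('p) ^ n = Rep_padic_int x n"
    by (rule Rep_padic_int_mod) simp
  then show "0 \<le> Rep_padic_int x n" "Rep_padic_int x n < int CARD('p) ^ n"
    using p pos_mod_bound[OF p, of "Rep_padic_int x n"] pos_mod_sign[OF p, of "Rep_padic_int x n"]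
    by simp_all
qed

lemma Rep_padic_int_0 [simp]: "Rep_padic_int (x :: 'p :: prime_card padic_int) 0 = 0"
  using Rep_padic_int_bounds[of x 0] by simp

lemma padic_int_eqI: "(\<And>n. Rep_padic_int x n = Rep_padic_int y n) \<Longrightarrow> x = y"
  by (simp add: Rep_padic_int_inject[symmetric] fun_eq_iff)

text \<open>The quotient is read off the residues: its n-th one is the (n + v)-th residue of
  \<open>x\<close> divided by p^v. The second conclusion records this, so that a factorisation can
  tell when no further p can be taken out.\<close>

lemma padic_int_divide_prime_power:
  fixes x :: "'p :: prime_card padic_int"
  assumes "Rep_padic_int x v = 0"
  obtains y where "x = of_nat CARD('p) ^ v * y"
    and "\<And>n. Rep_padic_int x (n + v) = int CARD('p) ^ v * Rep_padic_int y n"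
proof -
  let ?p = "int CARD('p)"
  have p: "?p > 0" using prime_gt_0_nat[OF prime_card[where ?'a = 'p]] by simp
  define f where "f n = Rep_padic_int x (n + v) div ?p ^ v" for n
  have f: "Rep_padic_int x (n + v) = ?p ^ v * f n" for n
  proof -
    have "Rep_padic_int x (n + v) mod ?p ^ v = 0" using assms by (simp add: Rep_padic_int_mod)
    then show ?thesis by (simp add: f_def mod_eq_0_iff_dvd)
  qed
  \<comment> \<open>Coherence of the quotient at level n is coherence of \<open>x\<close> at level n
    + v, divided by p^v.\<close>
  have "f (Suc n) mod ?p ^ n = f n" for n
  proof -
    have "?p ^ v * (f (Suc n) mod ?p ^ n) = (?p ^ v * f (Suc n)) mod ?p ^ (n + v)"
      unfolding add.commute[of n v] power_add by (rule mult_mod_right)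
    also have "\<dots> = ?p ^ v * f n"
      by (simp only: f[symmetric]) (rule Rep_padic_int_mod, simp)
    finally show ?thesis using p by simp
  qed
  then have Rep: "Rep_padic_int (Abs_padic_int f :: 'p padic_int) = f"
    by (intro Abs_padic_int_inverse) simp
  define y where "y = (Abs_padic_int f :: 'p padic_int)"
  have pw: "Rep_padic_int (of_nat (CARD('p) ^ v) :: 'p padic_int) n = ?p ^ v mod ?p ^ n" for n
    unfolding Rep_of_nat_padic_int by (simp only: of_nat_power)
  have "x = of_nat (CARD('p) ^ v) * y"
  proof (rule padic_int_eqI)
    fix n
    have "Rep_padic_int (of_nat (CARD('p) ^ v) * y) n = ?p ^ v * f n mod ?p ^ n"
      by (simp only: times_padic_int.rep_eq pw y_def Rep) (simp add: mod_simps)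
    also have "\<dots> = Rep_padic_int x (n + v) mod ?p ^ n" by (simp add: f)
    also have "\<dots> = Rep_padic_int x n" by (rule Rep_padic_int_mod) simp
    finally show "Rep_padic_int x n = Rep_padic_int (of_nat (CARD('p) ^ v) * y) n" by simp
  qed
  then show thesis using that[of y] f by (simp add: y_def Rep)
qed

text \<open>If n is the first index with a nonzero residue, then n - 1 is the valuation. The index
  is positive because the residue modulo p^0 is 0.\<close>

lemma padic_int_factorization:
  fixes x :: "'p :: prime_card padic_int"
  assumes "x \<noteq> 0"
  obtains v u where "x = of_nat CARD('p) ^ v * u" "Rep_padic_int u 1 \<noteq> 0"
proof -
  have "\<exists>n. Rep_padic_int x n \<noteq> 0"
    using assms padic_int_eqI[of x 0] by (auto simp: zero_padic_int.rep_eq)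
  then obtain n where n: "Rep_padic_int x n \<noteq> 0" "\<And>m. m < n \<Longrightarrow> Rep_padic_int x m = 0"
    using exists_least_iff[of "\<lambda>n. Rep_padic_int x n \<noteq> 0"] by blast
  then obtain v where v: "n = Suc v" by (cases n) auto
  obtain y where y: "x = of_nat CARD('p) ^ v * y"
    "\<And>n. Rep_padic_int x (n + v) = int CARD('p) ^ v * Rep_padic_int y n"
    using padic_int_divide_prime_power[of x v] n(2)[of v] v by auto
  have "Rep_padic_int y 1 \<noteq> 0" using y(2)[of 1] n(1) v by auto
  then show thesis using that y(1) by blast
qed

text \<open>A nonzero residue modulo p makes every residue coprime to p. Inverses modulo p^n are
  unique, so the inverses chosen level by level cohere.\<close>

lemma padic_int_unit:
  fixes u :: "'p :: prime_card padic_int"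
  assumes "Rep_padic_int u 1 \<noteq> 0"
  obtains w where "u * w = 1"
proof -
  let ?p = "int CARD('p)"
  have cop: "coprime (Rep_padic_int u n) (?p ^ n)" for n
  proof (cases n)
    case (Suc m)
    have "Rep_padic_int u n mod ?p ^ 1 \<noteq> 0"
      using assms Suc by (subst Rep_padic_int_mod) auto
    then have "\<not> ?p dvd Rep_padic_int u n" by (simp add: dvd_eq_mod_eq_0)
    then have "coprime ?p (Rep_padic_int u n)"
      by (rule prime_imp_coprime[OF prime_card_int])
    then show ?thesis by (simp add: coprime_commute)
  qed simp
  have "\<forall>n. \<exists>x. [Rep_padic_int u n * x = 1] (mod ?p ^ n)"
    using cong_solve_coprime_int[OF cop] by blast
  from choice[OF this] obtain g where g: "\<And>n. [Rep_padic_int u n * g n = 1] (mod ?p ^ n)" by blast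
  define f where "f n = g n mod ?p ^ n" for n
  have f: "[Rep_padic_int u n * f n = 1] (mod ?p ^ n)" for n
    using g[of n] by (simp add: f_def cong_def mod_mult_right_eq)
  have "f (Suc n) mod ?p ^ n = f n" for n
  proof -
    have "[Rep_padic_int u (Suc n) * f (Suc n) = 1] (mod ?p ^ n)"
      using f[of "Suc n"] by (rule cong_dvd_modulus) (simp add: le_imp_power_dvd)
    moreover have "[Rep_padic_int u (Suc n) = Rep_padic_int u n] (mod ?p ^ n)"
      using Rep_padic_int_mod[of n "Suc n" u] Rep_padic_int_mod[of n n u] by (simp add: cong_def)
    ultimately have "[Rep_padic_int u n * f (Suc n) = Rep_padic_int u n * f n] (mod ?p ^ n)"
      using f[of n] by (metis cong_scalar_right cong_sym cong_trans)
    then have "[f (Suc n) = f n] (mod ?p ^ n)"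
      using cong_mult_lcancel[OF cop] by blast
    then show ?thesis by (simp add: cong_def f_def)
  qed
  then have Rep: "Rep_padic_int (Abs_padic_int f :: 'p padic_int) = f"
    by (intro Abs_padic_int_inverse) simp
  have "u * Abs_padic_int f = 1"
    by (rule padic_int_eqI) (use f in \<open>simp add: times_padic_int.rep_eq one_padic_int.rep_eq Rep cong_def\<close>)
  then show thesis by (rule that)
qed

text \<open>A power of a unit is again a unit, and p a = 1 fails modulo p. The form is the one that
  contradicts integrality of u / p.\<close>

lemma prime_padic_int_not_dvd:
  fixes u :: "'p :: prime_card padic_int"
  assumes "Rep_padic_int u 1 \<noteq> 0"
  shows "u ^ n \<noteq> of_nat CARD('p) * a"
proof
  assume *: "u ^ n = of_nat CARD('p) * a"
  obtain w where "u * w = 1" using padic_int_unit[OF assms] .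
  then have "u ^ n * w ^ n = 1" by (metis power_mult_distrib power_one)
  then have "of_nat CARD('p) * (a * w ^ n) = 1" by (simp add: * mult.assoc)
  then have "Rep_padic_int (of_nat CARD('p) * (a * w ^ n)) 1 = 1 mod int CARD('p)"
    by (simp add: one_padic_int.rep_eq)
  then have "1 mod int CARD('p) = 0"
    by (simp add: times_padic_int.rep_eq Rep_of_nat_padic_int)
  then show False using prime_gt_1_nat[OF prime_card[where ?'a = 'p]] by simp
qed

section \<open>Equations over Z_p and integral elements\<close>

lemma embed_Zp_of_nat [simp]: "embed_Zp (of_nat n) = of_nat n"
  by (induction n) (simp_all add: embed_Zp.hom_add)

lemma fract_poly_clear_denominators:
  fixes f :: "'a :: idom fract poly"
  shows "\<exists>b g. b \<noteq> 0 \<and> smult (to_fract b) f = map_poly to_fract g"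
proof (induction f)
  case 0
  show ?case by (intro exI[of _ 1] exI[of _ 0]) simp
next
  case (pCons a f)
  then obtain b g where bg: "b \<noteq> 0" "smult (to_fract b) f = map_poly to_fract g" by blast
  obtain u v where uv: "a = Fract u v" "v \<noteq> 0" by (cases a)
  have "to_fract (v * b) * a = to_fract (u * b)"
    using uv by (simp add: Fract_conv_to_fract)
  moreover have "smult (to_fract (v * b)) f = smult (to_fract v) (smult (to_fract b) f)"
    by simp
  then have "smult (to_fract (v * b)) f = map_poly to_fract (smult v g)"
    by (simp only: bg(2) fract_poly_smult)
  ultimately have "smult (to_fract (v * b)) (pCons a f) = map_poly to_fract (pCons (u * b) (smult v g))"
    by (simp only: smult_pCons Polynomial.map_poly_pCons[where f = to_fract, OF to_fract_0])
  then show ?case using bg(1) uv(2) by (intro exI[of _ "v * b"]) auto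
qed

text \<open>The equation has coefficients in Z_p but need not be monic; the separation and the
  boundedness of elements are both extracted from it.\<close>

lemma padic_closure_algebraic:
  fixes x :: "'p :: prime_card padic_closure"
  obtains g :: "'p padic_int poly" where "g \<noteq> 0" "poly (map_poly embed_Zp g) x = 0"
proof -
  obtain f :: "'p padic_field poly" where f: "f \<noteq> 0" "poly (map_poly to_ac f) x = 0"
    by (rule alg_closure_algebraic)
  obtain b g where bg: "b \<noteq> 0" "smult (to_fract b) f = map_poly to_fract g"
    using fract_poly_clear_denominators[of f] by blast
  have "map_poly embed_Zp g = map_poly to_ac (map_poly to_fract g)"
    by (rule poly_eqI) (simp only: coeff_map_poly embed_Zp_def to_fract_0 to_ac_0)
  also have "\<dots> = smult (to_ac (to_fract b)) (map_poly to_ac f)"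
    unfolding bg(2)[symmetric]
    by (rule poly_eqI) (simp only: coeff_map_poly coeff_smult to_ac_0 to_ac_mult)
  finally have "poly (map_poly embed_Zp g) x = 0" using f(2) by simp
  moreover have "g \<noteq> 0"
  proof
    assume "g = 0"
    then have "smult (to_fract b) f = 0" using bg(2) by simp
    then show False using bg(1) f(1) by simp
  qed
  ultimately show thesis using that by blast
qed

text \<open>The fragment of integral closedness of Z_p that uniqueness of limits rests on:
  multiplied by p^n, a monic equation of degree n for u / p becomes u^n plus terms divisible by
  p.\<close>

lemma embed_Zp_eq_prime_multiple:
  fixes u :: "'p :: prime_card padic_int"
  assumes "integral_over_Zp (embed_Zp u / of_nat CARD('p))"
  shows "\<exists>n a. u ^ n = of_nat CARD('p) * a"
proof -
  let ?p = "of_nat CARD('p) :: 'p padic_closure"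
  have p: "?p \<noteq> 0" using prime_gt_0_nat[OF prime_card[where ?'a = 'p]] by simp
  obtain f :: "'p padic_int poly"
    where f: "lead_coeff f = 1" "poly (map_poly embed_Zp f) (embed_Zp u / ?p) = 0"
    using assms by (auto simp: integral_over_Zp_def)
  define n where "n = degree f"
  define b where "b = (\<Sum>i<n. coeff f i * u ^ i * of_nat CARD('p) ^ (n - Suc i))"
  have "0 = ?p ^ n * (\<Sum>i\<le>n. embed_Zp (coeff f i) * (embed_Zp u / ?p) ^ i)"
    using f(2) by (simp add: poly_altdef n_def)
  also have "\<dots> = ?p ^ n * (\<Sum>i<n. embed_Zp (coeff f i) * (embed_Zp u / ?p) ^ i) + embed_Zp u ^ n"
    using f(1) p by (simp add: n_def lessThan_Suc_atMost[symmetric] power_divide distrib_left)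
  also have "?p ^ n * (\<Sum>i<n. embed_Zp (coeff f i) * (embed_Zp u / ?p) ^ i) = ?p * embed_Zp b"
    unfolding b_def embed_Zp.hom_sum sum_distrib_left
  proof (rule sum.cong)
    fix i assume "i \<in> {..<n}"
    then have "n = Suc (n - Suc i + i)" by simp
    then have "?p ^ n = ?p * ?p ^ (n - Suc i) * ?p ^ i" by (metis power_Suc power_add mult.assoc)
    then show "?p ^ n * (embed_Zp (coeff f i) * (embed_Zp u / ?p) ^ i) =
        ?p * embed_Zp (coeff f i * u ^ i * of_nat CARD('p) ^ (n - Suc i))"
      using p by (simp add: power_divide embed_Zp.hom_mult embed_Zp.hom_power)
  qed simp
  finally have "embed_Zp (u ^ n) = embed_Zp (of_nat CARD('p) * (- b))"
    by (simp add: embed_Zp.hom_mult embed_Zp.hom_power embed_Zp.hom_uminus eq_neg_iff_add_eq_0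
        add.commute)
  then have "u ^ n = of_nat CARD('p) * (- b)" by simp
  then show ?thesis by blast
qed

section \<open>The neighbourhoods p^N O of zero\<close>

text \<open>Membership in p^N O, where O is the valuation ring, takes the place of a bound on an
  absolute value.\<close>

definition padic_small :: "nat \<Rightarrow> 'p :: prime_card padic_closure \<Rightarrow> bool" where
  "padic_small N x \<longleftrightarrow> integral_over_Zp (x / of_nat CARD('p) ^ N)"

lemma padic_prime_nonzero [simp]: "(of_nat CARD('p) :: 'p :: prime_card padic_closure) \<noteq> 0"
  using prime_gt_0_nat[OF prime_card[where ?'a = 'p]] by simp

lemma padic_small_0 [simp]: "padic_small N 0"
  by (simp add: padic_small_def)

lemma padic_small_0_iff: "padic_small 0 x \<longleftrightarrow> integral_over_Zp x"
  by (simp add: padic_small_def)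

lemma padic_small_add: "padic_small N x \<Longrightarrow> padic_small N y \<Longrightarrow> padic_small N (x + y)"
  by (simp add: padic_small_def add_divide_distrib integral_over_Zp_add)

lemma padic_small_uminus: "padic_small N x \<Longrightarrow> padic_small N (- x)"
  using integral_over_Zp_uminus by (fastforce simp: padic_small_def)

lemma padic_small_diff: "padic_small N x \<Longrightarrow> padic_small N y \<Longrightarrow> padic_small N (x - y)"
  using padic_small_add[of N x "- y"] by (simp add: padic_small_uminus)

lemma padic_small_sum:
  "(\<And>a. a \<in> A \<Longrightarrow> padic_small N (f a)) \<Longrightarrow> padic_small N (sum f A)"
  by (induction A rule: infinite_finite_induct) (auto intro: padic_small_add)

lemma padic_small_mult: "padic_small N x \<Longrightarrow> padic_small M y \<Longrightarrow> padic_small (N + M) (x * y)"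
  unfolding padic_small_def power_add times_divide_times_eq[symmetric]
  by (rule integral_over_Zp_mult)

lemma padic_small_mono:
  assumes "padic_small M x" and "N \<le> M"
  shows "padic_small N (x :: 'p :: prime_card padic_closure)"
proof -
  have "x / of_nat CARD('p) ^ N = x / of_nat CARD('p) ^ M * of_nat CARD('p) ^ (M - N)"
    using assms(2) by (simp add: power_diff)
  also have "integral_over_Zp \<dots>"
    by (intro integral_over_Zp_mult integral_over_Zp_power integral_over_Zp_of_nat
        assms(1)[unfolded padic_small_def])
  finally show ?thesis by (simp only: padic_small_def)
qed

lemma padic_small_prime_power_mult:
  "padic_small N (of_nat CARD('p) ^ N * embed_Zp (a :: 'p :: prime_card padic_int))"
  by (simp add: padic_small_def)

text \<open>Otherwise the nonzero constant term of an equation of \<open>x\<close> over $\mathbb{Z}_p$ would be divisible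
  by all powers of \<open>p\<close>.\<close>

lemma padic_small_all_imp_0:
  fixes x :: "'p :: prime_card padic_closure"
  assumes small: "\<And>N. padic_small N x"
  shows "x = 0"
proof (rule ccontr)
  let ?p = "of_nat CARD('p) :: 'p padic_closure"
  assume "x \<noteq> 0"
  obtain g :: "'p padic_int poly" where g: "g \<noteq> 0" "poly (map_poly embed_Zp g) x = 0"
    by (rule padic_closure_algebraic)
  \<comment> \<open>As x is not 0, factors X can be removed from the equation until its constant
    term is nonzero.\<close>
  have "\<exists>h :: 'p padic_int poly. coeff h 0 \<noteq> 0 \<and> poly (map_poly embed_Zp h) x = 0"
    using g
  proof (induction g)
    case (pCons a g)
    show ?case
    proof (cases "a = 0")
      case True
      then have "poly (map_poly embed_Zp g) x = 0" "g \<noteq> 0"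
        using pCons.prems \<open>x \<noteq> 0\<close> by (auto simp: Polynomial.map_poly_pCons)
      then show ?thesis using pCons.IH by blast
    next
      case False
      then show ?thesis using pCons.prems by (intro exI[of _ "pCons a g"]) simp
    qed
  qed simp
  then obtain h :: "'p padic_int poly" where h: "coeff h 0 \<noteq> 0" "poly (map_poly embed_Zp h) x = 0"
    by blast
  obtain c k where hc: "h = pCons c k" by (cases h)
  have c0: "c \<noteq> 0" using h(1) hc by simp
  \<comment> \<open>The constant term is -x times an integral element, so it inherits the smallness
    of x.\<close>
  have "embed_Zp c = - (x * poly (map_poly embed_Zp k) x)"
    using h(2) by (simp add: hc Polynomial.map_poly_pCons eq_neg_iff_add_eq_0)
  moreover have "integral_over_Zp x" using small[of 0] by (simp add: padic_small_0_iff)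
  then have "padic_small 0 (poly (map_poly embed_Zp k) x)"
    unfolding poly_altdef
    by (intro padic_small_sum)
       (simp add: padic_small_0_iff integral_over_Zp_mult integral_over_Zp_power)
  ultimately have c: "padic_small N (embed_Zp c)" for N
    using padic_small_uminus[OF padic_small_mult[OF small[of N], of 0]] by simp
  obtain v u where vu: "c = of_nat CARD('p) ^ v * u" "Rep_padic_int u 1 \<noteq> 0"
    using padic_int_factorization[OF c0] .
  \<comment> \<open>One power of p more than the valuation of c leaves u / p with a unit u, which is
    not integral.\<close>
  have "embed_Zp c / ?p ^ Suc v = embed_Zp u / ?p"
    by (simp add: vu(1) embed_Zp.hom_mult embed_Zp.hom_power)
  then have "integral_over_Zp (embed_Zp u / ?p)"
    using c[of "Suc v"] by (simp add: padic_small_def)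
  then show False
    using embed_Zp_eq_prime_multiple[of u] by (simp add: prime_padic_int_not_dvd[OF vu(2)])
qed

text \<open>The leading coefficient h of an equation makes h x integral, and h is a power of p times
  a unit, which is removed by its inverse.\<close>

lemma padic_bounded:
  fixes x :: "'p :: prime_card padic_closure"
  obtains c where "integral_over_Zp (of_nat CARD('p) ^ c * x)"
proof -
  obtain g :: "'p padic_int poly" where g: "g \<noteq> 0" "poly (map_poly embed_Zp g) x = 0"
    by (rule padic_closure_algebraic)
  define n where "n = degree g"
  define h where "h = embed_Zp (lead_coeff g)"
  define z where "z = h * x"
  have "h \<noteq> 0" using g(1) by (simp add: h_def)
  have "n > 0"
  proof (rule ccontr)
    assume "\<not> n > 0"
    then obtain a where "g = [:a:]" by (metis degree_eq_zeroE n_def neq0_conv)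
    then show False using g by (simp add: Polynomial.map_poly_pCons)
  qed
  \<comment> \<open>The factor h^(n-1) turns the equation of x into a monic equation of z = h
    x.\<close>
  have "0 = h ^ (n - 1) * (\<Sum>i\<le>n. embed_Zp (coeff g i) * x ^ i)"
    using g(2) by (simp add: poly_altdef n_def)
  also have "\<dots> = h ^ (n - 1) * (\<Sum>i<n. embed_Zp (coeff g i) * x ^ i) + h ^ (n - 1) * h * x ^ n"
    by (simp add: n_def h_def lessThan_Suc_atMost[symmetric] distrib_left mult.assoc)
  also have "h ^ (n - 1) * h * x ^ n = z ^ n"
    unfolding power_minus_mult[OF \<open>n > 0\<close>] by (simp add: z_def power_mult_distrib)
  also have "h ^ (n - 1) * (\<Sum>i<n. embed_Zp (coeff g i) * x ^ i) =
      (\<Sum>i<n. embed_Zp (coeff g i * lead_coeff g ^ (n - 1 - i)) * z ^ i)"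
    unfolding sum_distrib_left
  proof (rule sum.cong)
    fix i assume "i \<in> {..<n}"
    then have "n - 1 = (n - 1 - i) + i" by auto
    then have "h ^ (n - 1) = h ^ (n - 1 - i) * h ^ i" by (metis power_add)
    then show "h ^ (n - 1) * (embed_Zp (coeff g i) * x ^ i) =
        embed_Zp (coeff g i * lead_coeff g ^ (n - 1 - i)) * z ^ i"
      by (simp add: z_def power_mult_distrib embed_Zp.hom_mult embed_Zp.hom_power h_def)
  qed simp
  finally have "z ^ n = - (\<Sum>i<n. embed_Zp (coeff g i * lead_coeff g ^ (n - 1 - i)) * z ^ i)"
    by (simp add: eq_neg_iff_add_eq_0 add.commute)
  also have "\<dots> \<in> Zp.span ((\<lambda>i. z ^ i) ` {..<n})"
    by (intro Zp.span_neg Zp.span_sum Zp.span_scale Zp.span_base) simp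
  finally have "integral_over_Zp z"
    using \<open>n > 0\<close> integral_over_Zp_iff_power_span by blast
  have "lead_coeff g \<noteq> 0" using g(1) by simp
  then obtain v u where vu: "lead_coeff g = of_nat CARD('p) ^ v * u" "Rep_padic_int u 1 \<noteq> 0"
    by (rule padic_int_factorization)
  obtain w where w: "u * w = 1" using padic_int_unit[OF vu(2)] .
  then have uw: "embed_Zp u * embed_Zp w = 1" by (simp flip: embed_Zp.hom_mult)
  have "embed_Zp w * z = (embed_Zp u * embed_Zp w) * (of_nat CARD('p) ^ v * x)"
    by (simp add: z_def h_def vu(1) embed_Zp.hom_mult embed_Zp.hom_power)
  then have "embed_Zp w * z = of_nat CARD('p) ^ v * x" by (simp only: uw mult_1_left)
  then have "integral_over_Zp (of_nat CARD('p) ^ v * x)"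
    using integral_over_Zp_mult[OF integral_over_Zp_embed \<open>integral_over_Zp z\<close>, of w] by simp
  then show thesis by (rule that)
qed

section \<open>Evaluation of power series\<close>

text \<open>By the ultrametric property a single finite set is a sufficient witness: if all terms
  outside it are small, every larger finite set has nearly the same sum. Witnesses of two series can
  then simply be united.\<close>

definition padic_sums :: "('k \<Rightarrow> 'p :: prime_card padic_closure) \<Rightarrow> 'p padic_closure \<Rightarrow> bool" where
  "padic_sums a s \<longleftrightarrow>
     (\<forall>N. \<exists>S. finite S \<and> (\<forall>k. k \<notin> S \<longrightarrow> padic_small N (a k)) \<and> padic_small N (sum a S - s))"

lemma padic_sums_superset:
  assumes "finite Y" "S \<subseteq> Y" and "\<And>k. k \<notin> S \<Longrightarrow> padic_small N (a k)" and "padic_small N (sum a S - s)"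
  shows "padic_small N (sum a Y - s)"
proof -
  have "sum a Y - s = sum a (Y - S) + (sum a S - s)"
    using sum.subset_diff[OF assms(2,1), of a] by simp
  also have "padic_small N \<dots>"
    by (intro padic_small_add padic_small_sum assms(4)) (simp add: assms(3))
  finally show ?thesis .
qed

text \<open>In the backward direction, a term outside the witness is a difference of two partial
  sums that are both close to \<open>s\<close>.\<close>

lemma padic_sums_iff_eventually:
  "padic_sums a s \<longleftrightarrow> (\<forall>N. \<forall>\<^sub>F S in finite_subsets_at_top UNIV. padic_small N (sum a S - s))"
proof
  assume *: "padic_sums a s"
  show "\<forall>N. \<forall>\<^sub>F S in finite_subsets_at_top UNIV. padic_small N (sum a S - s)"
  proof
    fix N
    obtain S where S: "finite S" "\<And>k. k \<notin> S \<Longrightarrow> padic_small N (a k)" "padic_small N (sum a S - s)"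
      using * unfolding padic_sums_def by blast
    have "padic_small N (sum a Y - s)" if "finite Y" "S \<subseteq> Y" for Y
      by (rule padic_sums_superset[OF that S(2,3)])
    then show "\<forall>\<^sub>F S in finite_subsets_at_top UNIV. padic_small N (sum a S - s)"
      unfolding eventually_finite_subsets_at_top using S(1) by blast
  qed
next
  assume *: "\<forall>N. \<forall>\<^sub>F S in finite_subsets_at_top UNIV. padic_small N (sum a S - s)"
  show "padic_sums a s"
    unfolding padic_sums_def
  proof
    fix N
    from * have "\<exists>S. finite S \<and> (\<forall>Y. finite Y \<and> S \<subseteq> Y \<longrightarrow> padic_small N (sum a Y - s))"
      by (simp add: eventually_finite_subsets_at_top)
    then obtain S where "finite S" "\<forall>Y. finite Y \<and> S \<subseteq> Y \<longrightarrow> padic_small N (sum a Y - s)"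
      by (elim exE conjE)
    then have S: "finite S" "\<And>Y. finite Y \<Longrightarrow> S \<subseteq> Y \<Longrightarrow> padic_small N (sum a Y - s)"
      by simp_all
    have "padic_small N (a k)" if "k \<notin> S" for k
    proof -
      have "a k = (sum a (insert k S) - s) - (sum a S - s)" using that S(1) by simp
      also have "padic_small N \<dots>"
        by (intro padic_small_diff S(2)) (simp_all add: S(1) subset_insertI)
      finally show ?thesis .
    qed
    then show "\<exists>S. finite S \<and> (\<forall>k. k \<notin> S \<longrightarrow> padic_small N (a k)) \<and> padic_small N (sum a S - s)"
      using S by blast
  qed
qed

text \<open>A partial sum over the union of two witnesses is close to both limits, so these differ
  by an element of every p^N O.\<close>

lemma padic_sums_unique:
  assumes "padic_sums a s" and "padic_sums a s'"
  shows "s = s'"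
proof -
  have "padic_small N (s - s')" for N
  proof -
    obtain S where S: "finite S" "\<And>k. k \<notin> S \<Longrightarrow> padic_small N (a k)" "padic_small N (sum a S - s)"
      using assms(1) unfolding padic_sums_def by blast
    obtain T where T: "finite T" "\<And>k. k \<notin> T \<Longrightarrow> padic_small N (a k)" "padic_small N (sum a T - s')"
      using assms(2) unfolding padic_sums_def by blast
    have "padic_small N (sum a (S \<union> T) - s)"
      by (rule padic_sums_superset[OF _ _ S(2,3)]) (simp_all add: S(1) T(1))
    moreover have "padic_small N (sum a (S \<union> T) - s')"
      by (rule padic_sums_superset[OF _ _ T(2,3)]) (simp_all add: S(1) T(1))
    ultimately have "padic_small N ((sum a (S \<union> T) - s') - (sum a (S \<union> T) - s))"
      by (rule padic_small_diff[rotated])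
    then show ?thesis by simp
  qed
  then have "s - s' = 0" by (rule padic_small_all_imp_0)
  then show ?thesis by simp
qed

lemma padic_sums_finite_support:
  assumes "finite S" and "\<And>k. k \<notin> S \<Longrightarrow> a k = 0"
  shows "padic_sums a (sum a S)"
  unfolding padic_sums_def using assms by (intro allI exI[of _ S]) simp

lemma padic_sums_add:
  assumes "padic_sums a s" and "padic_sums b t"
  shows "padic_sums (\<lambda>k. a k + b k) (s + t)"
  unfolding padic_sums_def
proof
  fix N
  obtain S where S: "finite S" "\<And>k. k \<notin> S \<Longrightarrow> padic_small N (a k)" "padic_small N (sum a S - s)"
    using assms(1) unfolding padic_sums_def by blast
  obtain T where T: "finite T" "\<And>k. k \<notin> T \<Longrightarrow> padic_small N (b k)" "padic_small N (sum b T - t)"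
    using assms(2) unfolding padic_sums_def by blast
  have *: "padic_small N (sum a (S \<union> T) - s)"
    by (rule padic_sums_superset[OF _ _ S(2,3)]) (simp_all add: S(1) T(1))
  have **: "padic_small N (sum b (S \<union> T) - t)"
    by (rule padic_sums_superset[OF _ _ T(2,3)]) (simp_all add: S(1) T(1))
  show "\<exists>S. finite S \<and> (\<forall>k. k \<notin> S \<longrightarrow> padic_small N (a k + b k)) \<and>
      padic_small N ((\<Sum>k\<in>S. a k + b k) - (s + t))"
  proof (intro exI[of _ "S \<union> T"] conjI allI impI)
    show "padic_small N ((\<Sum>k\<in>S \<union> T. a k + b k) - (s + t))"
      using padic_small_add[OF * **] by (simp add: sum.distrib algebra_simps)
  qed (use S T in \<open>auto intro: padic_small_add\<close>)
qed

lemma padic_sums_uminus: "padic_sums a s \<Longrightarrow> padic_sums (\<lambda>k. - a k) (- s)"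
  unfolding padic_sums_def
proof (intro allI)
  fix N
  assume "\<forall>N. \<exists>S. finite S \<and> (\<forall>k. k \<notin> S \<longrightarrow> padic_small N (a k)) \<and> padic_small N (sum a S - s)"
  then obtain S where S: "finite S" "\<And>k. k \<notin> S \<Longrightarrow> padic_small N (a k)" "padic_small N (sum a S - s)"
    by blast
  show "\<exists>S. finite S \<and> (\<forall>k. k \<notin> S \<longrightarrow> padic_small N (- a k)) \<and>
      padic_small N ((\<Sum>k\<in>S. - a k) - - s)"
    using padic_small_uminus[OF S(3)] S(1) padic_small_uminus[OF S(2)]
    by (intro exI[of _ S]) (simp add: sum_negf)
qed

text \<open>Outside a finite set the terms are integral, by convergence at N = 0; the finitely many
  others and the sum have a common denominator p^c. Products need this, as an error in one factor is
  multiplied by values of the other.\<close>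

lemma padic_sums_bounded:
  fixes a :: "'k \<Rightarrow> 'p :: prime_card padic_closure"
  assumes "padic_sums a s"
  obtains c where "\<And>k. integral_over_Zp (of_nat CARD('p) ^ c * a k)"
    and "integral_over_Zp (of_nat CARD('p) ^ c * s)"
proof -
  let ?p = "of_nat CARD('p) :: 'p padic_closure"
  have int: "integral_over_Zp (?p ^ c * x)" if "integral_over_Zp (?p ^ d * x)" "d \<le> c" for c d x
  proof -
    have "?p ^ c * x = ?p ^ (c - d) * (?p ^ d * x)"
      using that(2) by (simp add: power_add[symmetric] mult.assoc[symmetric])
    then show ?thesis
      by (simp only: integral_over_Zp_mult integral_over_Zp_power integral_over_Zp_of_nat that(1))
  qed
  have fin: "\<exists>c. \<forall>x\<in>Y. integral_over_Zp (?p ^ c * x)" if "finite Y" for Y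
    using that
  proof induction
    case (insert x Y)
    then obtain c where c: "\<And>x. x \<in> Y \<Longrightarrow> integral_over_Zp (?p ^ c * x)" by blast
    obtain d where d: "integral_over_Zp (?p ^ d * x)" by (rule padic_bounded)
    show ?case
      by (rule exI[of _ "max c d"]) (use int[OF d] int[OF c] in auto)
  qed simp
  obtain S where S: "finite S" "\<And>k. k \<notin> S \<Longrightarrow> padic_small 0 (a k)"
    using assms unfolding padic_sums_def by blast
  obtain c where c: "\<And>x. x \<in> insert s (a ` S) \<Longrightarrow> integral_over_Zp (?p ^ c * x)"
    using fin[of "insert s (a ` S)"] S(1) by blast
  show thesis
  proof
    show "integral_over_Zp (?p ^ c * s)" by (rule c) simp
    fix k
    show "integral_over_Zp (?p ^ c * a k)"
    proof (cases "k \<in> S")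
      case False
      then show ?thesis using int[of 0 "a k" c] S(2) by (simp add: padic_small_0_iff)
    qed (auto intro: c)
  qed
qed

lemma padic_small_mult_bounded:
  assumes "padic_small (N + c) x" and "integral_over_Zp (of_nat CARD('p) ^ c * y)"
  shows "padic_small N (x * (y :: 'p :: prime_card padic_closure))"
proof -
  have "x * y / of_nat CARD('p) ^ N = x / of_nat CARD('p) ^ (N + c) * (of_nat CARD('p) ^ c * y)"
    by (simp add: power_add)
  then show ?thesis using integral_over_Zp_mult[OF assms[unfolded padic_small_def]]
    by (simp only: padic_small_def)
qed

text \<open>The precision demanded of each factor is raised by the denominator exponent of the other
  one. \<open>U\<close> consists of the sums i + j with (i, j) in S x T; resorting its Cauchy
  coefficients by pairs gives \<open>Q\<close>, which contains S x T and otherwise only pairs with a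
  small product.\<close>

lemma padic_sums_mult:
  fixes a b :: "('d :: finite \<Rightarrow> nat) \<Rightarrow> 'p :: prime_card padic_closure"
  assumes "padic_sums a s" and "padic_sums b t"
  shows "padic_sums (\<lambda>k. \<Sum>i\<in>{i. i \<le> k}. a i * b (\<lambda>x. k x - i x)) (s * t)"
  unfolding padic_sums_def
proof
  fix N
  obtain c where c: "\<And>k. integral_over_Zp (of_nat CARD('p) ^ c * a k)"
    "integral_over_Zp (of_nat CARD('p) ^ c * s)"
    using padic_sums_bounded[OF assms(1)] by blast
  obtain d where d: "\<And>k. integral_over_Zp (of_nat CARD('p) ^ d * b k)"
    "integral_over_Zp (of_nat CARD('p) ^ d * t)"
    using padic_sums_bounded[OF assms(2)] by blast
  obtain S where S: "finite S" "\<And>k. k \<notin> S \<Longrightarrow> padic_small (N + d) (a k)"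
    "padic_small (N + d) (sum a S - s)"
    using assms(1) unfolding padic_sums_def by blast
  obtain T where T: "finite T" "\<And>k. k \<notin> T \<Longrightarrow> padic_small (N + c) (b k)"
    "padic_small (N + c) (sum b T - t)"
    using assms(2) unfolding padic_sums_def by blast
  have small: "padic_small N (a i * b j)" if "i \<notin> S \<or> j \<notin> T" for i j
    using that padic_small_mult_bounded[OF S(2) d(1)] padic_small_mult_bounded[OF T(2) c(1)]
    by (auto simp: mult.commute)
  define U where "U = (\<lambda>(i, j) x. i x + j x :: nat) ` (S \<times> T)"
  define Q where "Q = (\<lambda>(k, i). (i, \<lambda>x. k x - i x)) ` Sigma U (\<lambda>k. {i. i \<le> k})"
  have finU: "finite U" using S(1) T(1) by (simp add: U_def)
  have finQ: "finite Q" using finU by (simp add: Q_def finite_multiindices_le)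
  have ST: "S \<times> T \<subseteq> Q"
  proof (clarify)
    fix i j assume ij: "i \<in> S" "j \<in> T"
    have "(\<lambda>x. i x + j x) \<in> U" unfolding U_def using ij by (intro image_eqI[of _ _ "(i, j)"]) auto
    then show "(i, j) \<in> Q"
      unfolding Q_def by (intro image_eqI[of _ _ "(\<lambda>x. i x + j x, i)"]) (auto simp: le_fun_def)
  qed
  have inj: "inj_on (\<lambda>(k, i). (i, \<lambda>x. k x - i x :: nat)) (Sigma U (\<lambda>k. {i. i \<le> k}))"
    by (rule inj_on_inverseI[where g = "\<lambda>(i, j). (\<lambda>x. i x + j x, i)"]) (auto simp: le_fun_def)
  have "(\<Sum>k\<in>U. \<Sum>i\<in>{i. i \<le> k}. a i * b (\<lambda>x. k x - i x)) =
      (\<Sum>(k, i)\<in>Sigma U (\<lambda>k. {i. i \<le> k}). a i * b (\<lambda>x. k x - i x))"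
    by (rule sum.Sigma) (auto simp: finU finite_multiindices_le)
  also have "\<dots> = (\<Sum>(i, j)\<in>Q. a i * b j)"
    unfolding Q_def sum.reindex[OF inj] by (simp add: case_prod_unfold)
  also have "\<dots> = (\<Sum>(i, j)\<in>Q - S \<times> T. a i * b j) + (\<Sum>(i, j)\<in>S \<times> T. a i * b j)"
    by (rule sum.subset_diff[OF ST finQ])
  also have "(\<Sum>(i, j)\<in>S \<times> T. a i * b j) = sum a S * sum b T"
    by (simp add: sum_product sum.cartesian_product)
  \<comment> \<open>Each error term has a small factor; the bounds on s and t control the two that
    are not products of errors.\<close>
  also have "sum a S * sum b T =
      s * t + ((sum a S - s) * t + (sum b T - t) * s + (sum a S - s) * (sum b T - t))"
    by (simp add: algebra_simps)
  finally have eq: "(\<Sum>k\<in>U. \<Sum>i\<in>{i. i \<le> k}. a i * b (\<lambda>x. k x - i x)) - s * t =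
      (\<Sum>(i, j)\<in>Q - S \<times> T. a i * b j) +
      ((sum a S - s) * t + (sum b T - t) * s + (sum a S - s) * (sum b T - t))"
    by simp
  show "\<exists>U. finite U \<and> (\<forall>k. k \<notin> U \<longrightarrow> padic_small N (\<Sum>i\<in>{i. i \<le> k}. a i * b (\<lambda>x. k x - i x))) \<and>
      padic_small N ((\<Sum>k\<in>U. \<Sum>i\<in>{i. i \<le> k}. a i * b (\<lambda>x. k x - i x)) - s * t)"
  proof (intro exI[of _ U] conjI allI impI finU)
    \<comment> \<open>No decomposition k = i + j outside \<open>U\<close> has both parts in the
      witnesses, so every summand is small.\<close>
    fix k assume k: "k \<notin> U"
    show "padic_small N (\<Sum>i\<in>{i. i \<le> k}. a i * b (\<lambda>x. k x - i x))"
    proof (rule padic_small_sum, rule small, rule ccontr)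
      fix i assume i: "i \<in> {i. i \<le> k}" and "\<not> (i \<notin> S \<or> (\<lambda>x. k x - i x) \<notin> T)"
      moreover have "k = (\<lambda>x. i x + (k x - i x))" using i by (auto simp: le_fun_def)
      ultimately have "k \<in> U"
        unfolding U_def by (intro image_eqI[of _ _ "(i, \<lambda>x. k x - i x)"]) auto
      then show False using k by simp
    qed
  next
    have "padic_small (N + d + (N + c)) ((sum a S - s) * (sum b T - t))"
      by (rule padic_small_mult[OF S(3) T(3)])
    then have "padic_small N ((sum a S - s) * (sum b T - t))"
      by (rule padic_small_mono) simp
    then show "padic_small N ((\<Sum>k\<in>U. \<Sum>i\<in>{i. i \<le> k}. a i * b (\<lambda>x. k x - i x)) - s * t)"
      unfolding eq
      by (intro padic_small_add padic_small_sum padic_small_mult_bounded[OF S(3) d(2)]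
          padic_small_mult_bounded[OF T(3) c(2)]) (auto intro: small)
  qed
qed

section \<open>Evaluation and the ring operations\<close>

lemma mfps_has_value_iff:
  "mfps_has_value f t s \<longleftrightarrow>
     padic_sums (\<lambda>k. to_ac (mfps_nth f k) * (\<Prod>i\<in>UNIV. t i ^ k i)) s"
  by (simp add: padic_sums_iff_eventually mfps_has_value_def padic_small_def)

lemma mfps_eval_eq: "mfps_has_value f t s \<Longrightarrow> mfps_eval f t = s"
  unfolding mfps_eval_def mfps_has_value_iff by (rule the_equality) (auto intro: padic_sums_unique)

lemma mfps_has_value_const: "mfps_has_value (mfps_const c) t (to_ac c)"
proof -
  let ?a = "\<lambda>k. to_ac (mfps_nth (mfps_const c) k) * (\<Prod>i\<in>UNIV. t i ^ k i)"
  have "padic_sums ?a (sum ?a {\<lambda>_. 0})"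
    by (rule padic_sums_finite_support) (auto simp: mfps_const_def Abs_mfps_inverse)
  then show ?thesis by (simp add: mfps_has_value_iff mfps_const_def Abs_mfps_inverse)
qed

lemma mfps_has_value_0: "mfps_has_value 0 t 0"
  using padic_sums_finite_support[of "{}" "\<lambda>_. 0"]
  by (simp add: mfps_has_value_iff zero_mfps.rep_eq)

lemma mfps_has_value_1: "mfps_has_value 1 t 1"
proof -
  have "(1 :: ('a, 'b padic_field) mfps) = mfps_const 1"
    by (simp add: mfps_nth_inject[symmetric] one_mfps.rep_eq mfps_const_def Abs_mfps_inverse)
  then show ?thesis using mfps_has_value_const[of 1 t] by simp
qed

lemma mfps_has_value_add:
  "mfps_has_value f t x \<Longrightarrow> mfps_has_value g t y \<Longrightarrow> mfps_has_value (f + g) t (x + y)"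
  unfolding mfps_has_value_iff
  by (drule (1) padic_sums_add) (simp add: plus_mfps.rep_eq distrib_right)

lemma mfps_has_value_uminus: "mfps_has_value f t x \<Longrightarrow> mfps_has_value (- f) t (- x)"
  unfolding mfps_has_value_iff
  by (drule padic_sums_uminus) (simp add: uminus_mfps.rep_eq)

lemma mfps_has_value_mult:
  assumes "mfps_has_value f t x" and "mfps_has_value g t y"
  shows "mfps_has_value (f * g) t (x * y)"
proof -
  have "(\<Sum>i\<in>{i. i \<le> k}. (to_ac (mfps_nth f i) * (\<Prod>x\<in>UNIV. t x ^ i x)) *
          (to_ac (mfps_nth g (\<lambda>x. k x - i x)) * (\<Prod>x\<in>UNIV. t x ^ (k x - i x)))) =
        to_ac (mfps_nth (f * g) k) * (\<Prod>x\<in>UNIV. t x ^ k x)" for k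
    unfolding times_mfps.rep_eq to_ac_sum to_ac_mult sum_distrib_right
  proof (rule sum.cong)
    fix i assume "i \<in> {i. i \<le> k}"
    then have "(\<Prod>x\<in>UNIV. t x ^ k x) = (\<Prod>x\<in>UNIV. t x ^ i x) * (\<Prod>x\<in>UNIV. t x ^ (k x - i x))"
      by (simp add: prod.distrib[symmetric] power_add[symmetric] le_fun_def)
    then show "(to_ac (mfps_nth f i) * (\<Prod>x\<in>UNIV. t x ^ i x)) *
          (to_ac (mfps_nth g (\<lambda>x. k x - i x)) * (\<Prod>x\<in>UNIV. t x ^ (k x - i x))) =
        to_ac (mfps_nth f i) * to_ac (mfps_nth g (\<lambda>x. k x - i x)) * (\<Prod>x\<in>UNIV. t x ^ k x)"
      by (simp only: mult_ac)
  qed simp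
  then show ?thesis
    using padic_sums_mult[OF assms[unfolded mfps_has_value_iff]]
    unfolding mfps_has_value_iff by simp
qed

lemma mfps_has_value_sum:
  "(\<And>a. a \<in> A \<Longrightarrow> mfps_has_value (f a) t (x a)) \<Longrightarrow> mfps_has_value (sum f A) t (sum x A)"
  by (induction A rule: infinite_finite_induct) (auto intro: mfps_has_value_add mfps_has_value_0)

lemma mfps_has_value_prod:
  "(\<And>a. a \<in> A \<Longrightarrow> mfps_has_value (f a) t (x a)) \<Longrightarrow> mfps_has_value (prod f A) t (prod x A)"
  by (induction A rule: infinite_finite_induct) (auto intro: mfps_has_value_mult mfps_has_value_1)

section \<open>The binomial series at a root of unity minus 1\<close>

lemma integral_over_Zp_root_of_unity:
  assumes "\<zeta> \<in> roots_of_unity n"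
  shows "integral_over_Zp (\<zeta> :: 'p :: prime_card padic_closure)"
proof -
  have "CARD('p) ^ n > 0" using prime_gt_0_nat[OF prime_card[where ?'a = 'p]] by simp
  moreover have "\<zeta> ^ (CARD('p) ^ n) = \<zeta> ^ 0" using assms by (simp add: roots_of_unity_def)
  ultimately show ?thesis
    unfolding integral_over_Zp_iff_power_span
    by (intro exI[of _ "CARD('p) ^ n"] conjI) (auto intro!: Zp.span_base image_eqI[of _ _ 0])
qed

text \<open>With q = p^n, k times (q choose k) is a multiple of q. If p did not divide the binomial
  coefficient, all of q would divide k, although 0 < k < q.\<close>

lemma prime_dvd_prime_power_choose:
  assumes "prime (p :: nat)" "0 < k" "k < p ^ n"
  shows "p dvd (p ^ n choose k)"
proof (rule ccontr)
  assume "\<not> p dvd (p ^ n choose k)"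
  then have "coprime (p ^ n) (p ^ n choose k)"
    using prime_imp_coprime[OF assms(1)] by simp
  moreover have "p ^ n dvd k * (p ^ n choose k)"
    using times_binomial_minus1_eq[OF assms(2), of "p ^ n"] by simp
  ultimately have "p ^ n dvd k" by (simp add: coprime_dvd_mult_left_iff)
  then show False using assms(2,3) by (simp add: nat_dvd_not_less)
qed

text \<open>In 1 = ((\<zeta> - 1) + 1)^q the inner binomial coefficients are divisible by p. The
  resulting topological nilpotence of \<zeta> - 1 is what makes the series converge there.\<close>

lemma padic_small_root_of_unity_diff_1:
  assumes "\<zeta> \<in> roots_of_unity n"
  shows "padic_small 1 ((\<zeta> - 1 :: 'p :: prime_card padic_closure) ^ (CARD('p) ^ n))"
proof -
  define q where "q = CARD('p) ^ n"
  define z where "z = \<zeta> - 1"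
  have q: "q > 0" using prime_gt_0_nat[OF prime_card[where ?'a = 'p]] by (simp add: q_def)
  have z: "integral_over_Zp z"
    using integral_over_Zp_add[OF integral_over_Zp_root_of_unity[OF assms]
        integral_over_Zp_uminus[OF integral_over_Zp_1]] by (simp add: z_def)
  have "1 = (z + 1) ^ q" using assms by (simp add: roots_of_unity_def q_def z_def)
  also have "\<dots> = (\<Sum>k\<le>q. of_nat (q choose k) * z ^ k)" by (simp add: binomial_ring)
  also have "{..q} = insert 0 (insert q {0<..<q})" using q by auto
  also have "(\<Sum>k\<in>\<dots>. of_nat (q choose k) * z ^ k) =
      1 + (z ^ q + (\<Sum>k\<in>{0<..<q}. of_nat (q choose k) * z ^ k))"
    using q by simp
  finally have "z ^ q = - (\<Sum>k\<in>{0<..<q}. of_nat (q choose k) * z ^ k)"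
    by (simp add: eq_neg_iff_add_eq_0)
  also have "padic_small 1 \<dots>"
  proof (rule padic_small_uminus, rule padic_small_sum)
    fix k assume "k \<in> {0<..<q}"
    then have "CARD('p) dvd (q choose k)"
      unfolding q_def by (intro prime_dvd_prime_power_choose prime_card) auto
    then obtain c where "q choose k = CARD('p) * c" by (rule dvdE)
    then have "of_nat (q choose k) * z ^ k / of_nat CARD('p) ^ 1 = of_nat c * z ^ k" by simp
    then show "padic_small 1 (of_nat (q choose k) * z ^ k)"
      unfolding padic_small_def
      by (simp only: integral_over_Zp_mult integral_over_Zp_of_nat integral_over_Zp_power z)
  qed
  finally show ?thesis by (simp only: q_def z_def)
qed

text \<open>Factors are exchanged one at a time. Applied to falling factorials, it makes them
  congruent at congruent arguments.\<close>

lemma prod_diff_dvd: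
  fixes f g :: "'a \<Rightarrow> 'b :: comm_ring_1"
  assumes "\<And>i. i \<in> A \<Longrightarrow> d dvd f i - g i"
  shows "d dvd prod f A - prod g A"
  using assms
proof (induction A rule: infinite_finite_induct)
  case (insert i A)
  have "prod f (insert i A) - prod g (insert i A) =
      (f i - g i) * prod f A + g i * (prod f A - prod g A)"
    using insert.hyps by (simp add: algebra_simps)
  also have "d dvd \<dots>" by (intro dvd_add dvd_mult dvd_mult2 insert.IH insert.prems) auto
  finally show ?case .
qed auto

text \<open>The case \<open>N = 0\<close> gives the integrality of the binomial coefficient.\<close>

lemma gchoose_approx:
  fixes a :: "'p :: prime_card padic_int"
  shows "\<exists>N'. \<forall>M\<ge>N'. \<exists>b. (to_fract a gchoose k) - of_nat (nat (Rep_padic_int a M) choose k) =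
        to_fract (of_nat CARD('p) ^ N * b)"
proof -
  let ?p = "of_nat CARD('p) :: 'p padic_int"
  have "(of_nat (fact k) :: 'p padic_int) \<noteq> 0" unfolding of_nat_eq_0_iff by simp
  then obtain v u where vu: "of_nat (fact k) = ?p ^ v * u" "Rep_padic_int u 1 \<noteq> 0"
    by (rule padic_int_factorization)
  obtain w where w: "u * w = 1" using padic_int_unit[OF vu(2)] .
  show ?thesis
  \<comment> \<open>Dividing by k! = p^v u loses v digits, so \<open>a\<close> has to be known
    modulo p^(N + v).\<close>
  proof (intro exI[of _ "N + v"] allI impI)
    fix M assume M: "M \<ge> N + v"
    define r where "r = nat (Rep_padic_int a M)"
    have r: "int r = Rep_padic_int a M" using Rep_padic_int_bounds[of a M] by (simp add: r_def)
    have "Rep_padic_int (a - of_nat r) M = 0"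
      using r by (simp add: minus_padic_int.rep_eq Rep_of_nat_padic_int mod_simps)
    then obtain d where "a - of_nat r = ?p ^ M * d" by (rule padic_int_divide_prime_power)
    then have dvd: "?p ^ M dvd a - of_nat r" by simp
    have "?p ^ M dvd (\<Prod>i = 0..<k. a - of_nat i) - (\<Prod>i = 0..<k. of_nat r - of_nat i)"
      by (rule prod_diff_dvd) (simp add: dvd)
    then obtain e where e: "(\<Prod>i = 0..<k. a - of_nat i) - (\<Prod>i = 0..<k. of_nat r - of_nat i) = ?p ^ M * e"
      by (rule dvdE)
    \<comment> \<open>This is p^M e divided by k! and by p^N, where \<open>w\<close> inverts the
      unit part of k!.\<close>
    define b where "b = ?p ^ (M - v - N) * e * w"
    have fract_of_nat: "to_fract (of_nat i) = (of_nat i :: 'p padic_field)" for i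
      by (induction i) simp_all
    have prod: "to_fract (\<Prod>i = 0..<k. f i) = (\<Prod>i = 0..<k. to_fract (f i))" for f :: "nat \<Rightarrow> 'p padic_int"
      by (induction k) simp_all
    have "(fact k :: 'p padic_field) * ((to_fract a gchoose k) - of_nat (r choose k)) =
        fact k * (to_fract a gchoose k) - fact k * (of_nat r gchoose k)"
      by (simp only: right_diff_distrib binomial_gbinomial)
    also have "\<dots> = (\<Prod>i = 0..<k. to_fract a - of_nat i) - (\<Prod>i = 0..<k. of_nat r - of_nat i)"
      by (simp only: gbinomial_mult_fact)
    also have "\<dots> = to_fract (?p ^ M * e)"
      by (simp only: e[symmetric] to_fract_diff prod fract_of_nat)
    also have "?p ^ M * e = ?p ^ v * u * (?p ^ N * b)"
    proof -
      have "?p ^ v * u * (?p ^ N * b) = (?p ^ v * ?p ^ N * ?p ^ (M - v - N)) * e * (u * w)"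
        by (simp add: b_def mult_ac)
      also have "?p ^ v * ?p ^ N * ?p ^ (M - v - N) = ?p ^ M"
        using M by (simp add: power_add[symmetric])
      finally show ?thesis by (simp add: w)
    qed
    also have "to_fract (?p ^ v * u * (?p ^ N * b)) = fact k * to_fract (?p ^ N * b)"
    proof -
      have "to_fract (?p ^ v * u) = fact k"
        unfolding vu(1)[symmetric] fract_of_nat by (rule of_nat_fact)
      then show ?thesis by (simp only: to_fract_mult[of "?p ^ v * u"])
    qed
    finally have "(to_fract a gchoose k) - of_nat (r choose k) = to_fract (?p ^ N * b)"
      by simp
    then show "\<exists>b. (to_fract a gchoose k) - of_nat (nat (Rep_padic_int a M) choose k) =
        to_fract (?p ^ N * b)" unfolding r_def by blast
  qed
qed

lemma integral_over_Zp_gchoose: "integral_over_Zp (to_ac (to_fract a gchoose k))"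
proof -
  obtain N' where "\<forall>M\<ge>N'. \<exists>b. (to_fract a gchoose k) - of_nat (nat (Rep_padic_int a M) choose k) =
        to_fract (of_nat CARD('a) ^ 0 * b)"
    using gchoose_approx[of a k 0] ..
  from this[rule_format, OF order_refl]
  obtain b where "(to_fract a gchoose k) - of_nat (nat (Rep_padic_int a N') choose k) = to_fract b"
    by auto
  then have "to_fract a gchoose k = of_nat (nat (Rep_padic_int a N') choose k) + to_fract b"
    by (simp add: diff_eq_eq)
  then have "to_ac (to_fract a gchoose k) = of_nat (nat (Rep_padic_int a N') choose k) + embed_Zp b"
    by (simp add: embed_Zp_def)
  then show ?thesis by (simp add: integral_over_Zp_add)
qed

text \<open>For a natural number r close to \<open>a\<close>, (1 + z)^r with z = \<zeta> - 1 is a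
  finite binomial sum. Below a bound K its coefficients agree with those of the series up to p^N,
  and from K on the terms of both are small. The value \<zeta>^r depends on r modulo p^n only, hence
  on the n-th residue of \<open>a\<close>.\<close>

lemma binomial_series_sums:
  fixes a :: "'p :: prime_card padic_int"
  assumes "\<zeta> \<in> roots_of_unity n"
  shows "padic_sums (\<lambda>k. to_ac (to_fract a gchoose k) * (\<zeta> - 1) ^ k) (\<zeta> ^ nat (Rep_padic_int a n))"
  unfolding padic_sums_def
proof
  fix N
  define q where "q = CARD('p) ^ n"
  define z where "z = \<zeta> - 1"
  \<comment> \<open>z^K is a product of N factors z^q, each of them in p O.\<close>
  define K where "K = q * N"
  have q: "q > 0" using prime_gt_0_nat[OF prime_card[where ?'a = 'p]] by (simp add: q_def)
  have z: "integral_over_Zp z"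
    using integral_over_Zp_add[OF integral_over_Zp_root_of_unity[OF assms]
        integral_over_Zp_uminus[OF integral_over_Zp_1]] by (simp add: z_def)
  have "padic_small N ((z ^ q) ^ N)"
  proof (induction N)
    case (Suc N)
    then show ?case
      using padic_small_mult[OF padic_small_root_of_unity_diff_1[OF assms] Suc]
      by (simp add: z_def q_def)
  qed (simp add: padic_small_0_iff)
  then have zK: "padic_small N (z ^ K)" by (simp add: K_def power_mult)
  have tail: "padic_small N (c * z ^ k)" if "integral_over_Zp c" "K \<le> k" for c k
  proof -
    have "c * z ^ k = z ^ K * (c * z ^ (k - K))"
      using that(2) by (simp add: power_add[symmetric])
    also have "padic_small (N + 0) \<dots>"
      by (rule padic_small_mult[OF zK])
         (simp only: padic_small_0_iff integral_over_Zp_mult integral_over_Zp_power z that(1))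
    finally show ?thesis by simp
  qed
  from choice[OF allI[OF gchoose_approx]] obtain N' where
    *: "\<forall>k. \<forall>M\<ge>N' k. \<exists>b. (to_fract a gchoose k) - of_nat (nat (Rep_padic_int a M) choose k) =
        to_fract (of_nat CARD('p) ^ N * b)" ..
  \<comment> \<open>The sum bounds every threshold \<open>N' k\<close> with k < K, and M is at least
    n so that r reduces to the n-th residue of \<open>a\<close>.\<close>
  define M where "M = n + (\<Sum>k<K. N' k)"
  define r where "r = nat (Rep_padic_int a M)"
  have approx: "padic_small N ((to_ac (to_fract a gchoose k) - of_nat (r choose k)) * z ^ k)" if "k < K" for k
  proof -
    have "N' k \<le> (\<Sum>k<K. N' k)" using that by (intro member_le_sum) auto
    then have "N' k \<le> M" by (simp add: M_def)
    from *[rule_format, OF this, folded r_def] obtain b where b: "(to_fract a gchoose k) - of_nat (r choose k) = to_fract (of_nat CARD('p) ^ N * b)"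
      ..
    have "to_ac (to_fract a gchoose k) - of_nat (r choose k) = embed_Zp (of_nat CARD('p) ^ N * b)"
      by (simp only: embed_Zp_def b[symmetric] to_ac_diff to_ac_of_nat)
    then have "padic_small (N + 0) ((to_ac (to_fract a gchoose k) - of_nat (r choose k)) * z ^ k)"
      by (intro padic_small_mult)
         (simp_all add: padic_small_prime_power_mult embed_Zp.hom_mult embed_Zp.hom_power
           padic_small_0_iff integral_over_Zp_power z)
    then show ?thesis by simp
  qed
  have "\<zeta> ^ r = (z + 1) ^ r" by (simp add: z_def)
  also have "\<dots> = (\<Sum>k\<le>r. of_nat (r choose k) * z ^ k)" by (simp add: binomial_ring)
  \<comment> \<open>This range contains both {..r} and {..<K}; the coefficients beyond r
    vanish.\<close>
  also have "\<dots> = (\<Sum>k<K + r + 1. of_nat (r choose k) * z ^ k)"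
    by (rule sum.mono_neutral_left) auto
  also have "\<dots> = (\<Sum>k\<in>{..<K + r + 1} - {..<K}. of_nat (r choose k) * z ^ k) +
      (\<Sum>k<K. of_nat (r choose k) * z ^ k)"
    by (rule sum.subset_diff) auto
  finally have 1: "\<zeta> ^ r = \<dots>" .
  have "int r mod int q = int (nat (Rep_padic_int a n))"
    using Rep_padic_int_mod[of n M a] Rep_padic_int_bounds[of a M] Rep_padic_int_bounds[of a n]
    by (simp add: r_def q_def M_def)
  then have "r mod q = nat (Rep_padic_int a n)" by (metis of_nat_eq_iff zmod_int)
  moreover have "\<zeta> ^ r = \<zeta> ^ (q * (r div q) + r mod q)" by simp
  then have "\<zeta> ^ r = \<zeta> ^ (r mod q)"
    using assms by (simp only: power_add power_mult) (simp add: roots_of_unity_def q_def)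
  ultimately have 2: "\<zeta> ^ nat (Rep_padic_int a n) = \<zeta> ^ r" by simp
  have "(\<Sum>k<K. to_ac (to_fract a gchoose k) * z ^ k) - \<zeta> ^ nat (Rep_padic_int a n) =
      (\<Sum>k<K. (to_ac (to_fract a gchoose k) - of_nat (r choose k)) * z ^ k) -
      (\<Sum>k\<in>{..<K + r + 1} - {..<K}. of_nat (r choose k) * z ^ k)"
    unfolding 2 1 by (simp add: left_diff_distrib sum_subtractf)
  also have "padic_small N \<dots>"
    by (intro padic_small_diff padic_small_sum) (auto intro: approx tail)
  finally have "padic_small N ((\<Sum>k<K. to_ac (to_fract a gchoose k) * z ^ k) - \<zeta> ^ nat (Rep_padic_int a n))" .
  then show "\<exists>S. finite S \<and> (\<forall>k. k \<notin> S \<longrightarrow> padic_small N (to_ac (to_fract a gchoose k) * (\<zeta> - 1) ^ k)) \<and>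
      padic_small N ((\<Sum>k\<in>S. to_ac (to_fract a gchoose k) * (\<zeta> - 1) ^ k) - \<zeta> ^ nat (Rep_padic_int a n))"
    using tail[OF integral_over_Zp_gchoose] unfolding z_def[symmetric]
    by (intro exI[of _ "{..<K}"]) auto
qed

text \<open>Carries a series in one variable over to multi-indices, where all other coefficients are
  0.\<close>

lemma padic_sums_reindex:
  assumes "padic_sums a s" and "inj e" and "\<And>k. b (e k) = a k" and "\<And>x. x \<notin> range e \<Longrightarrow> b x = 0"
  shows "padic_sums b s"
  unfolding padic_sums_def
proof
  fix N
  obtain S where S: "finite S" "\<And>k. k \<notin> S \<Longrightarrow> padic_small N (a k)" "padic_small N (sum a S - s)"
    using assms(1) unfolding padic_sums_def by blast
  have "padic_small N (b x)" if "x \<notin> e ` S" for x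
  proof (cases "x \<in> range e")
    case True
    then obtain k where "x = e k" by blast
    then show ?thesis using that assms(3) S(2) by auto
  next
    case False
    then show ?thesis using assms(4) by simp
  qed
  moreover have "sum b (e ` S) = sum a S"
    using assms(2,3) by (subst sum.reindex) (auto simp: inj_on_def)
  ultimately show "\<exists>S. finite S \<and> (\<forall>x. x \<notin> S \<longrightarrow> padic_small N (b x)) \<and> padic_small N (sum b S - s)"
    using S(1,3) by (intro exI[of _ "e ` S"]) simp
qed

lemma mfps_has_value_binomial_series:
  fixes \<zeta> :: "'d :: finite \<Rightarrow> 'p :: prime_card padic_closure"
  assumes "\<zeta> i \<in> roots_of_unity n"
  shows "mfps_has_value (binomial_series i a) (\<lambda>i. \<zeta> i - 1) (\<zeta> i ^ nat (Rep_padic_int a n))"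
  unfolding mfps_has_value_iff
proof (rule padic_sums_reindex[OF binomial_series_sums[OF assms]])
  let ?e = "\<lambda>m j. if j = i then m else 0 :: nat"
  show "inj ?e" by (rule inj_on_inverseI[where g = "\<lambda>k. k i"]) simp
  show "to_ac (mfps_nth (binomial_series i a) (?e k)) * (\<Prod>j\<in>UNIV. (\<zeta> j - 1) ^ ?e k j) =
      to_ac (to_fract a gchoose k) * (\<zeta> i - 1) ^ k" for k
    by (simp add: binomial_series_def Abs_mfps_inverse if_distrib[of "(^) _"] cong: if_cong)
  fix k :: "'d \<Rightarrow> nat" assume k: "k \<notin> range ?e"
  have "\<not> (\<forall>j. j \<noteq> i \<longrightarrow> k j = 0)"
  proof
    assume "\<forall>j. j \<noteq> i \<longrightarrow> k j = 0"
    then have "k = ?e (k i)" by auto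
    then show False using k by blast
  qed
  then have "mfps_nth (binomial_series i a) k = 0"
    unfolding binomial_series_def Abs_mfps_inverse[OF UNIV_I] by (rule if_not_P)
  then show "to_ac (mfps_nth (binomial_series i a) k) * (\<Prod>j\<in>UNIV. (\<zeta> j - 1) ^ k j) = 0"
    by simp
qed

lemma mfps_has_value_tau:
  fixes \<zeta> :: "'d :: finite \<Rightarrow> 'p :: prime_card padic_closure"
  assumes "\<And>i. \<zeta> i \<in> roots_of_unity n"
  shows "mfps_has_value (tau c) (\<lambda>i. \<zeta> i - 1) (\<Prod>i\<in>UNIV. \<zeta> i ^ nat (Rep_padic_int (c i) n))"
  unfolding tau_def by (intro mfps_has_value_prod mfps_has_value_binomial_series assms)

section \<open>Specialisation of polynomials and determinants\<close>

text \<open>A relation instead of the function \<open>specialize\<close>: \<open>mfps_eval\<close>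
  respects the ring operations where series converge, so convergence of the coefficients is carried
  along until the determinant is reached.\<close>

definition poly_has_value where
  "poly_has_value F t F' \<longleftrightarrow> (\<forall>i. mfps_has_value (coeff F i) t (coeff F' i))"

lemma poly_has_value_0: "poly_has_value 0 t 0"
  by (simp add: poly_has_value_def mfps_has_value_0)

lemma poly_has_value_pCons:
  "mfps_has_value c t c' \<Longrightarrow> poly_has_value F t F' \<Longrightarrow> poly_has_value (pCons c F) t (pCons c' F')"
  by (simp add: poly_has_value_def coeff_pCons split: nat.split)

lemma poly_has_value_1: "poly_has_value 1 t 1"
  unfolding one_pCons by (intro poly_has_value_pCons poly_has_value_0 mfps_has_value_1)

lemma poly_has_value_add:
  "poly_has_value F t F' \<Longrightarrow> poly_has_value G t G' \<Longrightarrow> poly_has_value (F + G) t (F' + G')"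
  by (simp add: poly_has_value_def mfps_has_value_add)

lemma poly_has_value_uminus: "poly_has_value F t F' \<Longrightarrow> poly_has_value (- F) t (- F')"
  by (simp add: poly_has_value_def mfps_has_value_uminus)

lemma poly_has_value_diff:
  "poly_has_value F t F' \<Longrightarrow> poly_has_value G t G' \<Longrightarrow> poly_has_value (F - G) t (F' - G')"
  unfolding diff_conv_add_uminus by (intro poly_has_value_add poly_has_value_uminus)

lemma poly_has_value_mult:
  "poly_has_value F t F' \<Longrightarrow> poly_has_value G t G' \<Longrightarrow> poly_has_value (F * G) t (F' * G')"
  by (simp add: poly_has_value_def coeff_mult mfps_has_value_sum mfps_has_value_mult)

lemma poly_has_value_sum:
  "(\<And>a. a \<in> A \<Longrightarrow> poly_has_value (F a) t (F' a)) \<Longrightarrow> poly_has_value (sum F A) t (sum F' A)"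
  by (induction A rule: infinite_finite_induct) (auto intro: poly_has_value_add poly_has_value_0)

lemma poly_has_value_prod:
  "(\<And>a. a \<in> A \<Longrightarrow> poly_has_value (F a) t (F' a)) \<Longrightarrow> poly_has_value (prod F A) t (prod F' A)"
  by (induction A rule: infinite_finite_induct) (auto intro: poly_has_value_mult poly_has_value_1)

lemma poly_has_value_det:
  assumes A: "A \<in> carrier_mat n n" and B: "B \<in> carrier_mat n n"
    and rel: "\<And>i j. i < n \<Longrightarrow> j < n \<Longrightarrow> poly_has_value (A $$ (i, j)) t (B $$ (i, j))"
  shows "poly_has_value (det A) t (det B)"
  unfolding det_def'[OF A] det_def'[OF B]
proof (intro poly_has_value_sum poly_has_value_mult poly_has_value_prod)
  fix f :: "nat \<Rightarrow> nat"
  show "poly_has_value (signof f) t (signof f)"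
    by (simp add: sign_def poly_has_value_1 poly_has_value_uminus)
  fix i assume "f \<in> {f. f permutes {0..<n}}" "i \<in> {0..<n}"
  then show "poly_has_value (A $$ (i, f i)) t (B $$ (i, f i))"
    using permutes_in_image[of f "{0..<n}" i] by (intro rel) auto
qed

lemma specialize_eq:
  assumes "poly_has_value F t F'"
  shows "specialize F t = F'"
proof (rule poly_eqI)
  fix i
  have "mfps_eval 0 t = 0" by (rule mfps_eval_eq[OF mfps_has_value_0])
  then have "coeff (specialize F t) i = mfps_eval (coeff F i) t"
    by (simp add: specialize_def coeff_map_poly)
  also have "\<dots> = coeff F' i"
    using assms by (intro mfps_eval_eq) (simp add: poly_has_value_def)
  finally show "coeff (specialize F t) i = coeff F' i" .
qed

text \<open>In characteristic 0 the derivative q z^(q-1) is nonzero at every root, so the roots are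
  simple and their number is the degree. This makes the characters as numerous as the
  cosets.\<close>

lemma card_nth_roots_of_unity:
  assumes "q > 0"
  shows "card {z :: 'a :: {alg_closed_field, field_char_0}. z ^ q = 1} = q"
proof -
  define f :: "'a poly" where "f = monom 1 q - 1"
  have deg: "degree f = q"
    unfolding f_def diff_conv_add_uminus
    using assms by (subst degree_add_eq_left) (auto simp: degree_monom_eq)
  have f0: "f \<noteq> 0" using deg assms by auto
  have roots: "poly f z = 0 \<longleftrightarrow> z ^ q = 1" for z by (simp add: f_def poly_monom)
  have "rsquarefree f"
    unfolding rsquarefree_roots
  proof (intro allI notI)
    fix z assume *: "poly f z = 0 \<and> poly (pderiv f) z = 0"
    then have "z ^ q = 1" by (simp add: roots)
    then have "z \<noteq> 0" using assms by (auto simp: power_0_left)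
    moreover have "of_nat q * z ^ (q - 1) = 0"
      using * by (simp add: f_def pderiv_diff pderiv_monom poly_monom)
    ultimately show False using assms by simp
  qed
  then have ord: "order z f = 1" if "z ^ q = 1" for z
    using that rsquarefree_root_order f0 roots by blast
  obtain A where A: "size A = degree f" "f = smult (lead_coeff f) (\<Prod>x\<in>#A. [:- x, 1:])"
    using alg_closed_imp_factorization[OF f0] by blast
  have nz: "(\<Prod>x\<in>#M. [:- x, 1 :: 'a:]) \<noteq> 0" for M
    by (induction M) (simp_all del: mult_pCons_left)
  have "proots f = proots (\<Prod>x\<in>#A. [:- x, 1:])"
    by (subst A(2)) (use f0 in simp)
  also have "\<dots> = A"
  proof (induction A)
    case (add x A)
    have "proots ([:- x, 1:] * (\<Prod>x\<in>#A. [:- x, 1:])) = proots [:- x, 1:] + proots (\<Prod>x\<in>#A. [:- x, 1:])"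
      by (rule proots_mult[OF _ nz]) simp
    then show ?case using add.IH by (simp del: mult_pCons_left)
  qed simp
  finally have "size (proots f) = q" using A(1) deg by simp
  also have "size (proots f) = (\<Sum>z\<in>{z. z ^ q = 1}. count (proots f) z)"
    unfolding size_multiset_overloaded_eq using f0 by (simp add: roots)
  also have "\<dots> = card {z :: 'a. z ^ q = 1}"
    using f0 ord by simp
  finally show ?thesis by simp
qed

section \<open>Characters of the quotient group\<close>

lemma multiples_zero: "(0 :: 'g :: ab_group_add) \<in> multiples m"
  unfolding multiples_def by (rule range_eqI[of _ _ 0]) simp

lemma multiples_add:
  assumes "x \<in> multiples m" "y \<in> multiples m"
  shows "(x + y :: 'g :: ab_group_add) \<in> multiples m"
proof -
  obtain a b where "x = (\<Sum>i<m. a)" "y = (\<Sum>i<m. b)" using assms by (auto simp: multiples_def)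
  then have "x + y = (\<Sum>i<m. a + b)" by (simp add: sum.distrib)
  then show ?thesis by (auto simp: multiples_def)
qed

lemma multiples_uminus:
  assumes "x \<in> multiples m"
  shows "(- x :: 'g :: ab_group_add) \<in> multiples m"
proof -
  obtain a where "x = (\<Sum>i<m. a)" using assms by (auto simp: multiples_def)
  then have "- x = (\<Sum>i<m. - a)" by (simp add: sum_negf)
  then show ?thesis by (auto simp: multiples_def)
qed

lemma coset_plus_coset:
  "(x +o multiples m) + (y +o multiples m) = (x + y :: 'g :: ab_group_add) +o multiples m"
proof -
  have "multiples m + multiples m = (multiples m :: 'g set)"
  proof
    show "multiples m + multiples m \<subseteq> (multiples m :: 'g set)"
      by (auto simp: set_plus_def intro: multiples_add)
    show "(multiples m :: 'g set) \<subseteq> multiples m + multiples m"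
      by (rule set_zero_plus2[OF multiples_zero])
  qed
  then show ?thesis by (simp add: set_plus_rearrange)
qed

lemma coset_eq_iff:
  "x +o multiples m = y +o multiples m \<longleftrightarrow> (x - y :: 'g :: ab_group_add) \<in> multiples m"
proof
  assume "x +o multiples m = y +o multiples m"
  moreover have "x + 0 \<in> x +o multiples m" by (rule set_plus_intro2[OF multiples_zero])
  ultimately show "x - y \<in> multiples m" by (auto intro: set_plus_imp_minus)
next
  have sub: "x +o multiples m \<subseteq> y +o multiples m" if "x - y \<in> multiples m" for x y :: 'g
  proof
    fix z assume "z \<in> x +o multiples m"
    then have "z - x \<in> multiples m" by (rule set_plus_imp_minus)
    then have "(z - x) + (x - y) \<in> multiples m" using that by (rule multiples_add)
    then show "z \<in> y +o multiples m" by (intro set_minus_imp_plus) simp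
  qed
  assume "x - y \<in> multiples m"
  moreover from this have "y - x \<in> multiples m" using multiples_uminus by fastforce
  ultimately show "x +o multiples m = y +o multiples m" using sub by (intro equalityI)
qed

text \<open>Maps with the same fibres have images in bijection; it allows cosets to be counted
  through their coordinates modulo p^n.\<close>

lemma card_range_cong:
  assumes "\<And>x y. f x = f y \<longleftrightarrow> g x = g y"
  shows "card (range f) = card (range g)" "finite (range g) \<Longrightarrow> finite (range f)"
proof -
  define h where "h y = f (inv_into UNIV g y)" for y
  have h: "h (g x) = f x" for x
    using assms[of "inv_into UNIV g (g x)" x] by (simp add: h_def f_inv_into_f)
  have "inj_on h (range g)"
    by (rule inj_onI) (auto simp: h assms)
  moreover have img: "h ` range g = range f"
    by (simp add: image_image h)
  ultimately show "card (range f) = card (range g)" using card_image[of h "range g"] by simp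
  show "finite (range g) \<Longrightarrow> finite (range f)" unfolding img[symmetric] by (rule finite_imageI)
qed

section \<open>Constant polynomials and the weighted order\<close>

lemma sum_pCons_0: "(\<Sum>x\<in>A. [:f x:]) = [:\<Sum>x\<in>A. f x:]"
  by (induction A rule: infinite_finite_induct) auto

lemma ord_star_mult: "F * G \<noteq> 0 \<Longrightarrow> ord_star P (F * G) = ord_star P F + ord_star P G"
  by (simp add: ord_star_def order_mult distrib_left sum.distrib)

lemma ord_star_1: "ord_star P 1 = 0"
  by (simp add: ord_star_def)

lemma ord_star_power: "F \<noteq> 0 \<Longrightarrow> ord_star P (F ^ k) = k * ord_star P F"
  by (induction k) (simp_all add: ord_star_1 ord_star_mult)

lemma ord_star_prod:
  "(\<And>a. a \<in> A \<Longrightarrow> F a \<noteq> 0) \<Longrightarrow> ord_star P (prod F A) = (\<Sum>a\<in>A. ord_star P (F a))"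
  by (induction A rule: infinite_finite_induct) (simp_all add: ord_star_1 ord_star_mult)

text \<open>A common root of \<open>P\<close> and \<open>F\<close> would put a linear factor into
  the gcd.\<close>

lemma ord_star_coprime:
  fixes P F :: "'a :: {field, factorial_ring_gcd, semiring_gcd_mult_normalize} poly"
  assumes "gcd P F = 1"
  shows "ord_star P F = 0"
  unfolding ord_star_def
proof (rule sum.neutral, rule ballI)
  fix \<theta> assume "\<theta> \<in> {\<theta>. poly P \<theta> = 0}"
  then have P: "[:- \<theta>, 1:] dvd P" by (simp add: poly_eq_0_iff_dvd)
  have "\<not> [:- \<theta>, 1:] dvd F"
  proof
    assume "[:- \<theta>, 1:] dvd F"
    with P have "[:- \<theta>, 1:] dvd gcd P F" by (rule gcd_greatest)
    then show False by (simp add: assms)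
  qed
  then have "order \<theta> F = 0" by (simp add: poly_eq_0_iff_dvd[symmetric] order_0I)
  then show "order \<theta> P * order \<theta> F = 0" by simp
qed

section \<open>The lattice, its finite quotient and the dual group\<close>

text \<open>\<Gamma> is an abstract group with coordinates \<phi>. As p^n \<Gamma> consists of
  p^n-fold sums, an additive bijection identifies it with the vectors divisible by p^n.\<close>

locale padic_lattice =
  fixes \<phi> :: "'g :: ab_group_add \<Rightarrow> 'd :: finite \<Rightarrow> 'p :: prime_card padic_int" and n :: nat
  assumes bij: "bij \<phi>" and add: "\<phi> (x + y) i = \<phi> x i + \<phi> y i"
begin

definition coset :: "'g \<Rightarrow> 'g set" where "coset x = x +o multiples (CARD('p) ^ n)"

lemma coset_add: "coset x + coset y = coset (x + y)"
  unfolding coset_def by (rule coset_plus_coset)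

text \<open>Natural numbers, because they serve as exponents of roots of unity.\<close>

definition residue :: "'g \<Rightarrow> 'd \<Rightarrow> nat" where
  "residue x i = nat (Rep_padic_int (\<phi> x i) n)"

lemma q_pos: "(CARD('p) ^ n) > 0"
  using prime_gt_0_nat[OF prime_card[where ?'a = 'p]] by simp

lemma preimage: obtains x where "\<phi> x = f"
proof -
  obtain x where "f = \<phi> x" using surjD[OF bij_is_surj[OF bij], of f] ..
  then show thesis using that[of x] by simp
qed

lemma zero: "\<phi> 0 i = 0"
  using add[of 0 0 i] by simp

lemma diff: "\<phi> (x - y) i = \<phi> x i - \<phi> y i"
  using add[of "x - y" y i] by (simp add: algebra_simps)

lemma multiple: "\<phi> (\<Sum>i<m. z) i = of_nat m * \<phi> z i"
  by (induction m) (simp_all add: zero add algebra_simps)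

lemma int_residue: "int (residue x i) = Rep_padic_int (\<phi> x i) n"
  using Rep_padic_int_bounds[of "\<phi> x i" n] by (simp add: residue_def)

lemma residue_less: "residue x i < (CARD('p) ^ n)"
  using Rep_padic_int_bounds[of "\<phi> x i" n] int_residue[of x i]
  by (metis of_nat_less_iff of_nat_power)

lemma residue_add: "residue (x + y) i = (residue x i + residue y i) mod (CARD('p) ^ n)"
proof -
  have "int (residue (x + y) i) = int ((residue x i + residue y i) mod (CARD('p) ^ n))"
    by (simp add: int_residue add plus_padic_int.rep_eq zmod_int)
  then show ?thesis by (simp only: of_nat_eq_iff)
qed

lemma Rep_power_mult: "Rep_padic_int (of_nat (CARD('p) ^ n) * (a :: 'p padic_int)) n = 0"
  unfolding times_padic_int.rep_eq Rep_of_nat_padic_int by simp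

text \<open>A difference with equal residues is p^n times a p-adic integer in each coordinate.
  Surjectivity of \<phi> assembles these quotients into one lattice element, and injectivity
  identifies its p^n-fold sum with the difference.\<close>

lemma coset_eq_iff_residue: "coset x = coset y \<longleftrightarrow> residue x = residue y"
proof
  assume "coset x = coset y"
  then have "x - y \<in> multiples (CARD('p) ^ n)"
    by (simp add: coset_def coset_eq_iff)
  then obtain z where "x - y = (\<Sum>i<(CARD('p) ^ n). z)"
    unfolding multiples_def by (rule rangeE)
  then have "\<phi> x i - \<phi> y i = of_nat (CARD('p) ^ n) * \<phi> z i" for i
    by (simp only: diff[symmetric] multiple)
  then have *: "Rep_padic_int (\<phi> x i - \<phi> y i) n = 0" for i
    by (simp only: Rep_power_mult)
  show "residue x = residue y"
  proof
    fix i
    have "\<phi> x i = \<phi> y i + (\<phi> x i - \<phi> y i)" by simp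
    then have "Rep_padic_int (\<phi> x i) n =
        (Rep_padic_int (\<phi> y i) n + Rep_padic_int (\<phi> x i - \<phi> y i) n) mod int CARD('p) ^ n"
      by (metis plus_padic_int.rep_eq)
    then show "residue x i = residue y i"
      using Rep_padic_int_mod[of n n "\<phi> y i"] by (simp add: residue_def *)
  qed
next
  assume eq: "residue x = residue y"
  have "\<exists>w. \<phi> x i - \<phi> y i = of_nat (CARD('p) ^ n) * w" for i
  proof -
    have "Rep_padic_int (\<phi> x i - \<phi> y i) n = 0"
      unfolding minus_padic_int.rep_eq int_residue[symmetric] eq by simp
    then obtain w where "\<phi> x i - \<phi> y i = of_nat CARD('p) ^ n * w"
      by (rule padic_int_divide_prime_power)
    then show ?thesis by (intro exI[of _ w]) simp
  qed
  from choice[OF allI[OF this]] obtain w where w: "\<forall>i. \<phi> x i - \<phi> y i = of_nat (CARD('p) ^ n) * w i" ..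
  obtain z where z: "\<phi> z = w" by (rule preimage)
  have "\<phi> (x - y) = \<phi> (\<Sum>i<(CARD('p) ^ n). z)"
  proof
    fix i show "\<phi> (x - y) i = \<phi> (\<Sum>i<(CARD('p) ^ n). z) i"
      unfolding diff multiple z using w by blast
  qed
  then have "x - y = (\<Sum>i<(CARD('p) ^ n). z)" using bij by (simp add: bij_def inj_eq)
  then have "x - y \<in> multiples (CARD('p) ^ n)" unfolding multiples_def by (rule range_eqI)
  then show "coset x = coset y" by (simp only: coset_def coset_eq_iff)
qed

lemma range_residue: "range residue = (\<Pi>\<^sub>E i\<in>UNIV. {..<(CARD('p) ^ n)})"
proof (intro equalityI subsetI)
  fix f assume f: "f \<in> (\<Pi>\<^sub>E i\<in>UNIV :: 'd set. {..<(CARD('p) ^ n)})"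
  obtain x where x: "\<phi> x = (\<lambda>i. of_nat (f i))" by (rule preimage)
  have "residue x = f"
  proof
    fix i
    have "f i < (CARD('p) ^ n)" using f by auto
    then have "int (f i) < int CARD('p) ^ n" by (metis of_nat_less_iff of_nat_power)
    then show "residue x i = f i"
      by (simp add: residue_def x Rep_of_nat_padic_int)
  qed
  then show "f \<in> range residue" by blast
qed (auto simp: residue_less)

lemma quotient_group_eq: "quotient_group (CARD('p) ^ n) = range coset"
  by (auto simp: quotient_group_def coset_def)

lemma finite_quotient_group: "finite (quotient_group (CARD('p) ^ n) :: 'g set set)"
  and card_quotient_group: "card (quotient_group (CARD('p) ^ n) :: 'g set set) = (CARD('p) ^ n) ^ CARD('d)"
proof -
  have fin: "finite (range residue)" unfolding range_residue by (intro finite_PiE) auto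
  show "finite (quotient_group (CARD('p) ^ n) :: 'g set set)"
    unfolding quotient_group_eq by (rule card_range_cong(2)[OF coset_eq_iff_residue fin])
  show "card (quotient_group (CARD('p) ^ n) :: 'g set set) = (CARD('p) ^ n) ^ CARD('d)"
    unfolding quotient_group_eq card_range_cong(1)[OF coset_eq_iff_residue] range_residue
    by (simp add: card_PiE)
qed

text \<open>The tuple \<zeta> encodes the character of \<Gamma> / p^n \<Gamma> with value
  \<open>\<zeta> i\<close> at the i-th unit vector.\<close>

definition dual :: "('d \<Rightarrow> 'p padic_closure) set" where
  "dual = {\<zeta>. \<forall>i. \<zeta> i \<in> roots_of_unity n}"

lemma finite_dual: "finite dual" and card_dual: "card dual = (CARD('p) ^ n) ^ CARD('d)"
proof -
  have dual: "dual = (\<Pi>\<^sub>E i\<in>UNIV. roots_of_unity n)"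
    by (auto simp: dual_def PiE_def)
  have card: "card (roots_of_unity n :: 'p padic_closure set) = (CARD('p) ^ n)"
    unfolding roots_of_unity_def by (rule card_nth_roots_of_unity[OF q_pos])
  then have "finite (roots_of_unity n :: 'p padic_closure set)"
    using q_pos by (metis card.infinite less_irrefl)
  then show "finite dual" unfolding dual by (intro finite_PiE) auto
  show "card dual = (CARD('p) ^ n) ^ CARD('d)" unfolding dual by (simp add: card_PiE card)
qed

definition character :: "('d \<Rightarrow> 'p padic_closure) \<Rightarrow> 'g \<Rightarrow> 'p padic_closure" where
  "character \<zeta> x = (\<Prod>i\<in>UNIV. \<zeta> i ^ residue x i)"

lemma root_power_mod:
  assumes "\<zeta> \<in> dual"
  shows "\<zeta> i ^ (k mod (CARD('p) ^ n)) = \<zeta> i ^ k"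
proof -
  have "\<zeta> i ^ (CARD('p) ^ n) = 1" using assms by (simp add: dual_def roots_of_unity_def)
  moreover have "\<zeta> i ^ k = \<zeta> i ^ ((CARD('p) ^ n) * (k div (CARD('p) ^ n)) + k mod (CARD('p) ^ n))" by simp
  ultimately show ?thesis by (simp only: power_add power_mult power_one mult_1_left)
qed

lemma character_add:
  assumes "\<zeta> \<in> dual"
  shows "character \<zeta> (x + y) = character \<zeta> x * character \<zeta> y"
  unfolding character_def residue_add root_power_mod[OF assms] power_add prod.distrib ..

lemma character_nonzero:
  assumes "\<zeta> \<in> dual"
  shows "character \<zeta> x \<noteq> 0"
proof -
  have "\<zeta> i \<noteq> 0" for i
  proof
    assume "\<zeta> i = 0"
    moreover have "\<zeta> i ^ (CARD('p) ^ n) = 1" using assms by (simp add: dual_def roots_of_unity_def)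
    ultimately show False using q_pos by (simp add: power_0_left)
  qed
  then show ?thesis by (simp add: character_def)
qed

text \<open>The choice of representative is immaterial, since \<open>character\<close> depends on an
  element through its residues.\<close>

definition coset_character :: "('d \<Rightarrow> 'p padic_closure) \<Rightarrow> 'g set \<Rightarrow> 'p padic_closure" where
  "coset_character \<zeta> c = character \<zeta> (SOME x. c = coset x)"

lemma coset_character [simp]: "coset_character \<zeta> (coset x) = character \<zeta> x"
proof -
  have "coset x = coset (SOME y. coset x = coset y)"
    by (rule someI[of "\<lambda>y. coset x = coset y"]) simp
  then show ?thesis
    by (simp add: coset_character_def character_def coset_eq_iff_residue)
qed

lemma bij_betw_translation:
  "bij_betw (\<lambda>c. c + coset x) (quotient_group (CARD('p) ^ n)) (quotient_group (CARD('p) ^ n))"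
  unfolding quotient_group_eq
  by (rule bij_betw_byWitness[where f' = "\<lambda>c. c + coset (- x)"]) (auto simp: coset_add)

text \<open>Translation by a coset on which the two characters differ multiplies the sum by a factor
  other than 1. The inverse plays the part of complex conjugation.\<close>

lemma character_orthogonality:
  assumes "\<zeta> \<in> dual" "\<zeta>' \<in> dual"
  shows "(\<Sum>c\<in>quotient_group (CARD('p) ^ n). inverse (coset_character \<zeta> c) * coset_character \<zeta>' c) =
    (if \<zeta> = \<zeta>' then of_nat ((CARD('p) ^ n) ^ CARD('d)) else 0)"
proof (cases "\<zeta> = \<zeta>'")
  case True
  have "inverse (coset_character \<zeta> c) * coset_character \<zeta> c = 1" if "c \<in> quotient_group (CARD('p) ^ n)" for c
    using that character_nonzero[OF assms(1)] by (auto simp: quotient_group_eq)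
  then show ?thesis using True by (simp add: card_quotient_group)
next
  case False
  define f where "f c = inverse (coset_character \<zeta> c) * coset_character \<zeta>' c" for c
  obtain i where i: "\<zeta> i \<noteq> \<zeta>' i" using False by auto
  \<comment> \<open>The unit vector at a coordinate where the tuples differ separates the
    characters.\<close>
  obtain x where x: "\<phi> x = (\<lambda>j. if j = i then 1 else 0)" by (rule preimage)
  have char: "character \<xi> x = \<xi> i" if "\<xi> \<in> dual" for \<xi>
  proof -
    \<comment> \<open>The residue of 1 is 1 mod p^n, which is 0 for n = 0; then every root in
      question is 1 and the value is still right.\<close>
    have "residue x j = (if j = i then 1 mod (CARD('p) ^ n) else 0)" for j
      by (simp add: residue_def x one_padic_int.rep_eq zero_padic_int.rep_eq nat_mod_distrib nat_power_eq)
    then have "character \<xi> x = \<xi> i ^ (1 mod (CARD('p) ^ n))"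
      by (simp add: character_def if_distrib[of "(^) _"] cong: if_cong)
    then show ?thesis using root_power_mod[OF that, of i 1] by simp
  qed
  have fx: "f (coset x) \<noteq> 1"
    using char[OF assms(1)] char[OF assms(2)] i character_nonzero[OF assms(1), of x]
    by (simp add: f_def field_simps)
  have "(\<Sum>c\<in>quotient_group (CARD('p) ^ n). f c) = (\<Sum>c\<in>quotient_group (CARD('p) ^ n). f (c + coset x))"
    by (rule sum.reindex_bij_betw[OF bij_betw_translation, symmetric])
  also have "\<dots> = (\<Sum>c\<in>quotient_group (CARD('p) ^ n). f c * f (coset x))"
    by (rule sum.cong)
       (auto simp: quotient_group_eq coset_add f_def character_add[OF assms(1)]
         character_add[OF assms(2)])
  also have "\<dots> = (\<Sum>c\<in>quotient_group (CARD('p) ^ n). f c) * f (coset x)"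
    by (rule sum_distrib_right[symmetric])
  finally have "(\<Sum>c\<in>quotient_group (CARD('p) ^ n). f c) * (1 - f (coset x)) = 0"
    by (simp add: right_diff_distrib)
  then show ?thesis using fx False by (simp add: f_def)
qed

end

section \<open>The derived graph\<close>

lemma (in padic_lattice) derived_graph_fin_digraph:
  fixes G :: "('v, 'e) pre_digraph" and \<alpha> :: "'e \<Rightarrow> 'g"
  assumes "fin_digraph G"
  shows "fin_digraph (derived_graph G \<alpha> (CARD('p) ^ n))"
proof -
  interpret fin_digraph G by (rule assms)
  show ?thesis
    by unfold_locales
       (auto simp: derived_graph_def quotient_group_eq coset_add coset_def[symmetric]
         intro!: finite_cartesian_product finite_quotient_group[unfolded quotient_group_eq])
qed

text \<open>The locale \<open>bidirected_digraph\<close> requires the reversal map to be the identity outside the arcs,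
  which \<open>derived_rev\<close> is not.\<close>

lemma (in padic_lattice) derived_graph_bidirected:
  fixes G :: "('v, 'e) pre_digraph" and \<alpha> :: "'e \<Rightarrow> 'g"
  assumes "fin_digraph G" and "bidirected_digraph G rv" and inv: "\<forall>e\<in>arcs G. \<alpha> (rv e) = - \<alpha> e"
  defines "H \<equiv> derived_graph G \<alpha> (CARD('p) ^ n)"
  shows "bidirected_digraph H
    (\<lambda>a. if a \<in> arcs H then derived_rev rv \<alpha> (CARD('p) ^ n) a else a)"
proof -
  interpret bidirected_digraph G rv by (rule assms(2))
  interpret H: fin_digraph H unfolding H_def by (rule derived_graph_fin_digraph[OF assms(1)])
  have rev: "derived_rev rv \<alpha> (CARD('p) ^ n) (e, coset x) = (rv e, coset (x + \<alpha> e))" for e x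
    by (simp add: derived_rev_def coset_def[symmetric] coset_add)
  have in_arcs: "a \<in> arcs H \<longleftrightarrow> (\<exists>e x. a = (e, coset x) \<and> e \<in> arcs G)" for a
    by (cases a) (auto simp: H_def derived_graph_def quotient_group_eq)
  show ?thesis
  proof (rule H.bidirected_digraphI)
    fix a assume "a \<in> arcs H"
    then obtain e x where a: "a = (e, coset x)" "e \<in> arcs G" by (auto simp: in_arcs)
    have arcs: "(e, coset x) \<in> arcs H" "(rv e, coset (x + \<alpha> e)) \<in> arcs H"
      using a(2) by (auto simp: in_arcs)
    show "(if a \<in> arcs H then derived_rev rv \<alpha> (CARD('p) ^ n) a else a) \<noteq> a"
      using arcs arev_neq[OF a(2)] by (simp add: a(1) rev)
    show "(if (if a \<in> arcs H then derived_rev rv \<alpha> (CARD('p) ^ n) a else a) \<in> arcs H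
        then derived_rev rv \<alpha> (CARD('p) ^ n) (if a \<in> arcs H then derived_rev rv \<alpha> (CARD('p) ^ n) a else a)
        else (if a \<in> arcs H then derived_rev rv \<alpha> (CARD('p) ^ n) a else a)) = a"
      using arcs inv a(2) by (simp add: a(1) rev)
    show "tail H (if a \<in> arcs H then derived_rev rv \<alpha> (CARD('p) ^ n) a else a) = head H a"
      using arcs(1) a(2)
      by (simp add: a(1) rev) (simp add: H_def derived_graph_def coset_def[symmetric] coset_add)
  qed simp
qed

text \<open>Exactly one arc leaves (v, c) over each arc leaving v, so the weights 2 / d_v upstairs
  are those of \<open>G\<close>.\<close>

lemma (in padic_lattice) out_degree_derived_graph:
  fixes G :: "('v, 'e) pre_digraph" and \<alpha> :: "'e \<Rightarrow> 'g"
  assumes "c \<in> quotient_group (CARD('p) ^ n)"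
  shows "out_degree (derived_graph G \<alpha> (CARD('p) ^ n)) (v, c) = out_degree G v"
proof -
  have "out_arcs (derived_graph G \<alpha> (CARD('p) ^ n)) (v, c) = (\<lambda>e. (e, c)) ` out_arcs G v"
    using assms by (auto simp: derived_graph_def out_arcs_def)
  then show ?thesis
    by (simp add: out_degree_def card_image inj_on_def)
qed

text \<open>One shape for both sides of the block diagonalisation: \<omega> is 1 on the derived
  graph and consists of the values of a character on \<open>G\<close>.\<close>

definition twisted_poly_mat ::
    "('v, 'e) pre_digraph \<Rightarrow> ('e \<Rightarrow> 'a) \<Rightarrow> 'v list \<Rightarrow> 'a :: field poly mat" where
  "twisted_poly_mat G \<omega> vs = imat vs vs (\<lambda>v w. (if v = w then [:1, 0, 1:] else 0) -
     [:0, 1:] * [:\<Sum>e | e \<in> arcs G \<and> tail G e = v \<and> head G e = w.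
       2 / of_nat (out_degree G v) * \<omega> e:])"

text \<open>The value of \<open>tau\<close> at \<zeta> - 1 is a product of powers of the
  \<open>\<zeta> i\<close> with the residues as exponents, which is \<open>character\<close> by
  definition. Entrywise values then pass to the determinant.\<close>

lemma (in padic_lattice) specialize_spectral_poly:
  fixes G :: "('v, 'e) pre_digraph" and \<alpha> :: "'e \<Rightarrow> 'g"
  assumes "\<zeta> \<in> dual" and "distinct vs"
  shows "specialize (spectral_poly G (\<lambda>e. \<phi> (\<alpha> e)) vs) (\<lambda>i. \<zeta> i - 1) =
    det (twisted_poly_mat G (\<lambda>e. character \<zeta> (\<alpha> e)) vs)"
proof (rule specialize_eq)
  let ?t = "\<lambda>i. \<zeta> i - 1"
  have root: "\<zeta> i \<in> roots_of_unity n" for i using assms(1) by (simp add: dual_def)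
  show "poly_has_value (spectral_poly G (\<lambda>e. \<phi> (\<alpha> e)) vs) ?t
    (det (twisted_poly_mat G (\<lambda>e. character \<zeta> (\<alpha> e)) vs))"
    unfolding spectral_poly_def
  proof (rule poly_has_value_det[where n = "length vs"])
    fix i j assume ij: "i < length vs" "j < length vs"
    define W where "W = (\<Sum>e | e \<in> arcs G \<and> tail G e = vs ! i \<and> head G e = vs ! j.
      mfps_const (2 / of_nat (out_degree G (tail G e))) * tau (\<phi> (\<alpha> e)))"
    define W' where "W' = (\<Sum>e | e \<in> arcs G \<and> tail G e = vs ! i \<and> head G e = vs ! j.
      2 / of_nat (out_degree G (vs ! i)) * character \<zeta> (\<alpha> e))"
    have W: "mfps_has_value W ?t W'"
      unfolding W_def W'_def
    proof (rule mfps_has_value_sum)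
      fix e assume "e \<in> {e. e \<in> arcs G \<and> tail G e = vs ! i \<and> head G e = vs ! j}"
      moreover have "mfps_has_value (mfps_const (2 / of_nat (out_degree G (tail G e))) * tau (\<phi> (\<alpha> e))) ?t
          (to_ac (2 / of_nat (out_degree G (tail G e))) * character \<zeta> (\<alpha> e))"
        unfolding character_def residue_def
        by (intro mfps_has_value_mult mfps_has_value_const mfps_has_value_tau root)
      ultimately show "mfps_has_value (mfps_const (2 / of_nat (out_degree G (tail G e))) * tau (\<phi> (\<alpha> e))) ?t
          (2 / of_nat (out_degree G (vs ! i)) * character \<zeta> (\<alpha> e))"
        by simp
    qed
    have "poly_has_value ((if i = j then [:1, 0, 1:] else 0) - [:0, 1:] * [:W:]) ?t
        ((if i = j then [:1, 0, 1:] else 0) - [:0, 1:] * [:W':])"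
    proof (intro poly_has_value_diff poly_has_value_mult)
      show "poly_has_value (if i = j then [:1, 0, 1:] else 0) ?t (if i = j then [:1, 0, 1:] else 0)"
        by (simp add: poly_has_value_0 poly_has_value_pCons mfps_has_value_0 mfps_has_value_1)
      show "poly_has_value [:0, 1:] ?t [:0, 1:]"
        by (intro poly_has_value_0 poly_has_value_pCons mfps_has_value_0 mfps_has_value_1)
      show "poly_has_value [:W:] ?t [:W':]"
        by (intro poly_has_value_0 poly_has_value_pCons W)
    qed
    moreover have "([:1, 0, 1:] \<cdot>\<^sub>m 1\<^sub>m (length vs) - [:0, 1:] \<cdot>\<^sub>m
        map_mat (\<lambda>c. [:c:]) (twisted_weight_matrix G (\<lambda>e. \<phi> (\<alpha> e)) vs)) $$ (i, j) =
        (if i = j then [:1, 0, 1:] else 0) - [:0, 1:] * [:W:]"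
      using ij by (simp add: twisted_weight_matrix_def W_def one_pCons)
    moreover have "twisted_poly_mat G (\<lambda>e. character \<zeta> (\<alpha> e)) vs $$ (i, j) =
        (if i = j then [:1, 0, 1:] else 0) - [:0, 1:] * [:W':]"
      using ij by (simp add: twisted_poly_mat_def W'_def nth_eq_iff_index_eq[OF assms(2)])
    ultimately show "poly_has_value (([:1, 0, 1:] \<cdot>\<^sub>m 1\<^sub>m (length vs) - [:0, 1:] \<cdot>\<^sub>m
        map_mat (\<lambda>c. [:c:]) (twisted_weight_matrix G (\<lambda>e. \<phi> (\<alpha> e)) vs)) $$ (i, j)) ?t
        (twisted_poly_mat G (\<lambda>e. character \<zeta> (\<alpha> e)) vs $$ (i, j))"
      by (simp only:)
  qed (auto simp: twisted_poly_mat_def twisted_weight_matrix_def intro!: carrier_matI)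
qed

text \<open>An arc over e leads from (v, g) to (w, h) exactly if h is g plus the coset of \<alpha>
  e, so entries depend on g and h through their difference and characters split the matrix. The swap
  puts the group coordinate first, where the blocks become consecutive.\<close>

lemma (in padic_lattice) det_derived_graph:
  fixes G :: "('v, 'e) pre_digraph" and \<alpha> :: "'e \<Rightarrow> 'g"
  assumes fin: "fin_digraph G" and vs: "distinct vs" "set vs = verts G"
    and gs: "distinct gs" "set gs = quotient_group (CARD('p) ^ n)"
  defines "H \<equiv> derived_graph G \<alpha> (CARD('p) ^ n)"
  shows "det (twisted_poly_mat H (\<lambda>_. 1 :: 'p padic_closure) (map prod.swap (List.product gs vs))) =
    (\<Prod>\<zeta>\<in>dual. det (twisted_poly_mat G (\<lambda>e. character \<zeta> (\<alpha> e)) vs))"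
proof -
  interpret fin_digraph G by (rule fin)
  define a :: "'v \<Rightarrow> 'p padic_closure" where "a v = 2 / of_nat (out_degree G v)" for v
  define E where "E v w = {e \<in> arcs G. tail G e = v \<and> head G e = w}" for v w
  have finE: "finite (E v w)" for v w by (simp add: E_def)
  define M :: "'g set \<Rightarrow> 'v \<Rightarrow> 'g set \<Rightarrow> 'v \<Rightarrow> 'p padic_closure poly" where
    "M g v h w = (if g = h then (if v = w then [:1, 0, 1:] else 0) else 0) -
       [:0, 1:] * [:\<Sum>e\<in>E v w. if g + coset (\<alpha> e) = h then a v else 0:]" for g v h w
  define F :: "('d \<Rightarrow> 'p padic_closure) \<Rightarrow> 'v \<Rightarrow> 'v \<Rightarrow> 'p padic_closure poly" where
    "F \<zeta> v w = (if v = w then [:1, 0, 1:] else 0) -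
       [:0, 1:] * [:\<Sum>e\<in>E v w. a v * character \<zeta> (\<alpha> e):]" for \<zeta> v w
  obtain zs where zs: "distinct zs" "set zs = dual"
    using finite_distinct_list[OF finite_dual] by blast
  have "twisted_poly_mat H (\<lambda>_. 1 :: 'p padic_closure) (map prod.swap (List.product gs vs)) =
      imat (List.product gs vs) (List.product gs vs) (\<lambda>(g, v) (h, w). M g v h w)"
    unfolding twisted_poly_mat_def imat_map
  proof (rule imat_cong)
    fix x y assume *: "x \<in> set (List.product gs vs)" "y \<in> set (List.product gs vs)"
    obtain g v h w where xy: "x = (g, v)" "y = (h, w)" by (cases x, cases y)
    have g: "g \<in> quotient_group (CARD('p) ^ n)" using *(1) gs(2) by (simp add: xy)
    have "{e \<in> arcs H. tail H e = (v, g) \<and> head H e = (w, h)} =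
        (\<lambda>e. (e, g)) ` {e \<in> E v w. g + coset (\<alpha> e) = h}"
      using g by (auto simp: H_def derived_graph_def E_def coset_def)
    then have "(\<Sum>e | e \<in> arcs H \<and> tail H e = (v, g) \<and> head H e = (w, h).
        2 / of_nat (out_degree H (v, g)) * (1 :: 'p padic_closure)) =
        (\<Sum>e\<in>{e \<in> E v w. g + coset (\<alpha> e) = h}. a v)"
      using g by (simp add: card_image inj_on_def H_def out_degree_derived_graph a_def)
    also have "\<dots> = (\<Sum>e\<in>E v w. if g + coset (\<alpha> e) = h then a v else 0)"
      by (rule sum.inter_filter[OF finE])
    finally show "(if prod.swap x = prod.swap y then [:1, 0, 1:] else 0) - [:0, 1:] *
        [:\<Sum>e | e \<in> arcs H \<and> tail H e = prod.swap x \<and> head H e = prod.swap y.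
          2 / of_nat (out_degree H (prod.swap x)) * (1 :: 'p padic_closure):] =
        (case x of (g, v) \<Rightarrow> \<lambda>(h, w). M g v h w) y"
      unfolding xy M_def by (auto simp del: sum_constant)
  qed
  also have "det \<dots> = (\<Prod>\<zeta>\<in>set zs. det (imat vs vs (F \<zeta>)))"
  \<comment> \<open>The matrices have polynomial entries, so character values enter as constant
    polynomials.\<close>
  proof (rule det_imat_fourier[where \<chi> = "\<lambda>\<zeta> c. [:coset_character \<zeta> c:]"
        and \<chi>' = "\<lambda>\<zeta> c. [:inverse (coset_character \<zeta> c):]" and q = "[:of_nat ((CARD('p) ^ n) ^ CARD('d)):]"])
    show "length gs = length zs"
      using distinct_card[OF gs(1)] distinct_card[OF zs(1)]
      by (simp add: gs(2) zs(2) card_quotient_group card_dual)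
    show "[:of_nat ((CARD('p) ^ n) ^ CARD('d)):] \<noteq> (0 :: 'p padic_closure poly)"
      using prime_gt_0_nat[OF prime_card[where ?'a = 'p]] by simp
    fix \<zeta> assume z: "\<zeta> \<in> set zs"
    then have \<zeta>: "\<zeta> \<in> dual" by (simp add: zs)
    {
      fix \<zeta>' assume "\<zeta>' \<in> set zs"
      then have \<zeta>': "\<zeta>' \<in> dual" by (simp add: zs)
      have "[:inverse (coset_character \<zeta> g):] * [:coset_character \<zeta>' g:] =
          [:inverse (coset_character \<zeta> g) * coset_character \<zeta>' g:]" for g by simp
      then have "(\<Sum>g\<in>set gs. [:inverse (coset_character \<zeta> g):] * [:coset_character \<zeta>' g:]) =
          [:\<Sum>g\<in>set gs. inverse (coset_character \<zeta> g) * coset_character \<zeta>' g:]"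
        by (simp only: sum_pCons_0)
      also have "\<dots> = [:if \<zeta> = \<zeta>' then of_nat ((CARD('p) ^ n) ^ CARD('d)) else 0:]"
        by (simp only: gs(2) character_orthogonality[OF \<zeta> \<zeta>'])
      finally show "(\<Sum>g\<in>set gs. [:inverse (coset_character \<zeta> g):] * [:coset_character \<zeta>' g:]) =
          (if \<zeta> = \<zeta>' then [:of_nat ((CARD('p) ^ n) ^ CARD('d)):] else 0)"
        by simp
    }
    fix g v w assume g: "g \<in> set gs"
    then obtain x where x: "g = coset x" by (auto simp: gs(2) quotient_group_eq)
    have "(\<Sum>h\<in>set gs. M g v h w * [:coset_character \<zeta> h:]) =
        (\<Sum>h\<in>set gs. (if g = h then (if v = w then [:1, 0, 1:] else 0) * [:coset_character \<zeta> h:] else 0)) -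
        [:0, 1:] * (\<Sum>h\<in>set gs. [:\<Sum>e\<in>E v w. if g + coset (\<alpha> e) = h then a v * coset_character \<zeta> h else 0:])"
      unfolding sum_distrib_left sum_subtractf[symmetric]
    proof (rule sum.cong[OF refl])
      fix h
      have "(\<Sum>e\<in>E v w. if g + coset (\<alpha> e) = h then a v * coset_character \<zeta> h else 0) =
          (\<Sum>e\<in>E v w. if g + coset (\<alpha> e) = h then a v else 0) * coset_character \<zeta> h"
        unfolding sum_distrib_right by (rule sum.cong) auto
      then show "M g v h w * [:coset_character \<zeta> h:] =
          (if g = h then (if v = w then [:1, 0, 1:] else 0) * [:coset_character \<zeta> h:] else 0) -
          [:0, 1:] * [:\<Sum>e\<in>E v w. if g + coset (\<alpha> e) = h then a v * coset_character \<zeta> h else 0:]"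
        by (auto simp: M_def)
    qed
    also have "(\<Sum>h\<in>set gs. [:\<Sum>e\<in>E v w. if g + coset (\<alpha> e) = h then a v * coset_character \<zeta> h else 0:]) =
        [:\<Sum>e\<in>E v w. \<Sum>h\<in>set gs. if g + coset (\<alpha> e) = h then a v * coset_character \<zeta> h else 0:]"
      unfolding sum_pCons_0 by (subst sum.swap) simp
    \<comment> \<open>The inner sum selects h = g + \<alpha> e, where the character is
      multiplicative.\<close>
    also have "(\<Sum>e\<in>E v w. \<Sum>h\<in>set gs. if g + coset (\<alpha> e) = h then a v * coset_character \<zeta> h else 0) =
        (\<Sum>e\<in>E v w. a v * (character \<zeta> x * character \<zeta> (\<alpha> e)))"
    proof (rule sum.cong[OF refl])
      fix e
      have "g + coset (\<alpha> e) \<in> set gs" by (simp add: x gs(2) coset_add quotient_group_eq)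
      then show "(\<Sum>h\<in>set gs. if g + coset (\<alpha> e) = h then a v * coset_character \<zeta> h else 0) =
          a v * (character \<zeta> x * character \<zeta> (\<alpha> e))"
        by (simp add: x coset_add character_add[OF \<zeta>])
    qed
    also have "\<dots> = character \<zeta> x * (\<Sum>e\<in>E v w. a v * character \<zeta> (\<alpha> e))"
      by (simp add: sum_distrib_left mult_ac)
    also have "(\<Sum>h\<in>set gs. (if g = h then (if v = w then [:1, 0, 1:] else 0) * [:coset_character \<zeta> h:] else 0)) =
        (if v = w then [:1, 0, 1:] else 0) * [:character \<zeta> x:]"
      using g by (simp add: x)
    finally show "(\<Sum>h\<in>set gs. M g v h w * [:coset_character \<zeta> h:]) = [:coset_character \<zeta> g:] * F \<zeta> v w"
      by (simp add: F_def x algebra_simps)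
  qed (use gs zs vs in auto)
  also have "\<dots> = (\<Prod>\<zeta>\<in>dual. det (twisted_poly_mat G (\<lambda>e. character \<zeta> (\<alpha> e)) vs))"
    unfolding zs(2)
  proof (rule prod.cong[OF refl])
    fix \<zeta>
    have "imat vs vs (F \<zeta>) = twisted_poly_mat G (\<lambda>e. character \<zeta> (\<alpha> e)) vs"
      unfolding twisted_poly_mat_def by (rule imat_cong) (simp add: F_def E_def a_def)
    then show "det (imat vs vs (F \<zeta>)) = det (twisted_poly_mat G (\<lambda>e. character \<zeta> (\<alpha> e)) vs)"
      by simp
  qed
  finally show ?thesis .
qed

theorem theorem6p1:
  fixes G :: "('v, 'e) pre_digraph"
    and rv :: "'e \<Rightarrow> 'e"
    and \<phi> :: "'g :: ab_group_add \<Rightarrow> 'd :: finite \<Rightarrow> 'p :: prime_card padic_int"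
    and \<alpha> :: "'e \<Rightarrow> 'g"
    and K :: "'p padic_closure set"
    and P :: "'p padic_closure poly"
    and n :: nat
    and vs :: "'v list"
    and es :: "('e \<times> 'g set) list"
  defines "p \<equiv> CARD('p)"
  defines "q\<^sub>n \<equiv> p ^ (CARD('d) * n)"
  defines "G\<^sub>n \<equiv> derived_graph G \<alpha> (p ^ n)"
  defines "U\<^sub>n \<equiv> (grover_matrix G\<^sub>n (derived_rev rv \<alpha> (p ^ n)) es :: 'p padic_closure mat)"
  defines "F\<^sub>X \<equiv> spectral_poly G (\<lambda>e. \<phi> (\<alpha> e)) vs"
  defines "m\<^sub>n \<equiv> ord_star P (char_poly U\<^sub>n)"
  assumes "fin_digraph G" and "bidirected_digraph G rv" and "Digraph_Component.connected G"
    and "\<forall>v\<in>verts G. out_degree G v \<ge> 1"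
    and "bij \<phi>" and "\<forall>x y i. \<phi> (x + y) i = \<phi> x i + \<phi> y i"
    and "\<forall>e\<in>arcs G. \<alpha> (rv e) = - \<alpha> e"
    and "distinct vs" and "set vs = verts G"
    and "distinct es" and "set es = arcs G\<^sub>n"
    and "finite_extension_of_Qp K"
    and "\<forall>i. coeff P i \<in> K" and "lead_coeff P = 1"
  shows "int m\<^sub>n = - int q\<^sub>n * euler_char G * int (ord_star P [:-1, 0, 1:]) +
           (\<Sum>\<zeta> | \<forall>i. \<zeta> i \<in> roots_of_unity n. int (ord_star P (specialize F\<^sub>X (\<lambda>i. \<zeta> i - 1))))
       \<and> (gcd P [:-1, 0, 1:] = 1 \<longrightarrow>
           m\<^sub>n = (\<Sum>\<zeta> | \<forall>i. \<zeta> i \<in> roots_of_unity n. ord_star P (specialize F\<^sub>X (\<lambda>i. \<zeta> i - 1))))"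
proof -
  interpret padic_lattice \<phi> n
    by unfold_locales (use \<open>bij \<phi>\<close> \<open>\<forall>x y i. \<phi> (x + y) i = \<phi> x i + \<phi> y i\<close> in auto)
  interpret G: fin_digraph G by (rule \<open>fin_digraph G\<close>)
  interpret G: bidirected_digraph G rv by (rule \<open>bidirected_digraph G rv\<close>)
  define c :: "'p padic_closure poly" where "c = [:-1, 0, 1:]"
  define o\<^sub>c where "o\<^sub>c = ord_star P c"
  define l where "l = card (arcs G) div 2"
  define D where "D \<zeta> = det (twisted_poly_mat G (\<lambda>e. character \<zeta> (\<alpha> e)) vs)" for \<zeta>
  have c0: "c \<noteq> 0" by (simp add: c_def)
  have G\<^sub>n: "G\<^sub>n = derived_graph G \<alpha> (CARD('p) ^ n)" by (simp add: G\<^sub>n_def p_def)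
  have q\<^sub>n: "q\<^sub>n = (CARD('p) ^ n) ^ CARD('d)"
    by (simp add: q\<^sub>n_def p_def power_mult[symmetric] mult.commute)
  have verts: "verts G\<^sub>n = verts G \<times> quotient_group (CARD('p) ^ n)"
    and arcs: "arcs G\<^sub>n = arcs G \<times> quotient_group (CARD('p) ^ n)"
    by (simp_all add: G\<^sub>n derived_graph_def)
  define rv\<^sub>n where "rv\<^sub>n a = (if a \<in> arcs G\<^sub>n then derived_rev rv \<alpha> (CARD('p) ^ n) a else a)" for a
  have fin: "fin_digraph G\<^sub>n"
    unfolding G\<^sub>n by (rule derived_graph_fin_digraph[OF \<open>fin_digraph G\<close>])
  have bid: "bidirected_digraph G\<^sub>n rv\<^sub>n"
    unfolding rv\<^sub>n_def G\<^sub>n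
    by (rule derived_graph_bidirected[OF \<open>fin_digraph G\<close> \<open>bidirected_digraph G rv\<close>
          \<open>\<forall>e\<in>arcs G. \<alpha> (rv e) = - \<alpha> e\<close>])
  have deg: "out_degree G\<^sub>n x \<noteq> 0" if "x \<in> verts G\<^sub>n" for x
  proof -
    obtain v g where x: "x = (v, g)" by (cases x)
    then have "v \<in> verts G" "g \<in> quotient_group (CARD('p) ^ n)" using that by (simp_all add: verts)
    then show ?thesis
      using \<open>\<forall>v\<in>verts G. out_degree G v \<ge> 1\<close> by (auto simp: x G\<^sub>n out_degree_derived_graph)
  qed
  obtain gs where gs: "distinct gs" "set gs = (quotient_group (CARD('p) ^ n) :: 'g set set)"
    using finite_distinct_list[OF finite_quotient_group] by blast
  define vs\<^sub>n where "vs\<^sub>n = map prod.swap (List.product gs vs)"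
  have vs\<^sub>n: "distinct vs\<^sub>n" "set vs\<^sub>n = verts G\<^sub>n"
    using gs \<open>distinct vs\<close> \<open>set vs = verts G\<close>
    by (auto simp: vs\<^sub>n_def verts distinct_map distinct_product inj_on_def)
  \<comment> \<open>Entries evaluate the reversal at arcs, where \<open>rv\<^sub>n\<close> and
    \<open>derived_rev\<close> agree.\<close>
  have U\<^sub>n: "U\<^sub>n = grover_matrix G\<^sub>n rv\<^sub>n es"
    unfolding U\<^sub>n_def grover_matrix_def p_def
  proof (rule cong_mat[OF refl refl])
    fix i j assume "i < length es" "j < length es"
    then have "es ! i \<in> arcs G\<^sub>n" using \<open>set es = arcs G\<^sub>n\<close> nth_mem by blast
    then show "(case (i, j) of (i, j) \<Rightarrow> let e = es ! i; f = es ! j in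
          if head G\<^sub>n f = tail G\<^sub>n e
          then 2 / of_nat (out_degree G\<^sub>n (head G\<^sub>n f)) -
            (if f = derived_rev rv \<alpha> (CARD('p) ^ n) e then 1 else 0) else 0) =
        (case (i, j) of (i, j) \<Rightarrow> let e = es ! i; f = es ! j in
          if head G\<^sub>n f = tail G\<^sub>n e
          then 2 / of_nat (out_degree G\<^sub>n (head G\<^sub>n f)) -
            (if f = rv\<^sub>n e then 1 else 0 :: 'p padic_closure) else 0)"
      by (simp add: rv\<^sub>n_def Let_def)
  qed
  \<comment> \<open>Evenness lets the halving commute with multiplication by
    \<open>q\<^sub>n\<close>.\<close>
  have "even (card (arcs G))"
    using involution_half[of "arcs G" rv] G.arev_neq by auto
  then have l: "card (arcs G\<^sub>n) div 2 = l * q\<^sub>n"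
    unfolding arcs card_cartesian_product card_quotient_group q\<^sub>n l_def by (auto elim!: evenE)
  have v: "card (verts G\<^sub>n) = card (verts G) * q\<^sub>n"
    unfolding verts card_cartesian_product card_quotient_group q\<^sub>n ..
  have "char_poly U\<^sub>n * c ^ card (verts G\<^sub>n) = c ^ (card (arcs G\<^sub>n) div 2) *
      det (twisted_poly_mat G\<^sub>n (\<lambda>_. 1) vs\<^sub>n)"
    unfolding U\<^sub>n c_def twisted_poly_mat_def mult_1_right
    by (rule grover_char_poly[OF fin bid deg vs\<^sub>n \<open>distinct es\<close> \<open>set es = arcs G\<^sub>n\<close>])
  also have "det (twisted_poly_mat G\<^sub>n (\<lambda>_. 1 :: 'p padic_closure) vs\<^sub>n) = prod D dual"
    unfolding D_def G\<^sub>n vs\<^sub>n_def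
    by (rule det_derived_graph[OF \<open>fin_digraph G\<close> \<open>distinct vs\<close> \<open>set vs = verts G\<close> gs])
  finally have eq: "char_poly U\<^sub>n * c ^ (card (verts G) * q\<^sub>n) = c ^ (l * q\<^sub>n) * prod D dual"
    unfolding l v .
  have "U\<^sub>n \<in> carrier_mat (length es) (length es)" by (simp add: U\<^sub>n_def grover_matrix_def)
  then have "char_poly U\<^sub>n \<noteq> 0" using degree_monic_char_poly[of U\<^sub>n "length es"] by auto
  then have nz: "char_poly U\<^sub>n * c ^ (card (verts G) * q\<^sub>n) \<noteq> 0" using c0 by simp
  \<comment> \<open>A monic characteristic polynomial is nonzero, so the right-hand side is as well;
    hence no block determinant vanishes and orders add up.\<close>
  then have nz': "c ^ (l * q\<^sub>n) * prod D dual \<noteq> 0" by (simp only: eq not_False_eq_True)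
  then have D0: "D \<zeta> \<noteq> 0" if "\<zeta> \<in> dual" for \<zeta>
    using that finite_dual by auto
  have "ord_star P (char_poly U\<^sub>n * c ^ (card (verts G) * q\<^sub>n)) = m\<^sub>n + card (verts G) * q\<^sub>n * o\<^sub>c"
    by (simp only: ord_star_mult[OF nz] ord_star_power[OF c0] m\<^sub>n_def o\<^sub>c_def)
  moreover have "ord_star P (c ^ (l * q\<^sub>n) * prod D dual) = l * q\<^sub>n * o\<^sub>c + (\<Sum>\<zeta>\<in>dual. ord_star P (D \<zeta>))"
    by (simp only: ord_star_mult[OF nz'] ord_star_power[OF c0] ord_star_prod[OF D0] o\<^sub>c_def)
  \<comment> \<open>An equation of natural numbers without subtraction, as \<open>l\<close> may be
    smaller than the number of vertices.\<close>
  ultimately have ord: "m\<^sub>n + card (verts G) * q\<^sub>n * o\<^sub>c = l * q\<^sub>n * o\<^sub>c + (\<Sum>\<zeta>\<in>dual. ord_star P (D \<zeta>))"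
    by (simp only: eq)
  have S: "(\<Sum>\<zeta> | \<forall>i. \<zeta> i \<in> roots_of_unity n. ord_star P (specialize F\<^sub>X (\<lambda>i. \<zeta> i - 1))) =
      (\<Sum>\<zeta>\<in>dual. ord_star P (D \<zeta>))"
    unfolding dual_def[symmetric] F\<^sub>X_def D_def
    by (rule sum.cong[OF refl]) (simp only: specialize_spectral_poly[OF _ \<open>distinct vs\<close>])
  have "int m\<^sub>n + int (card (verts G)) * int q\<^sub>n * int o\<^sub>c =
      int l * int q\<^sub>n * int o\<^sub>c + int (\<Sum>\<zeta>\<in>dual. ord_star P (D \<zeta>))"
    using arg_cong[OF ord, of int] by (simp only: of_nat_add of_nat_mult)
  \<comment> \<open>The difference of \<open>l\<close> and the number of vertices is minus the Euler
    characteristic.\<close>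
  then have main: "int m\<^sub>n = - int q\<^sub>n * euler_char G * int o\<^sub>c + int (\<Sum>\<zeta>\<in>dual. ord_star P (D \<zeta>))"
    by (simp add: euler_char_def l_def algebra_simps)
  have "gcd P c = 1 \<longrightarrow> m\<^sub>n = (\<Sum>\<zeta>\<in>dual. ord_star P (D \<zeta>))"
  proof
    assume "gcd P c = 1"
    then have "o\<^sub>c = 0" unfolding o\<^sub>c_def by (rule ord_star_coprime)
    then show "m\<^sub>n = (\<Sum>\<zeta>\<in>dual. ord_star P (D \<zeta>))" using ord by simp
  qed
  from conjI[OF main this] show ?thesis
    unfolding of_nat_sum[symmetric] S o\<^sub>c_def c_def .
qed

end
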